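(* Let $(\lambda_T)$ be a sequence of probability measures on $X$, indexed by a scale parameter $T$. Assume that, for each $T$, its height pushforward admits a finite rooted shadow decomposition $$(h_K)_*\lambda_T=\sum_{\ell=1}^{L_T}c_{\ell,T}\,\mu^{\varepsilon_{\ell,T}}_{k_{\ell,T},D_{\ell,T}},\qquad c_{\ell,T}\ge0,\qquad \sum_{\ell=1}^{L_T}c_{\ell,T}=1,$$ where each component has admissible parity ($k_{\ell,T}+D_{\ell,T}$ even), $\varepsilon_{\ell,T}\in\{\mathrm{fwd},\mathrm{bwd}\}$, $k_{\ell,T},D_{\ell,T}\ge0$ are integers, and $k_{\ell,T}\ge1$ whenever $\varepsilon_{\ell,T}=\mathrm{fwd}$. Define $M_T=\min_{1\le\ell\le L_T}(D_{\ell,T}-k_{\ell,T})$ and assume $M_T\ge0$. Then for every bounded right $K$-invariant observable $f(\Gamma g)=\Phi(h_K(\Gamma g))$, $$\left|\int_X f\,d\lambda_T-\int_X f\,d\mu_X\right|\ll_q \|\Phi\|_\infty q^{-M_T/2}.$$ If all shadow components are backward components, the sharper bound $O_q(\|\Phi\|_\infty q^{-M_T})$ holds. In particular, if $M_T\to\infty$, then $\int_X f\,d\lambda_T\to\int_X f\,d\mu_X$ for every bounded right $K$-invariant function $f$.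
   Context: Let $q$ be a prime power, $F=\mathbb F_q((t^{-1}))$, $\mathcal O=\mathbb F_q[[t^{-1}]]$, $\pi=t^{-1}$, $G=\mathrm{SL}_2(F)$, $\Gamma=\mathrm{SL}_2(\mathbb F_q[t])$, $K=\mathrm{SL}_2(\mathcal O)$, $X=\Gamma\backslash G$, and let $\mu_X$ be the normalized $G$-invariant probability measure on $X$. $\mathcal T$ is the Bruhat--Tits tree of $\mathrm{PGL}_2(F)$: vertices are homothety classes $[L]$ of $\mathcal O$-lattices in $F^2$, adjacent if representatives can be chosen with $\pi L\subsetneq L'\subsetneq L$, $L/L'\simeq\mathbb F_q$; it is $(q+1)$-regular. Put $v_n=[\mathrm{diag}(t^n,1)]\cdot[\mathcal O^2]$, $n\ge 0$. The quotient of $\mathcal T$ by $\mathrm{PGL}_2(\mathbb F_q[t])$ is a ray represented by $v_0-v_1-v_2-\cdots$, and the height $h(v)$ of a vertex is the $n$ for which $v$ lies in the $\mathrm{PGL}_2(\mathbb F_q[t])$-orbit of $v_n$. All neighbors of a height-$0$ vertex have height $1$; a vertex of height $k\ge1$ has exactly one neighbor of height $k+1$ and exactly $q$ of height $k-1$. The spherical height map is $h_K:X\to2\mathbb Z_{\ge0}$, $h_K(\Gamma g)=h(g v_0)$; it is well defined and right $K$-invariant, and every right $K$-invariant function on $X$ is $\Phi\circ h_K$ for some profile $\Phi:2\mathbb Z_{\ge0}\to\mathbb C$. An oriented edge $e=(z_{-1},z_0)$ with $h(z_0)=k$ is forward (state $(\mathrm{fwd},k)$, $k\ge 1$) if $h(z_{-1})=k-1$,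 and backward (state $(\mathrm{bwd},k)$, $k\ge0$) if $h(z_{-1})=k+1$. For $N\ge0$, $\mathrm{Desc}_N(e)$ is the set of terminal vertices $z_N$ of non-backtracking paths $z_{-1}\to z_0\to\cdots\to z_N$; it has $q^N$ elements. $\mu^{\varepsilon}_{k,N}(j)$ is $q^{-N}$ times the number of vertices of height $j$ in $\mathrm{Desc}_N(e)$ for $e$ in state $(\varepsilon,k)$; this depends only on the state. $A\ll_q B$ means $|A|\le C'B$ with $C'$ depending only on $q$ (and similarly $O_q$). *)

theory Defs
  imports "HOL-Probability.Probability" "HOL-Computational_Algebra.Computational_Algebra"
begin

text \<open>
  Throughout, \<open>'a\<close> is a finite field, \<open>q = CARD('a)\<close>, and \<open>F = 'a fls\<close> with
  \<open>fls_X\<close> playing the role of the uniformizer \<open>\<pi> = 1/t\<close>; hence \<open>t = fls_X_inv\<close>.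
  The library metric on \<open>'a fls\<close> induces the \<open>\<pi>\<close>-adic topology, and \<open>'a fls^2^2\<close>
  carries the product topology.
\<close>

type_synonym 'a mat2 = "'a fls ^ 2 ^ 2"
type_synonym 'a lat = "('a fls ^ 2) set"
type_synonym 'a vertex = "'a lat set"
type_synonym 'a quot = "'a mat2 set"

definition integer_ring :: "'a::{field,finite} fls set" where
  "integer_ring = range fps_to_fls"

definition poly_ring :: "'a::{field,finite} fls set" where
  "poly_ring = range (\<lambda>p. poly (map_poly fls_const p) fls_X_inv)"

definition has_entries :: "'a::{field,finite} fls set \<Rightarrow> 'a mat2 \<Rightarrow> bool" where
  "has_entries R g \<longleftrightarrow> (\<forall>i j. g $ i $ j \<in> R)"

definition SL2 :: "'a::{field,finite} fls set \<Rightarrow> 'a mat2 set" where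
  "SL2 R = {g. has_entries R g \<and> det g = 1}"

definition GL2 :: "'a::{field,finite} fls set \<Rightarrow> 'a mat2 set" where
  "GL2 R = {g. has_entries R g \<and> (\<exists>g'. has_entries R g' \<and> g ** g' = mat 1 \<and> g' ** g = mat 1)}"

definition diag2 :: "'a::{field,finite} fls \<Rightarrow> 'a fls \<Rightarrow> 'a mat2" where
  "diag2 a b = vector [vector [a, 0], vector [0, b]]"


subsection \<open>The Bruhat--Tits tree\<close>

definition std_lattice :: "'a::{field,finite} lat" where
  "std_lattice = {x. \<forall>i. x $ i \<in> integer_ring}"

definition is_lattice :: "'a::{field,finite} lat \<Rightarrow> bool" where
  "is_lattice L \<longleftrightarrow> (\<exists>g\<in>GL2 UNIV. L = (*v) g ` std_lattice)"

definition homothety_class :: "'a::{field,finite} lat \<Rightarrow> 'a vertex" where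
  "homothety_class L = {(*s) c ` L | c. c \<noteq> 0}"

definition tree_vertices :: "'a::{field,finite} vertex set" where
  "tree_vertices = {homothety_class L | L. is_lattice L}"

text \<open>
  \<open>L / L'\<close> is isomorphic to the residue field as a module over the ring of integers (which acts
  on the residue field through the constant coefficient): there is a surjective linear map from
  \<open>L\<close> to the residue field with kernel \<open>L'\<close>.
\<close>
definition quotient_is_residue_field :: "'a::{field,finite} lat \<Rightarrow> 'a lat \<Rightarrow> bool" where
  "quotient_is_residue_field L L' \<longleftrightarrow>
     (\<exists>\<phi> :: 'a fls ^ 2 \<Rightarrow> 'a.
        (\<forall>x\<in>L. \<forall>y\<in>L. \<phi> (x + y) = \<phi> x + \<phi> y) \<and>
        (\<forall>a\<in>integer_ring. \<forall>x\<in>L. \<phi> (a *s x) = fls_nth a 0 * \<phi> x) \<and>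
        \<phi> ` L = UNIV \<and> {x\<in>L. \<phi> x = 0} = L')"

definition tree_adj :: "'a::{field,finite} vertex \<Rightarrow> 'a vertex \<Rightarrow> bool" where
  "tree_adj v w \<longleftrightarrow> v \<in> tree_vertices \<and> w \<in> tree_vertices \<and>
     (\<exists>L\<in>v. \<exists>L'\<in>w. (*s) fls_X ` L \<subset> L' \<and> L' \<subset> L \<and> quotient_is_residue_field L L')"

definition act :: "'a::{field,finite} mat2 \<Rightarrow> 'a vertex \<Rightarrow> 'a vertex" where
  "act g v = (\<lambda>L. (*v) g ` L) ` v"

definition ray_vertex :: "nat \<Rightarrow> 'a::{field,finite} vertex" where
  "ray_vertex n = act (diag2 (fls_X_inv ^ n) 1) (homothety_class std_lattice)"

text \<open>Scalars act trivially on vertices, so \<open>PGL\<^sub>2\<close>-orbits are \<open>GL\<^sub>2\<close>-orbits.\<close>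
definition height :: "'a::{field,finite} vertex \<Rightarrow> nat" where
  "height v = (THE n. \<exists>\<gamma>\<in>GL2 poly_ring. v = act \<gamma> (ray_vertex n))"


subsection \<open>The quotient space and its measures\<close>

text \<open>Points of \<open>X = \<Gamma>\G\<close> are the cosets \<open>\<Gamma>g\<close> as sets of matrices.\<close>

definition coset :: "'a::{field,finite} mat2 \<Rightarrow> 'a quot" where
  "coset g = (\<lambda>\<gamma>. \<gamma> ** g) ` SL2 poly_ring"

definition quot_space :: "'a::{field,finite} quot set" where
  "quot_space = coset ` SL2 UNIV"

definition right_translate :: "'a::{field,finite} mat2 \<Rightarrow> 'a quot \<Rightarrow> 'a quot" where
  "right_translate g x = (\<lambda>y. y ** g) ` x"

definition quot_open :: "'a::{field,finite} quot set \<Rightarrow> bool" where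
  "quot_open U \<longleftrightarrow> U \<subseteq> quot_space \<and>
     openin (top_of_set (SL2 UNIV)) {g \<in> SL2 UNIV. coset g \<in> U}"

definition quot_borel :: "'a::{field,finite} quot measure" where
  "quot_borel = sigma quot_space {U. quot_open U}"

definition prob_on_quot :: "'a::{field,finite} quot measure \<Rightarrow> bool" where
  "prob_on_quot \<mu> \<longleftrightarrow> prob_space \<mu> \<and> sets \<mu> = sets quot_borel"

definition invariant_prob :: "'a::{field,finite} quot measure \<Rightarrow> bool" where
  "invariant_prob \<mu> \<longleftrightarrow> prob_on_quot \<mu> \<and>
     (\<forall>g\<in>SL2 UNIV. distr \<mu> \<mu> (right_translate g) = \<mu>)"

text \<open>The height is constant on \<open>{g v\<^sub>0 | g \<in> x}\<close>; \<open>the_elem\<close> picks this value.\<close>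
definition h_K :: "'a::{field,finite} quot \<Rightarrow> nat" where
  "h_K x = the_elem ((\<lambda>g. height (act g (ray_vertex 0))) ` x)"

definition right_K_invariant :: "('a::{field,finite} quot \<Rightarrow> complex) \<Rightarrow> bool" where
  "right_K_invariant f \<longleftrightarrow>
     (\<forall>x\<in>quot_space. \<forall>k\<in>SL2 integer_ring. f (right_translate k x) = f x)"

definition sup_norm :: "(nat \<Rightarrow> complex) \<Rightarrow> real" where
  "sup_norm \<Phi> = (SUP n\<in>{n. even n}. cmod (\<Phi> n))"


subsection \<open>Rooted shadows\<close>

datatype direction = Fwd | Bwd

fun edge_state :: "direction \<Rightarrow> nat \<Rightarrow> 'a::{field,finite} vertex \<times> 'a vertex \<Rightarrow> bool" where
  "edge_state Fwd k (y, z) \<longleftrightarrow> tree_adj y z \<and> height z = k \<and> height y + 1 = k"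
| "edge_state Bwd k (y, z) \<longleftrightarrow> tree_adj y z \<and> height z = k \<and> height y = k + 1"

text \<open>A path \<open>z\<^sub>-\<^sub>1, z\<^sub>0, \<dots>, z\<^sub>N\<close> is encoded with indices shifted by one, as \<open>p 0, \<dots>, p (N + 1)\<close>.\<close>
definition Desc :: "nat \<Rightarrow> 'a::{field,finite} vertex \<times> 'a vertex \<Rightarrow> 'a vertex set" where
  "Desc N e = {p (N + 1) | p. p 0 = fst e \<and> p 1 = snd e \<and>
     (\<forall>i\<le>N. tree_adj (p i) (p (i + 1))) \<and> (\<forall>i<N. p (i + 2) \<noteq> p i)}"

text \<open>
  The distribution depends only on the state of the edge, so any edge in that state may be
  chosen; the type argument fixes the field.
\<close>
definition shadow :: "'a::{field,finite} itself \<Rightarrow> direction \<Rightarrow> nat \<Rightarrow> nat \<Rightarrow> nat \<Rightarrow> real" where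
  "shadow _ \<epsilon> k N j =
     (let e = (SOME e :: 'a vertex \<times> 'a vertex. edge_state \<epsilon> k e)
      in real (card {z \<in> Desc N e. height z = j}) / real CARD('a) ^ N)"

definition shadow_decomposition ::
  "'a::{field,finite} quot measure \<Rightarrow> nat \<Rightarrow> (nat \<Rightarrow> real) \<Rightarrow> (nat \<Rightarrow> direction) \<Rightarrow>
     (nat \<Rightarrow> nat) \<Rightarrow> (nat \<Rightarrow> nat) \<Rightarrow> bool" where
  "shadow_decomposition lam L c \<epsilon> k D \<longleftrightarrow>
     (\<forall>l\<in>{1..L}. c l \<ge> 0 \<and> even (k l + D l) \<and> (\<epsilon> l = Fwd \<longrightarrow> k l \<ge> 1)) \<and>
     (\<Sum>l=1..L. c l) = 1 \<and>
     distr lam (count_space {n. even n}) h_K =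
       point_measure {n. even n} (\<lambda>j. ennreal (\<Sum>l=1..L. c l * shadow TYPE('a) (\<epsilon> l) (k l) (D l) j))"

definition margin :: "nat \<Rightarrow> (nat \<Rightarrow> nat) \<Rightarrow> (nat \<Rightarrow> nat) \<Rightarrow> int" where
  "margin L k D = Min ((\<lambda>l. int (D l) - int (k l)) ` {1..L})"

end

theory Submission
  imports Defs
begin

text \<open>
  The argument has a probabilistic half and a geometric half.

  \<^bold>\<open>The height walk.\<close> A non-backtracking path of uniformly chosen steps moves its height by a
  Markov chain on the edge states. From a backward state the height is forced down to \<open>0\<close> and the
  path then turns upwards; from a forward state it continues upwards with probability \<open>1/q\<close> and
  turns back with probability \<open>1 - 1/q\<close>. Let \<open>a(n)\<close> be the mean of a profile \<open>\<Phi>\<close> after \<open>n\<close> steps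
  from the state \<open>(bwd, 0)\<close>. The chain telescopes to
  \<open>a(n + 2) - a(n) = (\<Phi>(n + 2) - \<Phi>(n)) / q^(n + 1)\<close> (lemma \<open>walk_avg_return_diff\<close>), so along even \<open>n\<close>
  it converges to a number \<open>\<Lambda>\<close> with error of order \<open>q^(-n)\<close>. A backward edge of height \<open>k\<close> is this
  process delayed by \<open>k\<close> steps, whence the error \<open>q^(-(D - k))\<close>. A forward edge climbs \<open>i\<close> further
  steps before turning with probability about \<open>q^(-i)\<close>, and this costs \<open>2i\<close> of the margin
  \<open>D - k\<close>; the sum of \<open>q^(-i) * q^(-(D - k - 2i))\<close> is dominated by \<open>i\<close> near \<open>(D - k)/2\<close>, which is where the
  square root in the general bound comes from (\<open>walk_limit_exists\<close>).

  \<^bold>\<open>The limit is the integral.\<close> The number \<open>\<Lambda>\<close> is identified with the \<open>\<mu>\<close>-integral without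
  computing the height distribution of \<open>\<mu>\<close>. By invariance, the integral of \<open>f\<close> is unchanged when
  \<open>f\<close> is replaced by its mean over a sphere of even radius around \<open>g v\<^sub>0\<close>, since the points of such
  a sphere around \<open>v\<^sub>0\<close> have the form \<open>s v\<^sub>0\<close> with \<open>s \<in> SL\<^sub>2(F)\<close>. A sphere is a disjoint union of
  shadows, so these means converge pointwise to \<open>\<Lambda>\<close>, and dominated convergence gives
  \<open>\<integral> f d\<mu> = \<Lambda>\<close> (\<open>invariant_integral\<close>).

  \<^bold>\<open>The tree.\<close> Every vertex is the class of a lattice in Hermite normal form, and such classes
  correspond to the balls \<open>f + \<pi>\<^sup>n O\<close> in \<open>F\<close>; adjacency is inclusion with index \<open>q\<close>
  (\<open>ball_vertex_eq_iff\<close>, \<open>tree_adj_ball\<close>). A ball has one parent and \<open>q\<close> children, so a path that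
  has started to descend can only descend. This makes distinct non-backtracking paths from an edge
  end in distinct vertices. Polynomial translations together with \<open>f \<mapsto> 1/f\<close> carry every ball to a
  ball around \<open>0\<close>, as in the continued fraction algorithm, so every vertex has a height. Heights
  are unique because comparing determinants shows that a polynomial matrix relating two different
  ray vertices would have a vanishing first column (\<open>poly_equiv_ray_le\<close>).
\<close>

text \<open>
  The dollar sign is reserved for the entries of vectors and matrices.
\<close>
no_notation fps_nth (infixl "$" 75)

section \<open>Valuations of Laurent series\<close>

text \<open>
  The fractional ideal \<open>\<pi>\<^sup>n O\<close> as a predicate. The explicit case \<open>f = 0\<close> replaces an infinite
  valuation, because the subdegree of \<open>0\<close> is \<open>0\<close> by convention.
\<close>
definition val_ge :: "int \<Rightarrow> 'a::{field,finite} fls \<Rightarrow> bool" where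
  "val_ge n f \<longleftrightarrow> f = 0 \<or> n \<le> fls_subdegree f"

lemma val_ge_nth: "val_ge n f \<longleftrightarrow> (\<forall>i<n. fls_nth f i = 0)"
  unfolding val_ge_def
  by (metis fls_eq0_below_subdegree fls_subdegree_geI nth_fls_subdegree_zero_iff fls_zero_nth
      less_le_trans linorder_not_le)

lemma val_ge_0 [simp]: "val_ge n 0"
  by (simp add: val_ge_def)

lemma val_ge_1 [simp]: "val_ge n 1 \<longleftrightarrow> n \<le> 0"
  by (simp add: val_ge_def)

lemma val_ge_const: "n \<le> 0 \<Longrightarrow> val_ge n (fls_const a)"
  by (simp add: val_ge_def)

lemma val_ge_add: "val_ge n f \<Longrightarrow> val_ge n g \<Longrightarrow> val_ge n (f + g)"
  by (simp add: val_ge_nth)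

lemma val_ge_diff: "val_ge n f \<Longrightarrow> val_ge n g \<Longrightarrow> val_ge n (f - g)"
  by (simp add: val_ge_nth)

lemma val_ge_minus [simp]: "val_ge n (- f) \<longleftrightarrow> val_ge n f"
  by (simp add: val_ge_nth)

lemma val_ge_swap: "val_ge n (f - g) \<longleftrightarrow> val_ge n (g - f)"
  using val_ge_minus[of n "f - g"] by simp

lemma val_ge_mono: "val_ge n f \<Longrightarrow> m \<le> n \<Longrightarrow> val_ge m f"
  by (auto simp: val_ge_def)

lemma val_ge_mult: "val_ge m f \<Longrightarrow> val_ge n g \<Longrightarrow> val_ge (m + n) (f * g)"
  by (cases "f = 0"; cases "g = 0") (auto simp: val_ge_def)

lemma val_ge_mult_le: "val_ge m f \<Longrightarrow> val_ge n g \<Longrightarrow> k \<le> m + n \<Longrightarrow> val_ge k (f * g)"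
  using val_ge_mult val_ge_mono by blast

lemma val_ge_mult_iff:
  "g \<noteq> 0 \<Longrightarrow> val_ge n (g * f) \<longleftrightarrow> val_ge (n - fls_subdegree g) f"
  "g \<noteq> 0 \<Longrightarrow> val_ge n (f * g) \<longleftrightarrow> val_ge (n - fls_subdegree g) f"
  by (cases "f = 0"; auto simp: val_ge_def)+

lemma val_ge_divide_iff:
  "g \<noteq> 0 \<Longrightarrow> val_ge n (f / g) \<longleftrightarrow> val_ge (n + fls_subdegree g) f"
  by (cases "f = 0") (auto simp: val_ge_def fls_divide_subdegree)

lemma subdegree_divide': "f \<noteq> 0 \<Longrightarrow> g \<noteq> 0 \<Longrightarrow> 
   fls_subdegree (f / g :: 'a::{field,finite} fls) = fls_subdegree f - fls_subdegree g"
  by (simp add: fls_divide_subdegree)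

lemma integer_ring_iff: "f \<in> integer_ring \<longleftrightarrow> val_ge 0 f"
proof
  assume "f \<in> integer_ring"
  then show "val_ge 0 f"
    by (auto simp: integer_ring_def val_ge_nth)
next
  assume "val_ge 0 f"
  then have "f = fps_to_fls (fls_regpart f)"
    by (intro fls_eqI) (auto simp: val_ge_nth)
  then show "f \<in> integer_ring"
    unfolding integer_ring_def by blast
qed

text \<open>
  Integer powers of the uniformizer, kept opaque because the simplifier unfolds them to shifts.
\<close>
definition unif :: "int \<Rightarrow> 'a::{field,finite} fls" where
  "unif n = fls_X powi n"

lemma unif_nonzero [simp]: "unif n \<noteq> 0"
  by (simp add: unif_def del: fls_X_power_int)

lemma unif_0 [simp]: "unif 0 = 1"
  by (simp add: unif_def del: fls_X_power_int)

lemma unif_add: "unif (m + n) = unif m * unif n"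
  by (simp add: unif_def power_int_add del: fls_X_power_int)

lemma unif_mult_minus [simp]: "unif n * unif (- n) = 1" "unif (- n) * unif n = 1"
  by (simp_all flip: unif_add)

lemma subdegree_unif [simp]: "fls_subdegree (unif n) = n"
  by (simp add: unif_def)

lemma X_inv_power_unif: "fls_X_inv ^ n = unif (- int n)"
  by (simp add: unif_def fls_X_inv_power_conv_shift_1)

lemma unif_mult_nth: "fls_nth (unif n * f) i = fls_nth f (i - n)" "fls_nth (f * unif n) i = fls_nth f (i - n)"
  by (simp_all add: unif_def fls_X_intpow_times_conv_shift)

lemma val_ge_unif [simp]: "val_ge m (unif n) \<longleftrightarrow> m \<le> n"
  by (simp add: val_ge_def)

section \<open>The polynomial ring inside the Laurent series\<close>

lemma poly_const_nth:
  "fls_nth (poly (map_poly fls_const p) (fls_X_inv :: 'a::{field,finite} fls)) n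
     = (if n \<le> 0 then coeff p (nat (- n)) else 0)"
proof (induction p arbitrary: n)
  case 0
  then show ?case by simp
next
  case (pCons a p)
  have "fls_nth (fls_X_inv * poly (map_poly fls_const p) (fls_X_inv :: 'a fls)) n
      = fls_nth (poly (map_poly fls_const p) (fls_X_inv :: 'a fls)) (n + 1)"
    by (simp add: fls_X_inv_times_conv_shift)
  moreover have "map_poly fls_const (pCons a p) = pCons (fls_const a) (map_poly fls_const p)"
    using pCons.hyps by (simp add: map_poly_pCons)
  moreover have "nat (- n) = Suc (nat (- (n + 1)))" if "n < 0"
    using that by simp
  ultimately show ?case
    using pCons.IH[of "n + 1"] by (auto simp: coeff_pCons split: nat.splits)
qed

text \<open>
  Polynomials in \<open>t = \<pi>\<^sup>-\<^sup>1\<close> are the series without positive powers of \<open>\<pi>\<close>; closure properties and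
  degree bounds are read off from coefficients in this form.
\<close>
lemma poly_ring_iff: "f \<in> poly_ring \<longleftrightarrow> (\<forall>i>0. fls_nth f i = 0)"
proof
  assume "f \<in> poly_ring"
  then show "\<forall>i>0. fls_nth f i = 0"
    by (auto simp: poly_ring_def poly_const_nth)
next
  assume *: "\<forall>i>0. fls_nth f i = 0"
  define p where "p = fls_prpart f + [:fls_nth f 0:]"
  have "f = poly (map_poly fls_const p) fls_X_inv"
  proof (intro fls_eqI)
    fix n
    show "fls_nth f n = fls_nth (poly (map_poly fls_const p) fls_X_inv) n"
      unfolding poly_const_nth p_def using * by (auto simp: coeff_pCons split: nat.splits)
  qed
  then show "f \<in> poly_ring"
    by (auto simp: poly_ring_def)
qed

lemma poly_ring_add: "f \<in> poly_ring \<Longrightarrow> g \<in> poly_ring \<Longrightarrow> f + g \<in> poly_ring"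
  by (simp add: poly_ring_iff)

lemma poly_ring_minus: "f \<in> poly_ring \<Longrightarrow> - f \<in> poly_ring"
  by (simp add: poly_ring_iff)

lemma poly_ring_mult: "f \<in> poly_ring \<Longrightarrow> g \<in> poly_ring \<Longrightarrow> f * g \<in> poly_ring"
  unfolding poly_ring_iff fls_times_nth(2)
  by (smt (verit) mult_eq_0_iff sum.neutral)

lemma poly_ring_const: "fls_const a \<in> poly_ring"
  by (simp add: poly_ring_iff)

lemma poly_ring_0 [simp]: "0 \<in> poly_ring" and poly_ring_1 [simp]: "1 \<in> poly_ring"
  by (simp_all add: poly_ring_iff)

lemma poly_ring_unif: "n \<le> 0 \<Longrightarrow> unif n \<in> poly_ring"
  by (simp add: poly_ring_iff unif_def)

lemma poly_ring_subdegree: "f \<in> poly_ring \<Longrightarrow> fls_subdegree f \<le> 0"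
  by (metis poly_ring_iff fls_zero_subdegree nth_fls_subdegree_zero_iff linorder_not_le order_refl)

text \<open>
  The discreteness of the polynomial ring: this is what forces matrix entries to vanish in the
  uniqueness proof for heights.
\<close>
lemma poly_ring_val_ge_1: "f \<in> poly_ring \<Longrightarrow> val_ge 1 f \<Longrightarrow> f = 0"
  using poly_ring_subdegree[of f] by (auto simp: val_ge_def)

lemma poly_ring_decomp: "\<exists>p\<in>poly_ring. val_ge 1 (f - p)"
proof -
  define p where "p = fls_prpart f + [:fls_nth f 0:]"
  have "poly (map_poly fls_const p) fls_X_inv \<in> poly_ring"
    by (auto simp: poly_ring_def)
  moreover have "val_ge 1 (f - poly (map_poly fls_const p) fls_X_inv)"
    by (auto simp: val_ge_nth poly_const_nth p_def coeff_pCons intro: arg_cong[of _ _ "fls_nth f"] split: nat.splits)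
  ultimately show ?thesis by blast
qed

lemma vec2_eq_iff: "x = y \<longleftrightarrow> x $ 1 = y $ 1 \<and> x $ 2 = (y $ 2 :: 'b)" for x y :: "'b ^ 2"
  by (simp add: vec_eq_iff forall_2)

lemma matrix_vector_2:
  "((g :: 'b::semiring_1 ^ 2 ^ 2) *v x) $ i = g $ i $ 1 * x $ 1 + g $ i $ 2 * x $ 2"
  by (simp add: matrix_vector_mult_def sum_2)

lemma matrix_matrix_2:
  "((g :: 'b::semiring_1 ^ 2 ^ 2) ** h) $ i $ j = g $ i $ 1 * h $ 1 $ j + g $ i $ 2 * h $ 2 $ j"
  by (simp add: matrix_matrix_mult_def sum_2)

lemma mat2_eq_iff: "g = h \<longleftrightarrow> g $ 1 $ 1 = h $ 1 $ 1 \<and> g $ 1 $ 2 = h $ 1 $ 2 \<and> 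
    g $ 2 $ 1 = h $ 2 $ 1 \<and> g $ 2 $ 2 = (h $ 2 $ 2 :: 'b)" for g h :: "'b ^ 2 ^ 2"
  by (auto simp: vec2_eq_iff)

definition mat22 :: "'b \<Rightarrow> 'b \<Rightarrow> 'b \<Rightarrow> 'b \<Rightarrow> 'b::zero ^ 2 ^ 2" where
  "mat22 a b c d = vector [vector [a, b], vector [c, d]]"

lemma mat22_nth [simp]:
  "mat22 a b c d $ 1 $ 1 = a" "mat22 a b c d $ 1 $ 2 = b"
  "mat22 a b c d $ 2 $ 1 = c" "mat22 a b c d $ 2 $ 2 = d"
  by (simp_all add: mat22_def)

lemma det_mat22 [simp]: "det (mat22 a b c d) = a * d - b * (c :: 'b::comm_ring_1)"
  by (simp add: det_2)

lemma GL2_UNIV_iff: "g \<in> GL2 UNIV \<longleftrightarrow> det g \<noteq> 0"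
  by (auto simp: GL2_def has_entries_def invertible_def simp flip: invertible_det_nz)

lemma SL2_UNIV_iff: "g \<in> SL2 UNIV \<longleftrightarrow> det g = 1"
  by (auto simp: SL2_def has_entries_def)

lemma std_lattice_iff: "x \<in> std_lattice \<longleftrightarrow> val_ge 0 (x $ 1) \<and> val_ge 0 (x $ 2)"
  by (simp add: std_lattice_def integer_ring_iff forall_2)

section \<open>Matrices and homothety classes of lattices\<close>

lemma smult_image_iff:
  "c \<noteq> 0 \<Longrightarrow> x \<in> (*s) c ` L \<longleftrightarrow> (1 / c) *s x \<in> L" for c :: "'b::field"
proof -
  assume c: "c \<noteq> 0"
  have "x = c *s ((1 / c) *s x)" "\<And>y. x = c *s y \<Longrightarrow> (1 / c) *s x = y"
    using c by (simp_all add: vec_eq_iff)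
  then show ?thesis by (metis image_iff)
qed

lemma smult_smult_image: "(*s) a ` (*s) b ` L = (*s) (a * b) ` L" for L :: "('b::semiring_1 ^ 'n) set"
  by (simp add: image_image vector_smult_assoc)

lemma homothety_class_self: "L \<in> homothety_class L"
  unfolding homothety_class_def by (intro CollectI exI[of _ 1]) simp

lemma homothety_class_smult:
  assumes "c \<noteq> 0"
  shows "homothety_class ((*s) c ` L) = homothety_class L"
proof -
  have "\<exists>e. (*s) d ` (*s) c ` L = (*s) e ` L \<and> e \<noteq> 0" if "d \<noteq> 0" for d
    using that assms by (intro exI[of _ "d * c"]) (simp add: smult_smult_image)
  moreover have "\<exists>e. (*s) d ` L = (*s) e ` (*s) c ` L \<and> e \<noteq> 0" if "d \<noteq> 0" for d
    using that assms by (intro exI[of _ "d / c"]) (simp add: smult_smult_image)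
  ultimately show ?thesis
    unfolding homothety_class_def by blast
qed

lemma homothety_class_eq_iff:
  "homothety_class L = homothety_class L' \<longleftrightarrow> (\<exists>c. c \<noteq> 0 \<and> L' = (*s) c ` L)"
proof
  assume "homothety_class L = homothety_class L'"
  then have "L' \<in> homothety_class L"
    using homothety_class_self by metis
  then show "\<exists>c. c \<noteq> 0 \<and> L' = (*s) c ` L"
    by (auto simp: homothety_class_def)
next
  assume "\<exists>c. c \<noteq> 0 \<and> L' = (*s) c ` L"
  then show "homothety_class L = homothety_class L'"
    by (auto simp: homothety_class_smult)
qed

lemma matrix_smult_image: "(*v) g ` (*s) c ` L = (*s) c ` (*v) g ` L"
  for g :: "'b::field ^ 'n ^ 'm"
  by (simp add: image_image vector_scalar_commute)

lemma matrix_mul_image: "(*v) (g ** h) ` L = (*v) g ` (*v) h ` L"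
  for g :: "'b::semiring_1 ^ 'n ^ 'm"
  by (simp add: image_image matrix_vector_mul_assoc)

lemma act_homothety_class: "act g (homothety_class L) = homothety_class ((*v) g ` L)"
proof -
  have "act g (homothety_class L) = {(*v) g ` (*s) c ` L | c. c \<noteq> 0}"
    unfolding act_def homothety_class_def by blast
  then show ?thesis
    by (simp add: matrix_smult_image homothety_class_def)
qed

lemma act_mult: "act g (act h v) = act (g ** h) v"
  by (simp add: act_def image_image matrix_vector_mul_assoc)

lemma act_1 [simp]: "act (mat 1) v = v"
  by (simp add: act_def)

section \<open>Vertices as balls\<close>

text \<open>
  The lattice spanned by \<open>(\<pi>\<^sup>n, 0)\<close> and \<open>(f, 1)\<close>. It depends only on the ball \<open>f + \<pi>\<^sup>n O\<close>.
\<close>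
definition ball_lattice :: "int \<Rightarrow> 'a::{field,finite} fls \<Rightarrow> 'a lat" where
  "ball_lattice n f = {x. val_ge 0 (x $ 2) \<and> val_ge n (x $ 1 - f * x $ 2)}"

definition ball_vertex :: "int \<Rightarrow> 'a::{field,finite} fls \<Rightarrow> 'a vertex" where
  "ball_vertex n f = homothety_class (ball_lattice n f)"

lemma ball_lattice_iff: "x \<in> ball_lattice n f \<longleftrightarrow> val_ge 0 (x $ 2) \<and> val_ge n (x $ 1 - f * x $ 2)"
  by (simp add: ball_lattice_def)

lemma std_lattice_eq_ball: "std_lattice = ball_lattice 0 0"
  by (auto simp: std_lattice_iff ball_lattice_iff)

lemma ball_lattice_eq_matrix: "ball_lattice n f = (*v) (mat22 (unif n) f 0 1) ` std_lattice"
proof (intro set_eqI iffI)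
  fix x assume x: "x \<in> ball_lattice n f"
  have "vector [(x $ 1 - f * x $ 2) / unif n, x $ 2] \<in> std_lattice"
    using x by (simp add: std_lattice_iff ball_lattice_iff val_ge_divide_iff)
  moreover have "x = mat22 (unif n) f 0 1 *v vector [(x $ 1 - f * x $ 2) / unif n, x $ 2]"
    by (simp add: vec2_eq_iff matrix_vector_2)
  ultimately show "x \<in> (*v) (mat22 (unif n) f 0 1) ` std_lattice" by blast
next
  fix x assume "x \<in> (*v) (mat22 (unif n) f 0 1) ` std_lattice"
  then show "x \<in> ball_lattice n f"
    by (auto simp: ball_lattice_iff std_lattice_iff matrix_vector_2 val_ge_mult_iff)
qed

lemma ball_lattice_cong: 
  assumes "val_ge n (f - f')"
  shows "ball_lattice n f = ball_lattice n f'"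
proof -
  have "val_ge n (x - f * y) \<longleftrightarrow> val_ge n (x - f' * y)" if "val_ge 0 y" for x y
  proof -
    have *: "val_ge n ((f - f') * y)"
      using val_ge_mult[OF assms that] by simp
    have "x - f * y = (x - f' * y) - (f - f') * y" "x - f' * y = (x - f * y) + (f - f') * y"
      by (simp_all add: algebra_simps)
    then show ?thesis
      using * val_ge_add val_ge_diff by metis
  qed
  then show ?thesis
    by (auto simp: ball_lattice_def)
qed

lemma ball_vertex_cong: "val_ge n (f - f') \<Longrightarrow> ball_vertex n f = ball_vertex n f'"
  unfolding ball_vertex_def using ball_lattice_cong by metis

text \<open>
  A homothety between two such lattices must be by a unit, because both project onto \<open>O\<close> in the
  second coordinate. The lattices then coincide, and comparing the basis vectors shows that the
  balls do.
\<close>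
lemma ball_vertex_eq_iff:
  "ball_vertex n f = ball_vertex n' f' \<longleftrightarrow> n = n' \<and> val_ge n (f - f')"
proof
  assume "ball_vertex n f = ball_vertex n' f'"
  then obtain c where c: "c \<noteq> 0" and eq: "ball_lattice n' f' = (*s) c ` ball_lattice n f"
    by (auto simp: ball_vertex_def homothety_class_eq_iff)
  have mem: "x \<in> ball_lattice n f \<Longrightarrow> c *s x \<in> ball_lattice n' f'" for x
    unfolding eq by blast
  have mem': "x \<in> ball_lattice n' f' \<Longrightarrow> (1 / c) *s x \<in> ball_lattice n f" for x
    unfolding eq using c by (simp add: smult_image_iff)
  have "vector [f, 1] \<in> ball_lattice n f" "vector [f', 1] \<in> ball_lattice n' f'"
    by (simp_all add: ball_lattice_iff)
  from mem[OF this(1)] mem'[OF this(2)]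
  have 1: "val_ge 0 c" "val_ge n' (c * f - f' * c)" "val_ge 0 (1 / c)"
    by (simp_all add: ball_lattice_iff)
  have c0: "fls_subdegree c = 0"
    using 1 c by (auto simp: val_ge_def subdegree_divide')
  have 2: "val_ge n' (f - f')"
  proof -
    have "c * f - f' * c = c * (f - f')" by (simp add: algebra_simps)
    then show ?thesis using 1(2) c c0 by (simp add: val_ge_mult_iff)
  qed
  have "vector [unif n, 0] \<in> ball_lattice n f" "vector [unif n', 0] \<in> ball_lattice n' f'"
    by (simp_all add: ball_lattice_iff)
  from mem[OF this(1)] mem'[OF this(2)] have "n = n'"
    using c c0 by (simp add: ball_lattice_iff val_ge_mult_iff val_ge_divide_iff)
  with 2 show "n = n' \<and> val_ge n (f - f')" by simp
qed (use ball_vertex_cong in metis)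

text \<open>
  Hermite normal form: when the lower right entry has the smaller valuation in its row, a column
  operation over \<open>O\<close> clears the lower left entry, and a homothety makes the lower right entry \<open>1\<close>.
\<close>
lemma lattice_homothetic_ball_aux:
  fixes g :: "'a::{field,finite} mat2"
  assumes det: "det g \<noteq> 0" and d: "g $ 2 $ 2 \<noteq> 0" 
    and le: "val_ge (fls_subdegree (g $ 2 $ 2)) (g $ 2 $ 1)"
  shows "\<exists>n f. homothety_class ((*v) g ` std_lattice) = ball_vertex n f"
proof -
  define a b c d where "a = g $ 1 $ 1" and "b = g $ 1 $ 2" and "c = g $ 2 $ 1" and "d = g $ 2 $ 2"
  note defs = a_def b_def c_def d_def
  define D where "D = a * d - b * c"
  have D: "D \<noteq> 0" using det by (simp add: D_def defs det_2)
  have d0: "d \<noteq> 0" using d by (simp add: defs)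
  have cd: "val_ge 0 (c / d)" using le d0 by (simp add: defs val_ge_divide_iff)
  define n where "n = fls_subdegree (D / (d * d))"
  have "(*v) g ` std_lattice = (*s) d ` ball_lattice n (b / d)"
  proof (intro set_eqI iffI)
    fix z assume "z \<in> (*v) g ` std_lattice"
    then obtain x where x: "val_ge 0 (x $ 1)" "val_ge 0 (x $ 2)" and z: "z = g *v x"
      by (auto simp: std_lattice_iff)
    have "(a * x $ 1 + b * x $ 2) / d - b / d * ((c * x $ 1 + d * x $ 2) / d) = D / (d * d) * x $ 1"
      using d0 by (simp add: D_def field_simps)
    moreover have "val_ge n (D / (d * d) * x $ 1)"
      using x D d0 unfolding n_def by (subst val_ge_mult_iff(1)) auto
    moreover have "(c * x $ 1 + d * x $ 2) / d = c / d * x $ 1 + x $ 2"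
      using d0 by (simp add: field_simps)
    moreover have "val_ge 0 (c / d * x $ 1 + x $ 2)"
      using val_ge_mult[OF cd x(1)] x(2) by (simp add: val_ge_add)
    ultimately show "z \<in> (*s) d ` ball_lattice n (b / d)"
      using d0 by (simp add: smult_image_iff ball_lattice_iff z matrix_vector_2 flip: defs)
  next
    fix z assume "z \<in> (*s) d ` ball_lattice n (b / d)"
    then obtain x where x: "val_ge 0 (x $ 2)" "val_ge n (x $ 1 - b / d * x $ 2)" and z: "z = d *s x"
      by (auto simp: ball_lattice_iff)
    define u where "u = (x $ 1 - b / d * x $ 2) / (D / (d * d))"
    have u: "val_ge 0 u"
      unfolding u_def using x(2) D d0 by (subst val_ge_divide_iff) (auto simp: n_def)
    have "vector [u, x $ 2 - c / d * u] \<in> std_lattice"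
      using u x(1) val_ge_mult[OF cd u] by (simp add: std_lattice_iff val_ge_diff)
    moreover have "z = g *v vector [u, x $ 2 - c / d * u]"
    proof -
      have "a * u + b * (x $ 2 - c / d * u) = (D / d) * u + b * x $ 2"
        using d0 by (simp add: D_def field_simps)
      also have "\<dots> = d * x $ 1"
        using d0 D by (simp add: u_def field_simps)
      finally show ?thesis
        using d0 by (simp add: z vec2_eq_iff matrix_vector_2 field_simps flip: defs)
    qed
    ultimately show "z \<in> (*v) g ` std_lattice" by blast
  qed
  then show ?thesis
    unfolding ball_vertex_def using homothety_class_smult[OF d0] by metis
qed

lemma swap_std_lattice: "(*v) (mat22 0 1 1 0) ` std_lattice = std_lattice"
proof -
  have "mat22 0 1 1 0 *v x \<in> std_lattice" if "x \<in> std_lattice" for x :: "'a fls ^ 2"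
    using that by (simp add: std_lattice_iff matrix_vector_2)
  moreover have "x = mat22 0 1 1 0 *v (mat22 0 1 1 0 *v x)" for x :: "'a fls ^ 2"
    by (simp add: vec2_eq_iff matrix_vector_2)
  ultimately show ?thesis by blast
qed

lemma lattice_homothetic_ball:
  assumes "det g \<noteq> 0"
  shows "\<exists>n f. homothety_class ((*v) g ` std_lattice) = ball_vertex n f"
proof (cases "g $ 2 $ 2 \<noteq> 0 \<and> val_ge (fls_subdegree (g $ 2 $ 2)) (g $ 2 $ 1)")
  case True
  then show ?thesis using lattice_homothetic_ball_aux[OF assms] by blast
next
  case False
  let ?h = "g ** mat22 0 1 1 0"
  have "g $ 2 $ 1 \<noteq> 0"
    using False assms by (auto simp: det_2)
  then have "?h $ 2 $ 2 \<noteq> 0" "val_ge (fls_subdegree (?h $ 2 $ 2)) (?h $ 2 $ 1)"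
    using False by (auto simp: matrix_matrix_2 val_ge_def)
  moreover have "det ?h \<noteq> 0"
    using assms by (simp add: det_mul)
  ultimately obtain n f where "homothety_class ((*v) ?h ` std_lattice) = ball_vertex n f"
    using lattice_homothetic_ball_aux by blast
  moreover have "(*v) ?h ` std_lattice = (*v) g ` std_lattice"
    by (simp add: matrix_mul_image swap_std_lattice)
  ultimately show ?thesis by metis
qed

lemma tree_vertices_eq: "tree_vertices = {ball_vertex n f | n f. True}"
proof -
  have "is_lattice (ball_lattice n f)" for n and f :: "'a fls"
    unfolding is_lattice_def ball_lattice_eq_matrix
    by (intro bexI[of _ "mat22 (unif n) f 0 1"]) (auto simp: GL2_UNIV_iff)
  then show ?thesis
    unfolding tree_vertices_def ball_vertex_def[symmetric]
    by (auto simp: is_lattice_def GL2_UNIV_iff ball_vertex_def intro: lattice_homothetic_ball[unfolded ball_vertex_def])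
qed

lemma ball_vertex_in_tree [simp]: "ball_vertex n f \<in> tree_vertices"
  by (auto simp: tree_vertices_eq)

lemma val_ge_Suc: "val_ge (n + 1) f \<longleftrightarrow> val_ge n f \<and> fls_nth f n = 0"
  unfolding val_ge_nth by (metis add1_zle_eq add_le_cancel_right linorder_neqE_linordered_idom linorder_not_le order_less_irrefl zle_add1_eq_le zless_add1_eq)

lemma nth_mult_leading:
  assumes "val_ge m f" "val_ge n g"
  shows "fls_nth (f * g) (m + n) = fls_nth f m * fls_nth g n"
proof -
  define f' where "f' = f - fls_const (fls_nth f m) * unif m"
  have "val_ge (m + 1) f'"
    unfolding val_ge_Suc f'_def using assms(1)
    by (auto simp: val_ge_nth unif_mult_nth)
  from val_ge_mult[OF this assms(2)] have "fls_nth (f' * g) (m + n) = 0"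
    by (simp add: val_ge_nth)
  moreover have "f * g = fls_const (fls_nth f m) * (unif m * g) + f' * g"
    by (simp add: f'_def algebra_simps)
  ultimately show ?thesis
    by (simp add: unif_mult_nth)
qed

section \<open>Neighbours of a vertex\<close>

text \<open>
  The kernel of the linear functional on \<open>ball_lattice n f\<close> with values in the residue field that
  takes the basis vectors \<open>(\<pi>\<^sup>n, 0)\<close> and \<open>(f, 1)\<close> to \<open>\<alpha>\<close> and \<open>\<beta>\<close>.
\<close>
definition hyperplane :: "int \<Rightarrow> 'a::{field,finite} fls \<Rightarrow> 'a \<Rightarrow> 'a \<Rightarrow> 'a lat" where
  "hyperplane n f \<alpha> \<beta> = {x \<in> ball_lattice n f. 
      fls_nth (x $ 1 - f * x $ 2) n * \<alpha> + fls_nth (x $ 2) 0 * \<beta> = 0}"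

lemma hyperplane_parent:
  assumes "\<beta> \<noteq> 0"
  shows "hyperplane n f 0 \<beta> = (*s) (unif 1) ` ball_lattice (n - 1) f"
proof -
  have "x $ 1 / unif 1 - f * (x $ 2 / unif 1) = (x $ 1 - f * x $ 2) / unif 1" for x :: "'a fls ^ 2"
    by (simp add: diff_divide_distrib)
  then have "x \<in> (*s) (unif 1) ` ball_lattice (n - 1) f \<longleftrightarrow> val_ge 1 (x $ 2) \<and> val_ge n (x $ 1 - f * x $ 2)"
    for x :: "'a fls ^ 2"
    by (simp add: smult_image_iff ball_lattice_iff val_ge_divide_iff)
  then show ?thesis
    using assms by (auto simp: hyperplane_def ball_lattice_iff val_ge_Suc[of 0, simplified])
qed

lemma hyperplane_child:
  assumes "\<alpha> \<noteq> 0"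
  shows "hyperplane n f \<alpha> \<beta> = ball_lattice (n + 1) (f + fls_const (- \<beta> / \<alpha>) * unif n)"
proof -
  have "val_ge (n + 1) (x $ 1 - (f + fls_const (- \<beta> / \<alpha>) * unif n) * x $ 2) \<longleftrightarrow>
      val_ge n (x $ 1 - f * x $ 2) \<and> fls_nth (x $ 1 - f * x $ 2) n * \<alpha> + fls_nth (x $ 2) 0 * \<beta> = 0"
    if x2: "val_ge 0 (x $ 2)" for x :: "'a fls ^ 2"
  proof -
    define u where "u = fls_const (\<beta> / \<alpha>) * (unif n * x $ 2)"
    have u: "val_ge n u"
      using val_ge_mult[OF val_ge_const[of 0] val_ge_mult[of n "unif n" 0 "x $ 2"]] x2 unfolding u_def by simp
    have eq: "x $ 1 - (f + fls_const (- \<beta> / \<alpha>) * unif n) * x $ 2 = (x $ 1 - f * x $ 2) + u"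
      by (simp add: u_def algebra_simps)
    have "val_ge n ((x $ 1 - f * x $ 2) + u) \<longleftrightarrow> val_ge n (x $ 1 - f * x $ 2)"
      using val_ge_add[OF _ u] val_ge_diff[OF _ u] by (metis add_diff_cancel_right')
    moreover have "fls_nth u n = \<beta> / \<alpha> * fls_nth (x $ 2) 0"
      by (simp add: u_def unif_mult_nth)
    moreover have "s + \<beta> / \<alpha> * t = 0 \<longleftrightarrow> s * \<alpha> + t * \<beta> = 0" for s t
      using assms by (simp add: field_simps)
    ultimately show ?thesis
      unfolding eq val_ge_Suc fls_plus_nth by metis
  qed
  then show ?thesis
    by (auto simp: hyperplane_def ball_lattice_iff)
qed

lemma tree_vertex_eq_homothety_class:
  assumes "v \<in> tree_vertices" "L \<in> v"
  shows "v = homothety_class L"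
proof -
  obtain L' where v: "v = homothety_class L'"
    using assms by (auto simp: tree_vertices_def)
  then obtain c where "c \<noteq> 0" "L = (*s) c ` L'"
    using assms by (auto simp: homothety_class_def)
  then show ?thesis
    using v homothety_class_smult by metis
qed

lemma ball_lattice_decomp:
  "x = ((x $ 1 - f * x $ 2) / unif n) *s vector [unif n, 0] + x $ 2 *s vector [f, 1]"
  for x :: "'a::{field,finite} fls ^ 2"
  by (simp add: vec2_eq_iff)

lemma ball_lattice_smult_closed:
  assumes "val_ge 0 a" "x \<in> ball_lattice n f"
  shows "a *s x \<in> ball_lattice n f"
proof -
  have "a * x $ 1 - f * (a * x $ 2) = a * (x $ 1 - f * x $ 2)"
    by (simp add: algebra_simps)
  then show ?thesis
    using assms val_ge_mult[of 0 a 0] val_ge_mult[of 0 a n] by (simp add: ball_lattice_iff)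
qed

text \<open>
  A lattice \<open>L'\<close> with \<open>L / L'\<close> the residue field is the kernel of a functional on \<open>L\<close>, and a
  functional is determined by its values on the two basis vectors.
\<close>
lemma tree_adj_hyperplane:
  "tree_adj (ball_vertex n f) w \<longleftrightarrow>
     (\<exists>\<alpha> \<beta>. (\<alpha> \<noteq> 0 \<or> \<beta> \<noteq> 0) \<and> w = homothety_class (hyperplane n f \<alpha> \<beta>))"
proof
  assume "tree_adj (ball_vertex n f) w"
  then obtain L L' where L: "L \<in> ball_vertex n f" and L': "L' \<in> w" and w: "w \<in> tree_vertices"
    and q: "quotient_is_residue_field L L'"
    by (auto simp: tree_adj_def)
  obtain c where c: "c \<noteq> 0" "L = (*s) c ` ball_lattice n f"
    using L by (auto simp: ball_vertex_def homothety_class_def)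
  obtain \<phi> where add: "\<And>x y. x \<in> L \<Longrightarrow> y \<in> L \<Longrightarrow> \<phi> (x + y) = \<phi> x + \<phi> y"
    and smult: "\<And>a x. val_ge 0 a \<Longrightarrow> x \<in> L \<Longrightarrow> \<phi> (a *s x) = fls_nth a 0 * \<phi> x"
    and onto: "\<phi> ` L = UNIV" and ker: "{x\<in>L. \<phi> x = 0} = L'"
    using q unfolding quotient_is_residue_field_def integer_ring_iff[symmetric] by blast
  define \<alpha> where "\<alpha> = \<phi> (c *s vector [unif n, 0])"
  define \<beta> where "\<beta> = \<phi> (c *s vector [f, 1])"
  have base: "vector [unif n, 0] \<in> ball_lattice n f" "vector [f, 1] \<in> ball_lattice n f"
    by (simp_all add: ball_lattice_iff)
  have formula: "\<phi> (c *s x) = fls_nth (x $ 1 - f * x $ 2) n * \<alpha> + fls_nth (x $ 2) 0 * \<beta>" 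
    if x: "x \<in> ball_lattice n f" for x
  proof -
    define a where "a = (x $ 1 - f * x $ 2) / unif n"
    have a: "val_ge 0 a" and b: "val_ge 0 (x $ 2)"
      using x by (simp_all add: ball_lattice_iff a_def val_ge_divide_iff)
    have "c *s x = a *s (c *s vector [unif n, 0]) + x $ 2 *s (c *s vector [f, 1])"
      by (subst ball_lattice_decomp[of x f n]) (simp add: a_def vec2_eq_iff algebra_simps)
    then have "\<phi> (c *s x) = \<phi> (a *s (c *s vector [unif n, 0])) + \<phi> (x $ 2 *s (c *s vector [f, 1]))"
      using base a b c(2)
      by (metis (no_types, lifting) add ball_lattice_smult_closed image_eqI mult.commute vector_smult_assoc)
    also have "\<dots> = fls_nth a 0 * \<alpha> + fls_nth (x $ 2) 0 * \<beta>"
      using base a b c(2) unfolding \<alpha>_def \<beta>_def by (subst (1 2) smult) auto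
    also have "fls_nth a 0 = fls_nth (x $ 1 - f * x $ 2) n"
      using unif_mult_nth(2)[of a n n] by (simp add: a_def)
    finally show ?thesis .
  qed
  have "\<alpha> \<noteq> 0 \<or> \<beta> \<noteq> 0"
  proof (rule ccontr)
    assume "\<not> (\<alpha> \<noteq> 0 \<or> \<beta> \<noteq> 0)"
    then have "\<phi> ` L = {0}"
      using formula base c(2) by (auto simp: image_image)
    then show False
      using onto by (metis UNIV_I singletonD zero_neq_one)
  qed
  moreover have "L' = (*s) c ` hyperplane n f \<alpha> \<beta>"
    using formula c(2) by (auto simp: hyperplane_def simp flip: ker)
  then have "w = homothety_class (hyperplane n f \<alpha> \<beta>)"
    using tree_vertex_eq_homothety_class[OF w L'] homothety_class_smult[OF c(1)] by metis
  ultimately show "\<exists>\<alpha> \<beta>. (\<alpha> \<noteq> 0 \<or> \<beta> \<noteq> 0) \<and> w = homothety_class (hyperplane n f \<alpha> \<beta>)"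
    by blast
next
  assume "\<exists>\<alpha> \<beta>. (\<alpha> \<noteq> 0 \<or> \<beta> \<noteq> 0) \<and> w = homothety_class (hyperplane n f \<alpha> \<beta>)"
  then obtain \<alpha> \<beta> where nz: "\<alpha> \<noteq> 0 \<or> \<beta> \<noteq> 0" and w: "w = homothety_class (hyperplane n f \<alpha> \<beta>)"
    by blast
  define L where "L = ball_lattice n f"
  define L' where "L' = hyperplane n f \<alpha> \<beta>"
  define \<phi> where "\<phi> x = fls_nth (x $ 1 - f * x $ 2) n * \<alpha> + fls_nth (x $ 2) 0 * \<beta>" for x :: "'a fls ^ 2"
  have L'_iff: "x \<in> L' \<longleftrightarrow> x \<in> L \<and> \<phi> x = 0" for x
    by (auto simp: L'_def hyperplane_def \<phi>_def L_def)
  have w_tree: "w \<in> tree_vertices"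
  proof (cases "\<alpha> = 0")
    case True
    then have "w = ball_vertex (n - 1) f"
      using nz by (simp add: w hyperplane_parent homothety_class_smult ball_vertex_def)
    then show ?thesis by simp
  next
    case False
    then have "w = ball_vertex (n + 1) (f + fls_const (- \<beta> / \<alpha>) * unif n)"
      by (simp add: w hyperplane_child ball_vertex_def)
    then show ?thesis by simp
  qed
  have add: "\<phi> (x + y) = \<phi> x + \<phi> y" for x y
    by (simp add: \<phi>_def algebra_simps)
  have smult: "\<phi> (a *s x) = fls_nth a 0 * \<phi> x" if "val_ge 0 a" "x \<in> L" for a x
  proof -
    have "(a *s x) $ 1 - f * (a *s x) $ 2 = a * (x $ 1 - f * x $ 2)"
      by (simp add: algebra_simps)
    moreover have "fls_nth (a * (x $ 1 - f * x $ 2)) n = fls_nth a 0 * fls_nth (x $ 1 - f * x $ 2) n"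
      "fls_nth (a * x $ 2) 0 = fls_nth a 0 * fls_nth (x $ 2) 0"
      using that nth_mult_leading[of 0 a n "x $ 1 - f * x $ 2"] nth_mult_leading[of 0 a 0 "x $ 2"]
      by (simp_all add: L_def ball_lattice_iff)
    ultimately show ?thesis
      unfolding \<phi>_def by (simp only: vector_smult_component) (simp only: algebra_simps)
  qed
  obtain x0 where x0: "x0 \<in> L" "\<phi> x0 \<noteq> 0"
  proof (cases "\<alpha> = 0")
    case True
    then show ?thesis
      using nz that[of "vector [f, 1]"] by (simp add: L_def ball_lattice_iff \<phi>_def)
  next
    case False
    then show ?thesis
      using that[of "vector [unif n, 0]"] unif_mult_nth(1)[of n "1 :: 'a fls" n]
      by (simp add: L_def ball_lattice_iff \<phi>_def)
  qed
  have onto: "\<phi> ` L = UNIV"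
  proof -
    have "y \<in> \<phi> ` L" for y
    proof
      show "fls_const (y / \<phi> x0) *s x0 \<in> L"
        using x0 ball_lattice_smult_closed val_ge_const unfolding L_def by blast
      show "y = \<phi> (fls_const (y / \<phi> x0) *s x0)"
        using x0 by (simp add: smult val_ge_const)
    qed
    then show ?thesis by blast
  qed
  have "quotient_is_residue_field L L'"
    unfolding quotient_is_residue_field_def integer_ring_iff
    by (intro exI[of _ \<phi>]) (auto simp: integer_ring_iff add smult onto L'_iff)
  moreover have "L' \<subset> L"
    using x0 by (auto simp: L'_iff)
  moreover have "(*s) fls_X ` L \<subset> L'"
  proof -
    have sub: "(*s) fls_X ` L \<subseteq> L'"
      using ball_lattice_smult_closed[of "fls_X :: 'a fls"] smult[of fls_X]
      by (auto simp: L'_iff L_def val_ge_def)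
    \<comment> \<open>strictness: a vector of the kernel that is not divisible by \<open>\<pi>\<close>\<close>
    obtain x1 where "x1 \<in> L'" "x1 \<notin> (*s) fls_X ` L"
    proof (cases "\<alpha> = 0")
      case True
      then have "vector [unif n, 0] \<in> L'"
        by (simp add: L'_iff L_def ball_lattice_iff \<phi>_def)
      moreover have "vector [unif n, 0] \<notin> (*s) fls_X ` L"
        by (simp add: smult_image_iff L_def ball_lattice_iff val_ge_divide_iff del: fls_divide_X)
      ultimately show ?thesis using that by blast
    next
      case False
      let ?x = "vector [f + fls_const (- \<beta> / \<alpha>) * unif n, 1]"
      have "val_ge n (fls_const (- \<beta> / \<alpha>) * unif n)"
        by (intro val_ge_mult_le[of 0 _ n] val_ge_const) auto
      then have "?x \<in> L'"
        using False by (simp add: L'_iff L_def ball_lattice_iff \<phi>_def unif_mult_nth)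
      moreover have "?x \<notin> (*s) fls_X ` L"
        by (simp add: smult_image_iff L_def ball_lattice_iff val_ge_divide_iff del: fls_divide_X)
      ultimately show ?thesis using that by blast
    qed
    with sub show ?thesis by blast
  qed
  ultimately show "tree_adj (ball_vertex n f) w"
    unfolding tree_adj_def ball_vertex_def w using w_tree
    by (metis L'_def L_def ball_vertex_def ball_vertex_in_tree homothety_class_self w)
qed

text \<open>
  The functionals with \<open>\<alpha> = 0\<close> give the next larger ball, the others give the \<open>q\<close> balls of the
  next smaller radius.
\<close>
lemma tree_adj_ball:
  "tree_adj (ball_vertex n f) w \<longleftrightarrow>
     w = ball_vertex (n - 1) f \<or> (\<exists>a. w = ball_vertex (n + 1) (f + fls_const a * unif n))"
proof -
  have "homothety_class (hyperplane n f 0 \<beta>) = ball_vertex (n - 1) f" if "\<beta> \<noteq> 0" for \<beta>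
    using that by (simp add: hyperplane_parent homothety_class_smult ball_vertex_def)
  moreover have "homothety_class (hyperplane n f \<alpha> \<beta>) = ball_vertex (n + 1) (f + fls_const (- \<beta> / \<alpha>) * unif n)"
    if "\<alpha> \<noteq> 0" for \<alpha> \<beta>
    using that by (simp add: hyperplane_child ball_vertex_def)
  moreover have "- (- a) / 1 = a" for a :: 'a by simp
  ultimately show ?thesis
    unfolding tree_adj_hyperplane by (metis one_neq_zero)
qed

lemma tree_adj_sym:
  assumes "tree_adj v w"
  shows "tree_adj w v"
proof -
  obtain n f where v: "v = ball_vertex n f"
    using assms by (auto simp: tree_adj_def tree_vertices_eq)
  from assms consider "w = ball_vertex (n - 1) f" 
    | a where "w = ball_vertex (n + 1) (f + fls_const a * unif n)"
    by (auto simp: v tree_adj_ball)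
  then show ?thesis
  proof cases
    case 1
    have "v = ball_vertex ((n - 1) + 1) (f + fls_const 0 * unif (n - 1))"
      by (simp add: v)
    then show ?thesis
      unfolding 1 tree_adj_ball by blast
  next
    case 2
    have "val_ge n (fls_const a * unif n)"
      by (intro val_ge_mult_le[of 0 _ n] val_ge_const) auto
    then have "ball_vertex n (f + fls_const a * unif n) = ball_vertex n f"
      by (intro ball_vertex_cong) simp
    then show ?thesis
      unfolding 2 v tree_adj_ball by simp
  qed
qed

definition nbrs :: "'a::{field,finite} vertex \<Rightarrow> 'a vertex set" where
  "nbrs v = {w. tree_adj v w}"

lemma nbrs_ball:
  "nbrs (ball_vertex n f) = insert (ball_vertex (n - 1) f)
     (range (\<lambda>a. ball_vertex (n + 1) (f + fls_const a * unif n)))"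
  by (auto simp: nbrs_def tree_adj_ball)

lemma inj_children: "inj (\<lambda>a. ball_vertex (n + 1) (f + fls_const a * unif n))"
proof (rule injI)
  fix a b :: 'a
  assume "ball_vertex (n + 1) (f + fls_const a * unif n) = ball_vertex (n + 1) (f + fls_const b * unif n)"
  then have "val_ge (n + 1) (fls_const a * unif n - fls_const b * unif n)"
    by (simp add: ball_vertex_eq_iff)
  then show "a = b"
    by (simp add: val_ge_Suc unif_mult_nth)
qed

lemma card_nbrs:
  fixes v :: "'a::{field,finite} vertex"
  assumes "v \<in> tree_vertices"
  shows "finite (nbrs v)" "card (nbrs v) = CARD('a) + 1"
proof -
  obtain n and f :: "'a fls" where v: "v = ball_vertex n f"
    using assms by (auto simp: tree_vertices_eq)
  show "finite (nbrs v)" by (simp add: v nbrs_ball)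
  have "ball_vertex (n - 1) f \<notin> range (\<lambda>a. ball_vertex (n + 1) (f + fls_const a * unif n))"
    by (auto simp: ball_vertex_eq_iff)
  then show "card (nbrs v) = CARD('a) + 1"
    by (simp add: v nbrs_ball card_image[OF inj_children])
qed

lemma nbrs_in_tree: "w \<in> nbrs v \<Longrightarrow> w \<in> tree_vertices" "w \<in> nbrs v \<Longrightarrow> v \<in> tree_vertices"
  by (auto simp: nbrs_def tree_adj_def)

section \<open>The tree seen from an end\<close>

text \<open>
  The level is the Busemann function of the end of the tree at which the balls exhaust \<open>F\<close>; the
  parent is the next vertex towards that end.
\<close>
definition level :: "'a::{field,finite} vertex \<Rightarrow> int" where
  "level v = (THE n. \<exists>f. v = ball_vertex n f)"

definition parent :: "'a::{field,finite} vertex \<Rightarrow> 'a vertex" where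
  "parent v = (THE w. \<exists>n f. v = ball_vertex n f \<and> w = ball_vertex (n - 1) f)"

lemma level_ball [simp]: "level (ball_vertex n f) = n"
  unfolding level_def by (rule the_equality) (blast, auto simp: ball_vertex_eq_iff)

lemma parent_ball [simp]: "parent (ball_vertex n f) = ball_vertex (n - 1) f"
proof -
  have "w = ball_vertex (n - 1) f" if "ball_vertex n f = ball_vertex n' f'" "w = ball_vertex (n' - 1) f'" for w n' f'
  proof -
    have "n' = n" "val_ge (n - 1) (f' - f)"
      using that(1) val_ge_mono[of n "f' - f" "n - 1"] by (auto simp: ball_vertex_eq_iff val_ge_swap)
    then show ?thesis
      using that(2) by (simp add: ball_vertex_eq_iff)
  qed
  then show ?thesis
    unfolding parent_def by (intro the_equality) blast+
qed

lemma nbrs_parent_or_child: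
  assumes "w \<in> nbrs v"
  shows "level w = level v - 1 \<and> w = parent v \<or> level w = level v + 1 \<and> v = parent w"
proof -
  obtain n f where v: "v = ball_vertex n f"
    using nbrs_in_tree(2)[OF assms] by (auto simp: tree_vertices_eq)
  have "val_ge n (fls_const a * unif n)" for a :: 'a
    by (intro val_ge_mult_le[of 0 _ n] val_ge_const) auto
  then have "ball_vertex n f = ball_vertex n (f + fls_const a * unif n)" for a :: 'a
    by (simp add: ball_vertex_eq_iff)
  then have *: "v = parent (ball_vertex (n + 1) (f + fls_const a * unif n))" for a :: 'a
    by (simp add: v)
  from assms consider "w = ball_vertex (n - 1) f" | a where "w = ball_vertex (n + 1) (f + fls_const a * unif n)"
    by (auto simp: v nbrs_ball)
  then show ?thesis
  proof cases
    case 1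
    then show ?thesis by (simp add: v)
  next
    case 2
    then have "v = parent w" using * by simp
    then show ?thesis using 2 by (simp add: v)
  qed
qed

section \<open>Matrices as automorphisms of the tree\<close>

lemma GL2_inverse:
  fixes g :: "'a::{field,finite} mat2"
  assumes "det g \<noteq> 0"
  obtains g' where "g ** g' = mat 1" "g' ** g = mat 1"
proof -
  have "invertible g"
    using assms by (simp add: invertible_det_nz)
  then show ?thesis
    using that unfolding invertible_def by blast
qed

lemma act_ball: "act g (ball_vertex n f) = homothety_class ((*v) (g ** mat22 (unif n) f 0 1) ` std_lattice)"
  by (simp add: ball_vertex_def act_homothety_class ball_lattice_eq_matrix matrix_mul_image)

lemma act_in_tree:
  assumes "det g \<noteq> 0" "v \<in> tree_vertices"
  shows "act g v \<in> tree_vertices"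
proof -
  obtain n f where v: "v = ball_vertex n f"
    using assms by (auto simp: tree_vertices_eq)
  have "det (g ** mat22 (unif n) f 0 1) \<noteq> 0"
    using assms by (simp add: det_mul)
  from lattice_homothetic_ball[OF this] show ?thesis
    by (auto simp: v act_ball)
qed

lemma tree_adj_act:
  assumes g: "det g \<noteq> 0" and adj: "tree_adj v w"
  shows "tree_adj (act g v) (act g w)"
proof -
  obtain g' where g': "g ** g' = mat 1" "g' ** g = mat 1"
    using GL2_inverse[OF g] .
  have g'_g: "g' *v (g *v x) = x" and g_g': "g *v (g' *v x) = x" for x
    by (simp_all add: matrix_vector_mul_assoc g')
  obtain L L' where L: "L \<in> v" "L' \<in> w" "(*s) fls_X ` L \<subset> L'" "L' \<subset> L" "quotient_is_residue_field L L'"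
    using adj by (auto simp: tree_adj_def)
  then obtain \<phi> where add: "\<And>x y. x \<in> L \<Longrightarrow> y \<in> L \<Longrightarrow> \<phi> (x + y) = \<phi> x + \<phi> y"
    and smult: "\<And>a x. a \<in> integer_ring \<Longrightarrow> x \<in> L \<Longrightarrow> \<phi> (a *s x) = fls_nth a 0 * \<phi> x"
    and onto: "\<phi> ` L = UNIV" and ker: "{x\<in>L. \<phi> x = 0} = L'"
    unfolding quotient_is_residue_field_def by blast
  have inj: "inj ((*v) g)"
    by (metis g'_g injI)
  have "quotient_is_residue_field ((*v) g ` L) ((*v) g ` L')"
    unfolding quotient_is_residue_field_def
  proof (intro exI[of _ "\<lambda>x. \<phi> (g' *v x)"] conjI ballI)
    show "\<phi> (g' *v (x + y)) = \<phi> (g' *v x) + \<phi> (g' *v y)" if "x \<in> (*v) g ` L" "y \<in> (*v) g ` L" for x y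
      using that by (auto simp: matrix_vector_right_distrib g'_g add)
    show "\<phi> (g' *v (a *s x)) = fls_nth a 0 * \<phi> (g' *v x)" if "a \<in> integer_ring" "x \<in> (*v) g ` L" for a x
      using that by (auto simp: vector_scalar_commute g'_g smult)
    show "(\<lambda>x. \<phi> (g' *v x)) ` (*v) g ` L = UNIV"
      using onto by (simp add: image_image g'_g)
    show "{x \<in> (*v) g ` L. \<phi> (g' *v x) = 0} = (*v) g ` L'"
      using ker by (auto simp: g'_g)
  qed
  moreover have "(*v) g ` L' \<subset> (*v) g ` L"
    using L(4) inj by (simp add: inj_image_mem_iff psubset_eq inj_image_subset_iff inj_image_eq_iff)
  moreover have "(*s) fls_X ` (*v) g ` L \<subset> (*v) g ` L'"
    using L(3) inj unfolding matrix_smult_image[symmetric]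
    by (simp add: psubset_eq inj_image_subset_iff inj_image_eq_iff)
  moreover have "(*v) g ` L \<in> act g v" "(*v) g ` L' \<in> act g w"
    using L by (auto simp: act_def)
  moreover have "act g v \<in> tree_vertices" "act g w \<in> tree_vertices"
    using adj act_in_tree[OF g] by (auto simp: tree_adj_def)
  ultimately show ?thesis
    unfolding tree_adj_def by (intro conjI bexI)
qed

lemma nbrs_act:
  assumes g: "det g \<noteq> 0"
  shows "nbrs (act g v) = act g ` nbrs v"
proof -
  obtain g' where g': "g ** g' = mat 1" "g' ** g = mat 1"
    using GL2_inverse[OF g] .
  have "det g * det g' = 1"
    using g'(1) by (metis det_I det_mul)
  then have dg': "det g' \<noteq> 0" by auto
  have "act g' (act g u) = u" "act g (act g' u) = u" for u
    by (simp_all add: act_mult g')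
  then have "\<exists>u. tree_adj v u \<and> w = act g u" if "tree_adj (act g v) w" for w
    using tree_adj_act[OF dg' that] by metis
  then show ?thesis
    using tree_adj_act[OF g] by (auto simp: nbrs_def)
qed

lemma inj_act: 
  assumes "det g \<noteq> 0"
  shows "inj (act g)"
proof -
  obtain g' where "g ** g' = mat 1" "g' ** g = mat 1"
    using GL2_inverse[OF assms] .
  then have "act g' (act g u) = u" for u
    by (simp add: act_mult)
  then show ?thesis by (metis injI)
qed

section \<open>Existence of heights\<close>

lemma has_entries_2: "has_entries R g \<longleftrightarrow> g $ 1 $ 1 \<in> R \<and> g $ 1 $ 2 \<in> R \<and> g $ 2 $ 1 \<in> R \<and> g $ 2 $ 2 \<in> R"
  by (auto simp: has_entries_def forall_2)

lemma has_entries_poly_mult: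
  "has_entries poly_ring g \<Longrightarrow> has_entries poly_ring h \<Longrightarrow> has_entries poly_ring (g ** h)"
  by (simp add: has_entries_2 matrix_matrix_2 poly_ring_add poly_ring_mult)

lemma GL2_poly_mult: "g \<in> GL2 poly_ring \<Longrightarrow> h \<in> GL2 poly_ring \<Longrightarrow> g ** h \<in> GL2 poly_ring"
proof -
  assume "g \<in> GL2 poly_ring" "h \<in> GL2 poly_ring"
  then obtain g' h' where *: "has_entries poly_ring g" "has_entries poly_ring g'" "g ** g' = mat 1" "g' ** g = mat 1"
    "has_entries poly_ring h" "has_entries poly_ring h'" "h ** h' = mat 1" "h' ** h = mat 1"
    by (auto simp: GL2_def)
  have "(g ** h) ** (h' ** g') = g ** ((h ** h') ** g')" "(h' ** g') ** (g ** h) = h' ** ((g' ** g) ** h)"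
    by (simp_all add: matrix_mul_assoc)
  then have "(g ** h) ** (h' ** g') = mat 1" "(h' ** g') ** (g ** h) = mat 1"
    using * by simp_all
  with * show ?thesis
    unfolding GL2_def using has_entries_poly_mult by blast
qed

lemma GL2_poly_inverse:
  assumes "g \<in> GL2 poly_ring"
  obtains g' where "g' \<in> GL2 poly_ring" "g ** g' = mat 1" "g' ** g = mat 1"
  using assms that by (auto simp: GL2_def)

lemma has_entries_poly_1: "has_entries poly_ring (mat 1)"
  by (auto simp: has_entries_def mat_def)

lemma GL2_poly_1: "mat 1 \<in> GL2 poly_ring"
  unfolding GL2_def using has_entries_poly_1 by fastforce

lemma det_poly: "has_entries poly_ring g \<Longrightarrow> det g \<in> poly_ring"
  unfolding has_entries_2 det_2 diff_conv_add_uminus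
  by (intro poly_ring_add poly_ring_minus poly_ring_mult) auto

lemma GL2_poly_det:
  assumes "g \<in> GL2 poly_ring"
  shows "det g \<noteq> 0" "fls_subdegree (det g) = 0" "det g \<in> poly_ring" "1 / det g \<in> poly_ring"
proof -
  obtain g' where *: "has_entries poly_ring g" "has_entries poly_ring g'" "g ** g' = mat 1"
    using assms by (auto simp: GL2_def)
  have d: "det g * det g' = 1"
    using *(3) by (metis det_I det_mul)
  then show 0: "det g \<noteq> 0" by auto
  have 1: "det g' \<noteq> 0" using d by auto
  have "fls_subdegree (det g) + fls_subdegree (det g') = 0"
    using d 0 1 by (metis fls_one_subdegree fls_subdegree_mult)
  with poly_ring_subdegree[OF det_poly[OF *(1)]] poly_ring_subdegree[OF det_poly[OF *(2)]]
  show "fls_subdegree (det g) = 0" by simp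
  show "det g \<in> poly_ring" using *(1) by (rule det_poly)
  have "1 / det g = det g'" using d 0 by (simp add: field_simps)
  then show "1 / det g \<in> poly_ring" using *(2) det_poly by simp
qed

lemma mat22_mult: "mat22 a b c d ** mat22 a' b' c' d' = 
    mat22 (a * a' + b * c') (a * b' + b * d') (c * a' + d * c') (c * b' + d * d')"
  by (simp add: mat2_eq_iff matrix_matrix_2)

lemma mat22_1: "mat22 1 0 0 1 = mat 1"
  by (simp add: mat2_eq_iff mat_def)

text \<open>
  The orbit relation of \<open>GL\<^sub>2(F\<^sub>q[t])\<close>, in the form in which it occurs in the definition of the height.
\<close>
definition poly_equiv :: "'a::{field,finite} vertex \<Rightarrow> 'a vertex \<Rightarrow> bool" where
  "poly_equiv v w \<longleftrightarrow> (\<exists>\<gamma>\<in>GL2 poly_ring. v = act \<gamma> w)"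

lemma poly_equiv_refl: "poly_equiv v v"
  unfolding poly_equiv_def using GL2_poly_1 act_1 by metis

lemma poly_equiv_trans: "poly_equiv u v \<Longrightarrow> poly_equiv v w \<Longrightarrow> poly_equiv u w"
  unfolding poly_equiv_def using GL2_poly_mult act_mult by metis

lemma poly_equiv_sym: "poly_equiv u v \<Longrightarrow> poly_equiv v u"
  unfolding poly_equiv_def by (metis GL2_poly_inverse act_mult act_1)

lemma ray_vertex_eq_ball: "ray_vertex n = ball_vertex (- int n) 0"
proof -
  have "diag2 (fls_X_inv ^ n) 1 = mat22 (unif (- int n)) 0 0 (1 :: 'a fls)"
    by (simp add: diag2_def mat22_def X_inv_power_unif)
  then show ?thesis
    by (simp add: ray_vertex_def act_homothety_class ball_vertex_def ball_lattice_eq_matrix)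
qed

lemma poly_equiv_translate:
  assumes "p \<in> poly_ring"
  shows "poly_equiv (ball_vertex n (f + p)) (ball_vertex n f)"
proof -
  have "mat22 1 p 0 1 \<in> GL2 poly_ring"
    unfolding GL2_def using assms 
    by (intro CollectI conjI exI[of _ "mat22 1 (- p) 0 1"])
       (simp_all add: has_entries_2 poly_ring_minus mat22_mult mat22_1)
  moreover have "act (mat22 1 p 0 1) (ball_vertex n f) = ball_vertex n (f + p)"
    unfolding act_ball by (simp add: mat22_mult ball_vertex_def ball_lattice_eq_matrix add.commute)
  ultimately show ?thesis
    unfolding poly_equiv_def by metis
qed

lemma swap_GL2_poly: "mat22 0 1 1 0 \<in> GL2 poly_ring"
  unfolding GL2_def
  by (intro CollectI conjI exI[of _ "mat22 0 1 1 0"])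
     (simp_all add: has_entries_2 mat22_mult mat22_1)

lemma swap_image_iff: "x \<in> (*v) (mat22 0 1 1 0) ` L \<longleftrightarrow> vector [x $ 2, x $ 1] \<in> L"
  for L :: "('a::{field,finite} fls ^ 2) set"
proof
  assume "x \<in> (*v) (mat22 0 1 1 0) ` L"
  then obtain y where "y \<in> L" "x = mat22 0 1 1 0 *v y" by blast
  moreover from this have "vector [x $ 2, x $ 1] = y"
    by (simp add: vec2_eq_iff matrix_vector_2)
  ultimately show "vector [x $ 2, x $ 1] \<in> L" by simp
next
  assume "vector [x $ 2, x $ 1] \<in> L"
  moreover have "x = mat22 0 1 1 0 *v vector [x $ 2, x $ 1]"
    by (simp add: vec2_eq_iff matrix_vector_2)
  ultimately show "x \<in> (*v) (mat22 0 1 1 0) ` L" by blast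
qed

lemma poly_equiv_swap: "poly_equiv (ball_vertex n 0) (ball_vertex (- n) (0 :: 'a::{field,finite} fls))"
proof -
  have "(*v) (mat22 0 1 1 0) ` ball_lattice (- n) (0 :: 'a fls) = (*s) (unif (- n)) ` ball_lattice n 0"
    by (rule set_eqI) (auto simp: swap_image_iff smult_image_iff ball_lattice_iff val_ge_divide_iff)
  then have "act (mat22 0 1 1 0) (ball_vertex (- n) (0 :: 'a fls)) = ball_vertex n 0"
    by (simp add: ball_vertex_def act_homothety_class homothety_class_smult)
  then show ?thesis
    unfolding poly_equiv_def using swap_GL2_poly by metis
qed

text \<open>
  Swapping the coordinates acts on \<open>F\<close> by \<open>f \<mapsto> 1/f\<close>, whose derivative at \<open>f\<close> has valuation
  \<open>-2 v(f)\<close>; this is why the exponent of the ball drops by \<open>2 v(f)\<close>.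
\<close>
lemma poly_equiv_invert:
  fixes f :: "'a::{field,finite} fls"
  assumes f: "f \<noteq> 0" and d: "fls_subdegree f \<le> n"
  shows "poly_equiv (ball_vertex (n - 2 * fls_subdegree f) (1 / f)) (ball_vertex n f)"
proof -
  define d where "d = fls_subdegree f"
  have "(*v) (mat22 0 1 1 0) ` ball_lattice n f = (*s) f ` ball_lattice (n - 2 * d) (1 / f)"
  proof (rule set_eqI)
    fix z :: "'a fls ^ 2"
    define x y where "x = z $ 1" and "y = z $ 2"
    have "x / f - y / f / f = (f * x - y) / (f * f)"
      using f by (simp add: field_simps)
    then have "z \<in> (*s) f ` ball_lattice (n - 2 * d) (1 / f) \<longleftrightarrow> val_ge d y \<and> val_ge n (f * x - y)"
      using f by (simp add: smult_image_iff ball_lattice_iff x_def y_def d_def val_ge_divide_iff)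
    also have "\<dots> \<longleftrightarrow> val_ge d (f * x) \<and> val_ge n (f * x - y)"
    proof -
      have "val_ge d (f * x - y)" if "val_ge n (f * x - y)"
        using val_ge_mono[OF that] d by (simp add: d_def)
      then show ?thesis
        using val_ge_add[of d "f * x - y" y] val_ge_diff[of d "f * x" "f * x - y"] by auto
    qed
    also have "\<dots> \<longleftrightarrow> val_ge 0 x \<and> val_ge n (y - f * x)"
      using f by (simp add: val_ge_mult_iff d_def val_ge_swap)
    also have "\<dots> \<longleftrightarrow> z \<in> (*v) (mat22 0 1 1 0) ` ball_lattice n f"
      by (simp add: swap_image_iff ball_lattice_iff x_def y_def)
    finally show "z \<in> (*v) (mat22 0 1 1 0) ` ball_lattice n f \<longleftrightarrow> z \<in> (*s) f ` ball_lattice (n - 2 * d) (1 / f)"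
      by simp
  qed
  then have "act (mat22 0 1 1 0) (ball_vertex n f) = ball_vertex (n - 2 * d) (1 / f)"
    using f by (simp add: ball_vertex_def act_homothety_class homothety_class_smult)
  then show ?thesis
    unfolding poly_equiv_def d_def using swap_GL2_poly by metis
qed

lemma poly_equiv_ball_0: "\<exists>k. poly_equiv (ball_vertex n 0) (ray_vertex k)"
proof (cases "n \<le> 0")
  case True
  then have "ball_vertex n 0 = ray_vertex (nat (- n))"
    by (simp add: ray_vertex_eq_ball)
  then show ?thesis using poly_equiv_refl by metis
next
  case False
  then have "ball_vertex (- n) 0 = ray_vertex (nat n)"
    by (simp add: ray_vertex_eq_ball)
  then show ?thesis using poly_equiv_swap by metis
qed

text \<open>
  The continued fraction algorithm. Subtracting the polynomial part makes \<open>v(f) \<ge> 1\<close>; if the ball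
  then contains \<open>0\<close> it is a ball around \<open>0\<close>, and otherwise inversion makes \<open>n\<close> strictly smaller.
\<close>
lemma poly_equiv_ray_exists: "\<exists>k. poly_equiv (ball_vertex n f) (ray_vertex k)"
proof (induction "nat n" arbitrary: n f rule: less_induct)
  case less
  obtain p where p: "p \<in> poly_ring" "val_ge 1 (f - p)"
    using poly_ring_decomp by blast
  define f' where "f' = f - p"
  have step: "poly_equiv (ball_vertex n f) (ball_vertex n f')"
    using poly_equiv_translate[OF p(1), of n f'] by (simp add: f'_def)
  show ?case
  proof (cases "val_ge n f'")
    case True
    then have "ball_vertex n f' = ball_vertex n 0"
      by (intro ball_vertex_cong) simp
    then show ?thesis
      using poly_equiv_ball_0 step poly_equiv_trans by metis
  next
    case False
    then have f': "f' \<noteq> 0" "fls_subdegree f' < n" "1 \<le> fls_subdegree f'"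
      using p(2) by (auto simp: val_ge_def f'_def)
    then have "nat (n - 2 * fls_subdegree f') < nat n" by simp
    from less[OF this] obtain k where "poly_equiv (ball_vertex (n - 2 * fls_subdegree f') (1 / f')) (ray_vertex k)"
      by blast
    with poly_equiv_invert[OF f'(1), of n] f'(2) step show ?thesis
      by (metis less_imp_le poly_equiv_sym poly_equiv_trans)
  qed
qed

section \<open>Uniqueness of heights\<close>

lemma matrix_entries_from_std:
  assumes "(*v) A ` std_lattice \<subseteq> (*s) c ` std_lattice" "c \<noteq> 0"
  shows "val_ge (fls_subdegree c) (A $ i $ j)"
proof -
  have "A *v vector [1, 0] \<in> (*s) c ` std_lattice" "A *v vector [0, 1] \<in> (*s) c ` std_lattice"
    using assms(1) by (auto simp: std_lattice_iff)
  then have "\<forall>i j. val_ge (fls_subdegree c) (A $ i $ j)"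
    using assms(2) by (simp add: smult_image_iff std_lattice_iff matrix_vector_2 val_ge_divide_iff forall_2)
  then show ?thesis by blast
qed

lemma val_ge_det:
  assumes "\<And>i j. val_ge e (A $ i $ j)"
  shows "val_ge (2 * e) (det (A :: 'a::{field,finite} mat2))"
proof -
  have "val_ge (2 * e) (A $ i $ j * A $ k $ l)" for i j k l
    using val_ge_mult[OF assms assms] by (simp only: mult_2)
  then show ?thesis
    by (simp add: det_2 val_ge_diff)
qed

lemma ray_vertex_0: "ray_vertex 0 = homothety_class std_lattice"
  by (simp add: ray_vertex_eq_ball ball_vertex_def std_lattice_eq_ball)

text \<open>
  Two matrices with the same image of \<open>v\<^sub>0\<close> differ by a scalar of some valuation \<open>e\<close> and an element
  of \<open>GL\<^sub>2(O)\<close>. Only the valuations of entries and determinants are recorded: they decide uniqueness of heights, the parity of heights on \<open>SL\<^sub>2(F) v\<^sub>0\<close> and the stabilizer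
  of \<open>v\<^sub>0\<close>.
\<close>
lemma act_origin_eq_imp:
  fixes g h :: "'a::{field,finite} mat2"
  assumes dets: "det g \<noteq> 0" "det h \<noteq> 0" and eq: "act g (ray_vertex 0) = act h (ray_vertex 0)"
  obtains e K where "g = h ** K" "\<And>i j. val_ge e (K $ i $ j)" 
    "fls_subdegree (det g) = fls_subdegree (det h) + 2 * e"
proof -
  obtain h' where h': "h ** h' = mat 1" "h' ** h = mat 1"
    using GL2_inverse[OF dets(2)] .
  obtain g' where g': "g ** g' = mat 1" "g' ** g = mat 1"
    using GL2_inverse[OF dets(1)] .
  obtain c where c: "c \<noteq> 0" and gc: "(*v) g ` std_lattice = (*s) c ` (*v) h ` std_lattice"
    using eq[symmetric] unfolding ray_vertex_0 act_homothety_class homothety_class_eq_iff by blast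
  define e where "e = fls_subdegree c"
  define K where "K = h' ** g"
  define K' where "K' = g' ** h"
  have "(*v) K ` std_lattice = (*s) c ` (*v) (h' ** h) ` std_lattice"
    by (simp only: K_def matrix_mul_image gc matrix_smult_image)
  then have "(*v) K ` std_lattice = (*s) c ` std_lattice"
    by (simp add: h')
  then have K: "val_ge e (K $ i $ j)" for i j
    unfolding e_def by (intro matrix_entries_from_std c) simp
  have "(*v) h ` std_lattice = (*s) (1 / c) ` (*v) g ` std_lattice"
    unfolding gc smult_smult_image using c by simp
  then have "(*v) K' ` std_lattice = (*s) (1 / c) ` (*v) (g' ** g) ` std_lattice"
    by (simp only: K'_def matrix_mul_image matrix_smult_image)
  then have "(*v) K' ` std_lattice = (*s) (1 / c) ` std_lattice"
    by (simp add: g')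
  then have K': "val_ge (fls_subdegree (1 / c)) (K' $ i $ j)" for i j
    by (intro matrix_entries_from_std) (use c in auto)
  have g_eq: "g = h ** K"
    by (simp add: K_def matrix_mul_assoc h')
  have h_eq: "h = g ** K'"
    by (simp add: K'_def matrix_mul_assoc g')
  have dg: "det g = det h * det K" and dh: "det h = det g * det K'"
    using g_eq h_eq det_mul by metis+
  have nz: "det K \<noteq> 0" "det K' \<noteq> 0" using dg dh dets by auto
  have "2 * e \<le> fls_subdegree (det K)"
    using val_ge_det[OF K] nz by (simp add: val_ge_def)
  moreover have "2 * (- e) \<le> fls_subdegree (det K')"
    using val_ge_det[OF K'] nz c by (simp add: val_ge_def e_def subdegree_divide')
  moreover have "fls_subdegree (det g) = fls_subdegree (det h) + fls_subdegree (det K)"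
    "fls_subdegree (det h) = fls_subdegree (det g) + fls_subdegree (det K')"
    using dg dh nz dets by (metis fls_subdegree_mult)+
  ultimately have "fls_subdegree (det g) = fls_subdegree (det h) + 2 * e" by simp
  with g_eq K show ?thesis using that by blast
qed

definition ray_matrix :: "nat \<Rightarrow> 'a::{field,finite} mat2" where
  "ray_matrix n = mat22 (unif (- int n)) 0 0 1"

lemma ray_vertex_eq_act: "ray_vertex n = act (ray_matrix n) (ray_vertex 0)"
proof -
  have "diag2 (fls_X_inv ^ n) 1 = (ray_matrix n :: 'a mat2)"
    by (simp add: diag2_def ray_matrix_def mat22_def X_inv_power_unif)
  then show ?thesis unfolding ray_vertex_0 ray_vertex_def[of n] by simp
qed

lemma det_ray_matrix [simp]: "det (ray_matrix n) = unif (- int n)"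
  by (simp add: ray_matrix_def)

text \<open>
  If \<open>\<gamma> v\<^sub>n = v\<^sub>m\<close> with \<open>m < n\<close>, comparing determinants gives the scalar between the lattices the
  valuation \<open>(m - n)/2\<close>. Then both entries in the first column of \<open>\<gamma>\<close> have positive valuation, so
  they vanish and \<open>\<gamma>\<close> is singular.
\<close>
lemma poly_equiv_ray_le:
  assumes "poly_equiv (ray_vertex m) (ray_vertex n :: 'a::{field,finite} vertex)"
  shows "n \<le> m"
proof (rule ccontr)
  assume "\<not> n \<le> m"
  then have less: "int m < int n" by simp
  obtain \<gamma> :: "'a mat2" where \<gamma>: "\<gamma> \<in> GL2 poly_ring" "ray_vertex m = act \<gamma> (ray_vertex n)"
    using assms by (auto simp: poly_equiv_def)
  have eq: "act (\<gamma> ** ray_matrix n) (ray_vertex 0) = act (ray_matrix m) (ray_vertex 0 :: 'a vertex)"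
    by (simp only: act_mult[symmetric] ray_vertex_eq_act[symmetric] \<gamma>(2))
  have "det (\<gamma> ** ray_matrix n) \<noteq> 0" "det (ray_matrix m :: 'a mat2) \<noteq> 0"
    using GL2_poly_det[OF \<gamma>(1)] by (simp_all add: det_mul)
  then obtain e K where K: "\<gamma> ** ray_matrix n = ray_matrix m ** K" "\<And>i j. val_ge e (K $ i $ j)"
    and e: "fls_subdegree (det (\<gamma> ** ray_matrix n)) = fls_subdegree (det (ray_matrix m :: 'a mat2)) + 2 * e"
    using act_origin_eq_imp[OF _ _ eq] by metis
  have e: "2 * e = int m - int n"
    using e GL2_poly_det[OF \<gamma>(1)] by (simp add: det_mul)
  have "\<gamma> $ 1 $ 1 * unif (- int n) = unif (- int m) * K $ 1 $ 1" "\<gamma> $ 2 $ 1 * unif (- int n) = K $ 2 $ 1"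
    using arg_cong[OF K(1), of "\<lambda>A. A $ 1 $ 1"] arg_cong[OF K(1), of "\<lambda>A. A $ 2 $ 1"]
    by (simp_all add: matrix_matrix_2 ray_matrix_def)
  moreover have "val_ge (e - int m) (unif (- int m) * K $ 1 $ 1)"
    using K(2) by (simp add: val_ge_mult_iff)
  moreover have "val_ge e (K $ 2 $ 1)" using K(2) .
  ultimately have "val_ge (e - int m) (\<gamma> $ 1 $ 1 * unif (- int n))" "val_ge e (\<gamma> $ 2 $ 1 * unif (- int n))"
    by simp_all
  then have "val_ge (e - int m + int n) (\<gamma> $ 1 $ 1)" "val_ge (e + int n) (\<gamma> $ 2 $ 1)"
    by (simp_all add: val_ge_mult_iff)
  then have "val_ge 1 (\<gamma> $ 1 $ 1)" "val_ge 1 (\<gamma> $ 2 $ 1)"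
    using e less by (auto elim!: val_ge_mono)
  moreover have "\<gamma> $ 1 $ 1 \<in> poly_ring" "\<gamma> $ 2 $ 1 \<in> poly_ring"
    using \<gamma>(1) by (auto simp: GL2_def has_entries_def)
  ultimately have "\<gamma> $ 1 $ 1 = 0" "\<gamma> $ 2 $ 1 = 0"
    using poly_ring_val_ge_1 by blast+
  then show False
    using GL2_poly_det(1)[OF \<gamma>(1)] by (simp add: det_2)
qed

lemma height_eqI:
  assumes "poly_equiv v (ray_vertex n)"
  shows "height v = n"
  unfolding height_def poly_equiv_def[symmetric]
proof (rule the_equality[where P = "\<lambda>n. poly_equiv v (ray_vertex n)"])
  fix m assume m: "poly_equiv v (ray_vertex m)"
  have "n \<le> m"
    by (rule poly_equiv_ray_le[OF poly_equiv_trans[OF poly_equiv_sym[OF m] assms]])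
  moreover have "m \<le> n"
    by (rule poly_equiv_ray_le[OF poly_equiv_trans[OF poly_equiv_sym[OF assms] m]])
  ultimately show "m = n" by simp
qed (fact assms)

lemma height_spec: "v \<in> tree_vertices \<Longrightarrow> poly_equiv v (ray_vertex (height v))"
proof -
  assume "v \<in> tree_vertices"
  then obtain n f where "v = ball_vertex n f"
    by (auto simp: tree_vertices_eq)
  then obtain k where k: "poly_equiv v (ray_vertex k)"
    using poly_equiv_ray_exists by metis
  then show ?thesis using height_eqI[OF k] by simp
qed

lemma height_poly_equiv:
  assumes "poly_equiv v w" "w \<in> tree_vertices"
  shows "height v = height w"
  using height_eqI[OF poly_equiv_trans[OF assms(1) height_spec[OF assms(2)]]] .

lemma height_act: "\<gamma> \<in> GL2 poly_ring \<Longrightarrow> v \<in> tree_vertices \<Longrightarrow> height (act \<gamma> v) = height v"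
  using height_poly_equiv unfolding poly_equiv_def by blast

lemma height_ray: "height (ray_vertex n) = n"
  using height_eqI[OF poly_equiv_refl] .

lemma ray_vertex_in_tree [simp]: "ray_vertex n \<in> tree_vertices"
  by (simp add: ray_vertex_eq_ball)

text \<open>
  The parent of the ball \<open>v\<^sub>n\<close> is \<open>v\<^sub>n\<^sub>+\<^sub>1\<close>. Its children have centres \<open>a t\<^sup>n\<close>, which are polynomials, so
  they all lie in the orbit of the child centred at \<open>0\<close>; for \<open>n = 0\<close> that child is exchanged with
  \<open>v\<^sub>1\<close> by swapping the coordinates.
\<close>
lemma height_nbrs_ray:
  "ray_vertex (n + 1) \<in> nbrs (ray_vertex n :: 'a::{field,finite} vertex)"
  "w \<in> nbrs (ray_vertex n :: 'a vertex) \<Longrightarrow> w \<noteq> ray_vertex (n + 1) \<Longrightarrow> 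
     height w = (if n = 0 then 1 else n - 1)"
proof -
  have up: "ball_vertex (- int n - 1) 0 = (ray_vertex (n + 1) :: 'a vertex)"
    unfolding ray_vertex_eq_ball by (rule arg_cong2[where f = ball_vertex]) simp_all
  show "ray_vertex (n + 1) \<in> nbrs (ray_vertex n :: 'a vertex)"
    unfolding ray_vertex_eq_ball[of n] nbrs_ball up by simp
  assume "w \<in> nbrs (ray_vertex n :: 'a vertex)" "w \<noteq> ray_vertex (n + 1)"
  then obtain a :: 'a where w: "w = ball_vertex (- int n + 1) (0 + fls_const a * unif (- int n))"
    unfolding ray_vertex_eq_ball[of n] nbrs_ball up by auto
  have "poly_equiv w (ball_vertex (- int n + 1) 0)"
    unfolding w by (intro poly_equiv_translate poly_ring_mult poly_ring_const poly_ring_unif) simp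
  moreover have "poly_equiv (ball_vertex (- int n + 1) 0) (ray_vertex (if n = 0 then 1 else n - 1) :: 'a vertex)"
  proof (cases "n = 0")
    case True
    then show ?thesis using poly_equiv_swap[of 1] by (simp add: ray_vertex_eq_ball)
  next
    case False
    then have "ball_vertex (- int n + 1) 0 = (ray_vertex (n - 1) :: 'a vertex)"
      by (simp add: ray_vertex_eq_ball of_nat_diff)
    then show ?thesis using False poly_equiv_refl by simp
  qed
  ultimately show "height w = (if n = 0 then 1 else n - 1)"
    by (rule height_eqI[OF poly_equiv_trans])
qed

lemma height_nbrs:
  fixes v :: "'a::{field,finite} vertex"
  assumes "v \<in> tree_vertices"
  obtains u where "u \<in> nbrs v" "height u = height v + 1"
    "\<And>w. w \<in> nbrs v \<Longrightarrow> w \<noteq> u \<Longrightarrow> height w = (if height v = 0 then 1 else height v - 1)"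
proof -
  define n where "n = height v"
  obtain \<gamma> :: "'a mat2" where \<gamma>: "\<gamma> \<in> GL2 poly_ring" and v: "v = act \<gamma> (ray_vertex n)"
    using height_spec[OF assms] by (auto simp: poly_equiv_def n_def)
  have nb: "nbrs v = act \<gamma> ` nbrs (ray_vertex n)"
    unfolding v by (rule nbrs_act[OF GL2_poly_det(1)[OF \<gamma>]])
  show ?thesis
  proof (rule that)
    show "act \<gamma> (ray_vertex (n + 1)) \<in> nbrs v"
      unfolding nb using height_nbrs_ray(1) by blast
    show "height (act \<gamma> (ray_vertex (n + 1))) = height v + 1"
      using height_act[OF \<gamma>] height_ray by (simp add: n_def)
  next
    fix w assume "w \<in> nbrs v" "w \<noteq> act \<gamma> (ray_vertex (n + 1))"
    then obtain u where u: "u \<in> nbrs (ray_vertex n)" "u \<noteq> ray_vertex (n + 1)" "w = act \<gamma> u"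
      unfolding nb by blast
    then show "height w = (if height v = 0 then 1 else height v - 1)"
      using height_nbrs_ray(2) height_act[OF \<gamma>] nbrs_in_tree(1) n_def by metis
  qed
qed

section \<open>Non-backtracking paths\<close>

lemma Desc_0: "tree_adj y z \<Longrightarrow> Desc 0 (y, z) = {z}"
proof -
  assume "tree_adj y z"
  then have "\<exists>p. p 0 = y \<and> p 1 = z \<and> (\<forall>i\<le>0::nat. tree_adj (p i) (p (i + 1)))"
    by (intro exI[of _ "\<lambda>i::nat. if i = 0 then y else z"]) simp
  then show ?thesis by (auto simp: Desc_def)
qed

lemma Desc_Suc:
  assumes "tree_adj y z"
  shows "Desc (Suc N) (y, z) = (\<Union>w\<in>nbrs z - {y}. Desc N (z, w))"
proof (intro set_eqI iffI)
  fix u assume "u \<in> Desc (Suc N) (y, z)"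
  then obtain p where p: "u = p (Suc N + 1)" "p 0 = y" "p 1 = z" "\<And>i. i \<le> Suc N \<Longrightarrow> tree_adj (p i) (p (i + 1))"
    "\<And>i. i < Suc N \<Longrightarrow> p (i + 2) \<noteq> p i"
    by (auto simp: Desc_def)
  have "u \<in> Desc N (z, p 2)"
    unfolding Desc_def using p(1,3) p(4)[of "Suc _"] p(5)[of "Suc _"]
    by (intro CollectI exI[of _ "\<lambda>i. p (Suc i)"]) (simp add: numeral_2_eq_2)
  moreover have "p 2 \<in> nbrs z - {y}"
    using p(2,3) p(4)[of 1] p(5)[of 0] by (simp add: nbrs_def numeral_2_eq_2)
  ultimately show "u \<in> (\<Union>w\<in>nbrs z - {y}. Desc N (z, w))" by blast
next
  fix u assume "u \<in> (\<Union>w\<in>nbrs z - {y}. Desc N (z, w))"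
  then obtain w p where w: "tree_adj z w" "w \<noteq> y" and p: "u = p (N + 1)" "p 0 = z" "p 1 = w"
    "\<And>i. i \<le> N \<Longrightarrow> tree_adj (p i) (p (i + 1))" "\<And>i. i < N \<Longrightarrow> p (i + 2) \<noteq> p i"
    by (auto simp: Desc_def nbrs_def)
  define p' where "p' i = (case i of 0 \<Rightarrow> y | Suc j \<Rightarrow> p j)" for i
  have [simp]: "p' 0 = y" "\<And>i. p' (Suc i) = p i" by (simp_all add: p'_def)
  have "tree_adj (p' i) (p' (i + 1))" if "i \<le> Suc N" for i
    using that assms p(2) p(4) by (cases i) auto
  moreover have "p' (i + 2) \<noteq> p' i" if "i < Suc N" for i
    using that w(2) p(3) p(5) by (cases i) auto
  ultimately show "u \<in> Desc (Suc N) (y, z)"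
    unfolding Desc_def using p(1,2) by (intro CollectI exI[of _ p']) simp
qed

lemma Desc_level_le:
  assumes "tree_adj z w" "u \<in> Desc N (z, w)"
  shows "level u \<le> level w + int N"
  using assms
proof (induction N arbitrary: z w)
  case 0
  then show ?case by (simp add: Desc_0)
next
  case (Suc N)
  then obtain w' where w': "w' \<in> nbrs w" "u \<in> Desc N (w, w')"
    by (auto simp: Desc_Suc)
  then have "level u \<le> level w' + int N"
    using Suc.IH by (simp add: nbrs_def)
  moreover have "level w' \<le> level w + 1"
    using nbrs_parent_or_child[OF w'(1)] by auto
  ultimately show ?case by simp
qed

text \<open>
  A path that descends once descends forever, because the only ascending step would backtrack. Its
  first vertex is recovered from its end by taking parents.
\<close>
lemma Desc_below_child:
  assumes "tree_adj z w" "z = parent w" "u \<in> Desc N (z, w)"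
  shows "level u = level w + int N \<and> (parent ^^ N) u = w"
  using assms
proof (induction N arbitrary: z w)
  case 0
  then show ?case by (simp add: Desc_0)
next
  case (Suc N)
  then obtain w' where w': "w' \<in> nbrs w" "w' \<noteq> z" "u \<in> Desc N (w, w')"
    by (auto simp: Desc_Suc)
  then have w'_child: "level w' = level w + 1" "w = parent w'"
    using nbrs_parent_or_child[OF w'(1)] Suc.prems by auto
  then have "level u = level w' + int N \<and> (parent ^^ N) u = w'"
    using Suc.IH w' by (simp add: nbrs_def)
  then show ?case using w'_child by simp
qed

text \<open>
  Only one neighbour is an ascending first step, and the ends behind it have too small a level to
  lie behind a descending one. If both first steps descend, each is the ancestor of its end.
\<close>
lemma Desc_disjoint:
  assumes "w \<in> nbrs z" "w' \<in> nbrs z" "w \<noteq> w'"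
  shows "Desc N (z, w) \<inter> Desc N (z, w') = {}"
proof (rule ccontr)
  assume "\<not> ?thesis"
  then obtain u where u: "u \<in> Desc N (z, w)" "u \<in> Desc N (z, w')" by blast
  have adj: "tree_adj z w" "tree_adj z w'"
    using assms by (auto simp: nbrs_def)
  from nbrs_parent_or_child[OF assms(1)] nbrs_parent_or_child[OF assms(2)]
  show False
    using assms(3) Desc_level_le[OF adj(1) u(1)] Desc_level_le[OF adj(2) u(2)]
      Desc_below_child[OF adj(1) _ u(1)] Desc_below_child[OF adj(2) _ u(2)]
    by auto
qed

lemma finite_Desc: "tree_adj y z \<Longrightarrow> finite (Desc N (y, z))"
proof (induction N arbitrary: y z)
  case 0
  then show ?case by (simp add: Desc_0)
next
  case (Suc N)
  then have "finite (nbrs z)"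
    using card_nbrs(1)[of z] by (simp add: tree_adj_def)
  moreover have "finite (Desc N (z, w))" if "w \<in> nbrs z" for w
    using Suc.IH that by (simp add: nbrs_def)
  ultimately show ?case by (simp add: Desc_Suc[OF Suc.prems])
qed

lemma sum_Desc_Suc:
  assumes "tree_adj y z"
  shows "(\<Sum>u\<in>Desc (Suc N) (y, z). \<psi> u) = (\<Sum>w\<in>nbrs z - {y}. \<Sum>u\<in>Desc N (z, w). \<psi> u)"
  unfolding Desc_Suc[OF assms]
proof (rule sum.UNION_disjoint)
  show "finite (nbrs z - {y})"
    using assms card_nbrs(1)[of z] by (simp add: tree_adj_def)
  show "\<forall>w\<in>nbrs z - {y}. finite (Desc N (z, w))"
    by (auto simp: nbrs_def finite_Desc)
  show "\<forall>w\<in>nbrs z - {y}. \<forall>w'\<in>nbrs z - {y}. w \<noteq> w' \<longrightarrow> Desc N (z, w) \<inter> Desc N (z, w') = {}"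
    using Desc_disjoint by blast
qed

section \<open>The height walk\<close>

text \<open>
  The mean of \<open>\<Phi>\<close> at the height reached after \<open>N\<close> steps from a state, as a recursion over the first
  step.
\<close>
fun walk_avg :: "real \<Rightarrow> (nat \<Rightarrow> complex) \<Rightarrow> direction \<Rightarrow> nat \<Rightarrow> nat \<Rightarrow> complex" where
  "walk_avg q \<Phi> \<epsilon> k 0 = \<Phi> k"
| "walk_avg q \<Phi> Fwd k (Suc N) = (walk_avg q \<Phi> Fwd (k + 1) N + (q - 1) * walk_avg q \<Phi> Bwd (k - 1) N) / q"
| "walk_avg q \<Phi> Bwd 0 (Suc N) = walk_avg q \<Phi> Fwd 1 N"
| "walk_avg q \<Phi> Bwd (Suc k) (Suc N) = walk_avg q \<Phi> Bwd k N"

lemma sum_Desc_height: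
  fixes y z :: "'a::{field,finite} vertex"
  assumes "edge_state \<epsilon> k (y, z)"
  shows "(\<Sum>u\<in>Desc N (y, z). \<Phi> (height u)) = real CARD('a) ^ N * walk_avg (real CARD('a)) \<Phi> \<epsilon> k N"
  using assms
proof (induction N arbitrary: \<epsilon> k y z)
  case 0
  then have "tree_adj y z" "height z = k"
    by (cases \<epsilon>; simp)+
  then show ?case by (simp add: Desc_0)
next
  case (Suc N)
  define q where "q = real CARD('a)"
  have q: "q > 0" by (simp add: q_def)
  have adj: "tree_adj y z" and hz: "height z = k"
    using Suc.prems by (cases \<epsilon>; simp)+
  have z: "z \<in> tree_vertices" using adj by (simp add: tree_adj_def)
  have y: "y \<in> nbrs z" using tree_adj_sym[OF adj] by (simp add: nbrs_def)
  have fin: "finite (nbrs z)" and card: "card (nbrs z) = CARD('a) + 1"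
    using card_nbrs[OF z] by auto
  obtain u where u: "u \<in> nbrs z" "height u = k + 1" 
    and other: "\<And>w. w \<in> nbrs z \<Longrightarrow> w \<noteq> u \<Longrightarrow> height w = (if k = 0 then 1 else k - 1)"
    using height_nbrs[OF z] hz by metis
  define S where "S w = (\<Sum>u\<in>Desc N (z, w). \<Phi> (height u))" for w
  have S_up: "S w = q ^ N * walk_avg q \<Phi> Fwd (k + 1) N" if "w \<in> nbrs z" "height w = k + 1" for w
    unfolding S_def q_def by (rule Suc.IH) (use that hz in \<open>simp add: nbrs_def\<close>)
  have S_down: "S w = q ^ N * walk_avg q \<Phi> Bwd (k - 1) N" if "w \<in> nbrs z" "height w = k - 1" "k \<noteq> 0" for w
    unfolding S_def q_def by (rule Suc.IH) (use that hz in \<open>simp add: nbrs_def\<close>)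
  have sum: "(\<Sum>u\<in>Desc (Suc N) (y, z). \<Phi> (height u)) = (\<Sum>w\<in>nbrs z - {y}. S w)"
    unfolding S_def by (rule sum_Desc_Suc[OF adj])
  have card_y: "card (nbrs z - {y}) = CARD('a)"
    using card y fin by simp
  consider (fwd) "\<epsilon> = Fwd" "height y + 1 = k" | (bwd0) "\<epsilon> = Bwd" "k = 0" 
    | (bwd) k' where "\<epsilon> = Bwd" "k = Suc k'" "height y = k + 1"
    using Suc.prems by (cases \<epsilon>; cases k) auto
  then show ?case
  proof cases
    case fwd
    then have "u \<noteq> y" using u by auto
    then have "card (nbrs z - {y} - {u}) = CARD('a) - 1"
      using card_y u fin by simp
    moreover have "S w = q ^ N * walk_avg q \<Phi> Bwd (k - 1) N" if "w \<in> nbrs z - {y} - {u}" for w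
      using that other[of w] fwd(2) by (intro S_down) auto
    then have "(\<Sum>w\<in>nbrs z - {y} - {u}. S w) = (\<Sum>w\<in>nbrs z - {y} - {u}. q ^ N * walk_avg q \<Phi> Bwd (k - 1) N)"
      by (intro sum.cong) auto
    moreover have "(\<Sum>w\<in>nbrs z - {y}. S w) = S u + (\<Sum>w\<in>nbrs z - {y} - {u}. S w)"
      using u \<open>u \<noteq> y\<close> fin by (intro sum.remove) auto
    moreover have "of_nat (CARD('a) - 1) = complex_of_real (q - 1)"
      by (simp add: q_def of_nat_diff)
    ultimately have *: "(\<Sum>w\<in>nbrs z - {y}. S w) = q ^ N * walk_avg q \<Phi> Fwd (k + 1) N 
        + (q - 1) * (q ^ N * walk_avg q \<Phi> Bwd (k - 1) N)"
      using S_up u by simp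
    then show ?thesis
      unfolding sum * fwd(1) q_def[symmetric] using q by (simp add: field_simps)
  next
    case bwd0
    have "S w = q ^ N * walk_avg q \<Phi> Fwd 1 N" if "w \<in> nbrs z - {y}" for w
      using S_up[of w] that u(2) other[of w] bwd0(2) by (cases "w = u") auto
    then have "(\<Sum>w\<in>nbrs z - {y}. S w) = (\<Sum>w\<in>nbrs z - {y}. q ^ N * walk_avg q \<Phi> Fwd 1 N)"
      by (intro sum.cong) auto
    then show ?thesis
      unfolding sum bwd0 by (simp add: card_y flip: q_def) (simp add: q_def)
  next
    case bwd
    have "y = u"
      using other[of y] y bwd by auto
    then have "S w = q ^ N * walk_avg q \<Phi> Bwd k' N" if "w \<in> nbrs z - {y}" for w
      using S_down[of w] that other[of w] bwd(2) by auto
    then have "(\<Sum>w\<in>nbrs z - {y}. S w) = (\<Sum>w\<in>nbrs z - {y}. q ^ N * walk_avg q \<Phi> Bwd k' N)"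
      by (intro sum.cong) auto
    then show ?thesis
      unfolding sum bwd(1,2) by (simp add: card_y flip: q_def) (simp add: q_def)
  qed
qed

lemma edge_state_exists:
  assumes "\<epsilon> = Fwd \<Longrightarrow> k \<ge> 1"
  shows "\<exists>e :: 'a::{field,finite} vertex \<times> 'a vertex. edge_state \<epsilon> k e"
proof (cases \<epsilon>)
  case Fwd
  then have "edge_state Fwd k (ray_vertex (k - 1), ray_vertex k :: 'a vertex)"
    using height_nbrs_ray(1)[of "k - 1"] assms by (simp add: nbrs_def height_ray)
  then show ?thesis using Fwd by blast
next
  case Bwd
  have "edge_state Bwd k (ray_vertex (k + 1), ray_vertex k :: 'a vertex)"
    using tree_adj_sym[of "ray_vertex k" "ray_vertex (k + 1) :: 'a vertex"] height_nbrs_ray(1)[of k]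
    by (simp add: nbrs_def height_ray)
  then show ?thesis using Bwd by blast
qed

text \<open>
  The finite set \<open>J\<close> carries the shadow distribution. Sums over arbitrary finite supersets are
  allowed so that several shadows can be summed over one common set.
\<close>
lemma shadow_sums:
  assumes "\<epsilon> = Fwd \<Longrightarrow> k \<ge> 1"
  shows "\<exists>J. finite J \<and> (\<forall>j. j \<notin> J \<longrightarrow> shadow TYPE('a::{field,finite}) \<epsilon> k N j = 0) \<and>
    (\<forall>(\<Phi> :: nat \<Rightarrow> complex) J'. finite J' \<longrightarrow> J \<subseteq> J' \<longrightarrow> (\<Sum>j\<in>J'. \<Phi> j * shadow TYPE('a) \<epsilon> k N j) = walk_avg (real CARD('a)) \<Phi> \<epsilon> k N)"
proof -
  define e :: "'a vertex \<times> 'a vertex" where "e = (SOME e. edge_state \<epsilon> k e)"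
  have "edge_state \<epsilon> k e"
    unfolding e_def using edge_state_exists[OF assms] by (rule someI_ex)
  then obtain y z where e: "e = (y, z)" "edge_state \<epsilon> k (y, z)" by (cases e) auto
  have "tree_adj y z" using e(2) by (cases \<epsilon>) auto
  then have fin: "finite (Desc N (y, z))" by (rule finite_Desc)
  have sh: "shadow TYPE('a) \<epsilon> k N j = real (card {u \<in> Desc N (y, z). height u = j}) / real CARD('a) ^ N" for j
    unfolding shadow_def Let_def e_def[symmetric] e(1) ..
  define J where "J = height ` Desc N (y, z)"
  have "shadow TYPE('a) \<epsilon> k N j = 0" if "j \<notin> J" for j
  proof -
    have *: "{u \<in> Desc N (y, z). height u = j} = {}" using that by (auto simp: J_def)
    show ?thesis unfolding sh * by simp
  qed
  moreover have "(\<Sum>j\<in>J'. \<Phi> j * shadow TYPE('a) \<epsilon> k N j) = walk_avg (real CARD('a)) \<Phi> \<epsilon> k N"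
    if J': "finite J'" "J \<subseteq> J'" for \<Phi> :: "nat \<Rightarrow> complex" and J'
  proof -
    have "(\<Sum>j\<in>J'. \<Phi> j * real (card {u \<in> Desc N (y, z). height u = j}))
        = (\<Sum>j\<in>J'. \<Sum>u | u \<in> Desc N (y, z) \<and> height u = j. \<Phi> (height u))"
      by (intro sum.cong) auto
    also have "\<dots> = (\<Sum>u\<in>Desc N (y, z). \<Phi> (height u))"
      using fin J' by (intro sum.group) (auto simp: J_def)
    also have "\<dots> = real CARD('a) ^ N * walk_avg (real CARD('a)) \<Phi> \<epsilon> k N"
      by (rule sum_Desc_height[OF e(2)])
    finally show ?thesis
      unfolding sh by (simp add: sum_divide_distrib[symmetric])
  qed
  moreover have "finite J" using fin by (simp add: J_def)
  ultimately show ?thesis by blast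
qed

section \<open>Convergence of the height walk\<close>

lemma geometric_cauchy_limit:
  fixes A :: "nat \<Rightarrow> complex"
  assumes step: "\<And>m. norm (A (Suc m) - A m) \<le> c * r ^ m" and r: "0 \<le> r" "r < 1"
  shows "\<exists>L. A \<longlonglongrightarrow> L \<and> (\<forall>m. norm (A m - L) \<le> c * r ^ m / (1 - r))"
proof -
  have geo: "summable (\<lambda>m. c * r ^ m)"
    using r by (intro summable_mult summable_geometric) simp
  have "summable (\<lambda>m. A (Suc m) - A m)"
    using step geo by (intro summable_comparison_test'[OF geo]) auto
  then have "(\<lambda>n. \<Sum>m<n. A (Suc m) - A m) \<longlonglongrightarrow> (\<Sum>m. A (Suc m) - A m)"
    by (rule summable_LIMSEQ)
  then have "(\<lambda>n. A n - A 0) \<longlonglongrightarrow> (\<Sum>m. A (Suc m) - A m)"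
    by (simp add: sum_lessThan_telescope)
  then have lim: "A \<longlonglongrightarrow> A 0 + (\<Sum>m. A (Suc m) - A m)" (is "_ \<longlonglongrightarrow> ?L")
    using tendsto_add[OF tendsto_const[of "A 0"]] by fastforce
  have c: "c \<ge> 0" using order_trans[OF norm_ge_zero step[of 0]] by simp
  have tele: "norm (A m - A (m + j)) \<le> c * r ^ m * (1 - r ^ j) / (1 - r)" for m j
  proof (induction j)
    case 0
    then show ?case by simp
  next
    case (Suc j)
    have "norm (A m - A (m + Suc j)) \<le> norm (A m - A (m + j)) + norm (A (Suc (m + j)) - A (m + j))"
      using norm_triangle_ineq4[of "A m - A (m + j)" "A (Suc (m + j)) - A (m + j)"] by simp
    also have "\<dots> \<le> c * r ^ m * (1 - r ^ j) / (1 - r) + c * r ^ (m + j)"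
      using Suc step by (intro add_mono) auto
    also have "\<dots> = c * r ^ m * (1 - r ^ Suc j) / (1 - r)"
      using r by (simp add: field_simps power_add)
    finally show ?case .
  qed
  have "norm (A m - ?L) \<le> c * r ^ m / (1 - r)" for m
  proof (rule tendsto_upperbound)
    show "(\<lambda>j. norm (A m - A (j + m))) \<longlonglongrightarrow> norm (A m - ?L)"
      by (intro tendsto_intros LIMSEQ_ignore_initial_segment lim)
    have "c * r ^ m * (1 - r ^ j) / (1 - r) \<le> c * r ^ m / (1 - r)" for j
      using r c by (intro divide_right_mono mult_left_le) auto
    then show "\<forall>\<^sub>F j in sequentially. norm (A m - A (j + m)) \<le> c * r ^ m / (1 - r)"
      using order_trans[OF tele] by (intro always_eventually allI) (simp add: add.commute[of _ m])
  qed simp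
  with lim show ?thesis by blast
qed

lemma walk_avg_Bwd_descend: "k \<le> N \<Longrightarrow> walk_avg q \<Phi> Bwd k N = walk_avg q \<Phi> Bwd 0 (N - k)"
proof (induction k arbitrary: N)
  case (Suc k)
  then obtain N' where "N = Suc N'" by (cases N) auto
  then show ?case using Suc by simp
qed simp

lemma walk_avg_const: "q \<noteq> 0 \<Longrightarrow> walk_avg q (\<lambda>_. 1) \<epsilon> k N = 1"
proof (induction N arbitrary: \<epsilon> k)
  case (Suc N)
  then show ?case by (cases \<epsilon>; cases k) (auto simp: field_simps)
qed simp

lemma walk_avg_bound:
  assumes q: "q \<ge> 1" and \<Phi>: "\<And>n. even n \<Longrightarrow> cmod (\<Phi> n) \<le> B"
  shows "even (k + N) \<Longrightarrow> (\<epsilon> = Fwd \<Longrightarrow> 1 \<le> k) \<Longrightarrow> cmod (walk_avg q \<Phi> \<epsilon> k N) \<le> B"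
proof (induction N arbitrary: \<epsilon> k)
  case 0
  then show ?case using \<Phi> by simp
next
  case (Suc N)
  show ?case
  proof (cases \<epsilon>)
    case Fwd
    have 1: "cmod (walk_avg q \<Phi> Fwd (k + 1) N) \<le> B" "cmod (walk_avg q \<Phi> Bwd (k - 1) N) \<le> B"
      using Suc.prems Fwd by (intro Suc.IH; simp)+
    have "cmod (walk_avg q \<Phi> Fwd (k + 1) N + (q - 1) * walk_avg q \<Phi> Bwd (k - 1) N) \<le> B + (q - 1) * B"
    proof (rule order_trans[OF norm_triangle_ineq], rule add_mono[OF 1(1)])
      have "cmod (complex_of_real q - 1) = q - 1"
        using q by (metis abs_of_nonneg diff_ge_0_iff_ge norm_of_real of_real_1 of_real_diff)
      then show "cmod ((q - 1) * walk_avg q \<Phi> Bwd (k - 1) N) \<le> (q - 1) * B"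
        using 1(2) q by (simp add: norm_mult mult_left_mono)
    qed
    then show ?thesis
      using q Fwd by (simp add: norm_divide field_simps)
  next
    case Bwd
    then show ?thesis using Suc by (cases k) auto
  qed
qed

text \<open>
  Raising the starting height and the number of steps by one leaves the margin unchanged. Both walks
  see the same backward means when they turn, so only the branch that climbs for \<open>N\<close> steps contributes to the
  difference, with probability \<open>q^(-N)\<close>.
\<close>
lemma walk_avg_Fwd_shift:
  assumes "q \<noteq> 0" "1 \<le> k"
  shows "walk_avg q \<Phi> Fwd (k + 1) (N + 1) - walk_avg q \<Phi> Fwd k N
    = (\<Phi> (k + N + 2) - \<Phi> (k + N)) / q ^ (N + 1)"
  using assms(2)
proof (induction N arbitrary: k)
  case 0
  then show ?case using assms(1) by (simp add: field_simps)
next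
  case (Suc N)
  obtain k' where k: "k = Suc k'" using Suc.prems by (cases k) auto
  have "walk_avg q \<Phi> Fwd (k + 1) (Suc N + 1) - walk_avg q \<Phi> Fwd k (Suc N)
    = (walk_avg q \<Phi> Fwd (k + 1 + 1) (N + 1) - walk_avg q \<Phi> Fwd (k + 1) N) / q"
    by (simp add: k diff_divide_distrib add_divide_distrib)
  also have "\<dots> = ((\<Phi> (k + 1 + N + 2) - \<Phi> (k + 1 + N)) / q ^ (N + 1)) / q"
    by (subst Suc.IH) auto
  finally show ?case by simp
qed

text \<open>
  Splitting \<open>n + 2\<close> steps from \<open>(bwd, 0)\<close> at the first two steps, the walk is back at \<open>(bwd, 0)\<close>
  with probability \<open>1 - 1/q\<close>, where its mean is \<open>a(n)\<close>. On the other branch the shift identity applies.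
\<close>
lemma walk_avg_return_diff:
  assumes "q \<noteq> 0"
  shows "walk_avg q \<Phi> Bwd 0 (n + 2) - walk_avg q \<Phi> Bwd 0 n = (\<Phi> (n + 2) - \<Phi> n) / q ^ (n + 1)"
proof (cases n)
  case 0
  then show ?thesis using assms by (simp add: numeral_2_eq_2 field_simps)
next
  case (Suc m)
  have "walk_avg q \<Phi> Bwd 0 (n + 2) - walk_avg q \<Phi> Bwd 0 n
     = (walk_avg q \<Phi> Fwd (1 + 1) (m + 1) - walk_avg q \<Phi> Fwd 1 m) / q"
    using assms by (simp add: Suc field_simps)
  then show ?thesis
    using walk_avg_Fwd_shift[OF assms, of 1 \<Phi> m] by (simp add: Suc)
qed

text \<open>
  The number \<open>\<Lambda>\<close> is the common limit of the walk means along even heights, with the two rates of the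
  theorem. The forward case is parametrized by half the margin because parity makes it even.
\<close>
definition walk_limit :: "real \<Rightarrow> (nat \<Rightarrow> complex) \<Rightarrow> real \<Rightarrow> complex \<Rightarrow> bool" where
  "walk_limit q \<Phi> B \<Lambda> \<longleftrightarrow>
     (\<forall>k N. even (k + N) \<and> k \<le> N \<longrightarrow> cmod (walk_avg q \<Phi> Bwd k N - \<Lambda>) \<le> 2 * B / q ^ (N - k)) \<and>
     (\<forall>k s. 1 \<le> k \<longrightarrow> cmod (walk_avg q \<Phi> Fwd k (k + 2 * s) - \<Lambda>) \<le> 4 * B / q ^ s)"

text \<open>
  The backward rate is the geometric tail of the differences of \<open>a(n)\<close>. In the forward case the
  error at half-margin \<open>s\<close> is at most \<open>1/q\<close> times the error at half-margin \<open>s - 1\<close> plus a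
  backward error of order \<open>q^(-2s)\<close>; the bound \<open>2B (2 q^(-s) - q^(-2s))\<close> is shaped to absorb that term and
  to start from the trivial bound \<open>2B\<close> at \<open>s = 0\<close>.
\<close>
lemma walk_limit_exists:
  assumes q: "q \<ge> 2" and \<Phi>: "\<And>n. even n \<Longrightarrow> cmod (\<Phi> n) \<le> B"
  shows "\<exists>\<Lambda>. walk_limit q \<Phi> B \<Lambda>"
proof -
  have B: "B \<ge> 0" using order_trans[OF norm_ge_zero \<Phi>[of 0]] by simp
  define A where "A m = walk_avg q \<Phi> Bwd 0 (2 * m)" for m
  define r where "r = 1 / q ^ 2"
  have "2 * 2 \<le> q * q"
    using q by (intro mult_mono) auto
  then have r: "0 \<le> r" "r < 1" by (auto simp: r_def power2_eq_square field_simps)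
  have rpow: "r ^ m = 1 / q ^ (2 * m)" for m
    by (simp add: r_def power_mult power_one_over)
  have "cmod (A (Suc m) - A m) \<le> (2 * B / q) * r ^ m" for m
  proof -
    have "A (Suc m) - A m = (\<Phi> (2 * m + 2) - \<Phi> (2 * m)) / q ^ (2 * m + 1)"
      using walk_avg_return_diff[of q \<Phi> "2 * m"] q by (simp add: A_def)
    moreover have "cmod (\<Phi> (2 * m + 2) - \<Phi> (2 * m)) \<le> B + B"
      by (rule order_trans[OF norm_triangle_ineq4 add_mono]) (auto intro: \<Phi>)
    ultimately show ?thesis
      using q by (simp add: norm_divide norm_power norm_mult rpow divide_right_mono)
  qed
  then obtain \<Lambda> where lim: "A \<longlonglongrightarrow> \<Lambda>" and bound: "\<And>m. cmod (A m - \<Lambda>) \<le> (2 * B / q) * r ^ m / (1 - r)"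
    using geometric_cauchy_limit[of A "2 * B / q" r] r by blast
  have A_bound: "cmod (A m - \<Lambda>) \<le> 2 * B / q ^ (2 * m)" for m
  proof -
    \<comment> \<open>the geometric series contributes the factor \<open>(1/q) / (1 - q\<^sup>-\<^sup>2)\<close>, which is at most \<open>1\<close> for \<open>q \<ge> 2\<close>\<close>
    have "1 + q \<le> q * q"
      using q mult_right_mono[of 2 q q] by linarith
    then have "1 / q \<le> 1 - r"
      using q by (simp add: r_def field_simps power2_eq_square)
    then have "2 * B * r ^ m * (1 / q) \<le> 2 * B * r ^ m * (1 - r)"
      using B r by (intro mult_left_mono) auto
    moreover have "2 * B * r ^ m * (1 / q) = (2 * B / q) * r ^ m"
      by simp
    ultimately have "(2 * B / q) * r ^ m \<le> 2 * B * r ^ m * (1 - r)"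
      by linarith
    moreover have "0 < 1 - r" using r by simp
    ultimately have "(2 * B / q) * r ^ m / (1 - r) \<le> 2 * B * r ^ m"
      by (simp only: pos_divide_le_eq)
    with bound[of m] show ?thesis by (simp add: rpow)
  qed
  have bwd: "cmod (walk_avg q \<Phi> Bwd k N - \<Lambda>) \<le> 2 * B / q ^ (N - k)" if "even (k + N)" "k \<le> N" for k N
  proof -
    have "even (N - k)" using that by presburger
    then obtain m where "N - k = 2 * m" by (rule evenE)
    then show ?thesis
      using A_bound[of m] walk_avg_Bwd_descend[OF that(2), of q \<Phi>] by (simp add: A_def)
  qed
  have \<Lambda>: "cmod \<Lambda> \<le> B"
  proof (rule tendsto_upperbound[OF tendsto_norm[OF lim]])
    show "\<forall>\<^sub>F m in sequentially. cmod (A m) \<le> B"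
      unfolding A_def using q by (intro always_eventually allI walk_avg_bound \<Phi>) auto
  qed simp
  have fwd: "cmod (walk_avg q \<Phi> Fwd k (k + 2 * s) - \<Lambda>) \<le> 2 * B * (2 / q ^ s - 1 / q ^ (2 * s))" if "1 \<le> k" for k s
    using that
  proof (induction s arbitrary: k)
    case 0
    have "cmod (walk_avg q \<Phi> Fwd k k) \<le> B"
      using q 0 by (intro walk_avg_bound \<Phi>) auto
    then show ?case
      using \<Lambda> norm_triangle_ineq4[of "walk_avg q \<Phi> Fwd k k" \<Lambda>] by simp
  next
    case (Suc s)
    define b where "b = walk_avg q \<Phi> Fwd (k + 1) (k + 1 + 2 * s)"
    define a where "a = walk_avg q \<Phi> Bwd (k - 1) (k + 1 + 2 * s)"
    have b: "cmod (b - \<Lambda>) \<le> 2 * B * (2 / q ^ s - 1 / q ^ (2 * s))"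
      unfolding b_def by (rule Suc.IH) simp
    have a: "cmod (a - \<Lambda>) \<le> 2 * B / q ^ (2 * s + 2)"
    proof -
      have "k + 1 + 2 * s - (k - 1) = 2 * s + 2" "k - 1 \<le> k + 1 + 2 * s" "even (k - 1 + (k + 1 + 2 * s))"
        using Suc.prems by auto
      then show ?thesis
        unfolding a_def using bwd[of "k - 1" "k + 1 + 2 * s"] by simp
    qed
    have q1: "cmod (complex_of_real q - 1) = q - 1"
      using q by (metis abs_of_nonneg diff_ge_0_iff_ge norm_of_real of_real_1 of_real_diff one_le_numeral order_trans)
    have "walk_avg q \<Phi> Fwd k (k + 2 * Suc s) - \<Lambda> = ((b - \<Lambda>) + (q - 1) * (a - \<Lambda>)) / q"
      using q by (simp add: a_def b_def field_simps)
    then have "cmod (walk_avg q \<Phi> Fwd k (k + 2 * Suc s) - \<Lambda>) 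
        \<le> (cmod (b - \<Lambda>) + (q - 1) * cmod (a - \<Lambda>)) / q"
      using q norm_triangle_ineq[of "b - \<Lambda>" "(q - 1) * (a - \<Lambda>)"] q1
      by (simp add: norm_divide norm_mult divide_right_mono)
    also have "\<dots> \<le> (2 * B * (2 / q ^ s - 1 / q ^ (2 * s)) + (q - 1) * (2 * B / q ^ (2 * s + 2))) / q"
      using q a b by (intro divide_right_mono add_mono mult_left_mono) auto
    also have "\<dots> = 2 * B * ((2 / q ^ s - 1 / q ^ (2 * s)) + (q - 1) / q ^ (2 * s + 2)) / q"
      by (simp add: algebra_simps)
    also have "\<dots> \<le> 2 * B * (2 / q ^ Suc s - 1 / q ^ (2 * Suc s))"
    proof -
      have "((2 / q ^ s - 1 / q ^ (2 * s)) + (q - 1) / q ^ (2 * s + 2)) / q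
          = 2 / q ^ Suc s - (q ^ 2 - (q - 1)) / q ^ (2 * s + 3)"
        using q by (simp add: field_simps power_add power2_eq_square power3_eq_cube)
      also have "\<dots> \<le> 2 / q ^ Suc s - q / q ^ (2 * s + 3)"
      proof (intro diff_left_mono divide_right_mono)
        have "2 * q \<le> q * q" using q by (intro mult_right_mono) auto
        then show "q \<le> q ^ 2 - (q - 1)" by (simp add: power2_eq_square)
      qed (use q in simp)
      also have "q / q ^ (2 * s + 3) = 1 / q ^ (2 * Suc s)"
        using q by (simp add: power_add power3_eq_cube power2_eq_square)
      finally show ?thesis
        unfolding times_divide_eq_right[symmetric] using B by (intro mult_left_mono) auto
    qed
    finally show ?case .
  qed
  have "2 * B * (2 / q ^ s - 1 / q ^ (2 * s)) \<le> 4 * B / q ^ s" for s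
  proof -
    have "2 * B * (2 / q ^ s - 1 / q ^ (2 * s)) = 4 * B / q ^ s - 2 * B / q ^ (2 * s)"
      by (simp add: algebra_simps)
    then show ?thesis using q B by simp
  qed
  with fwd have "\<And>k s. 1 \<le> k \<Longrightarrow> cmod (walk_avg q \<Phi> Fwd k (k + 2 * s) - \<Lambda>) \<le> 4 * B / q ^ s"
    using order_trans by blast
  with bwd have "walk_limit q \<Phi> B \<Lambda>" by (simp add: walk_limit_def)
  then show ?thesis ..
qed

section \<open>Points of the quotient space\<close>

text \<open>
  The adjugate, which is the inverse when the determinant is \<open>1\<close>.
\<close>
definition adj2 :: "'b::ab_group_add ^ 2 ^ 2 \<Rightarrow> 'b ^ 2 ^ 2" where
  "adj2 g = mat22 (g $ 2 $ 2) (- (g $ 1 $ 2)) (- (g $ 2 $ 1)) (g $ 1 $ 1)"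

lemma adj2_inverse:
  assumes "det (g :: 'a::{field,finite} mat2) = 1"
  shows "g ** adj2 g = mat 1" "adj2 g ** g = mat 1" "det (adj2 g) = 1"
  using assms by (simp_all add: adj2_def mat2_eq_iff matrix_matrix_2 mat_def det_2 algebra_simps)

lemma SL2_poly_adj2: "\<gamma> \<in> SL2 poly_ring \<Longrightarrow> adj2 \<gamma> \<in> SL2 poly_ring"
  by (simp add: SL2_def adj2_inverse) (simp add: has_entries_2 adj2_def poly_ring_minus)

lemma SL2_integer_adj2: "k \<in> SL2 integer_ring \<Longrightarrow> adj2 k \<in> SL2 integer_ring"
  by (simp add: SL2_def adj2_inverse) (simp add: has_entries_2 adj2_def integer_ring_iff)

lemma SL2_poly_subset_GL2: "\<gamma> \<in> SL2 poly_ring \<Longrightarrow> \<gamma> \<in> GL2 poly_ring"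
  using SL2_poly_adj2[of \<gamma>] adj2_inverse[of \<gamma>] by (auto simp: SL2_def GL2_def)

lemma SL2_poly_mult: "\<gamma> \<in> SL2 poly_ring \<Longrightarrow> \<delta> \<in> SL2 poly_ring \<Longrightarrow> \<gamma> ** \<delta> \<in> SL2 poly_ring"
  by (simp add: SL2_def has_entries_poly_mult det_mul)

lemma SL2_poly_1: "mat 1 \<in> SL2 poly_ring"
  by (simp add: SL2_def has_entries_poly_1)

lemma SL2_UNIV_mult: "g \<in> SL2 UNIV \<Longrightarrow> h \<in> SL2 UNIV \<Longrightarrow> g ** h \<in> SL2 UNIV"
  by (simp add: SL2_UNIV_iff det_mul)

lemma SL2_subset_UNIV: "g \<in> SL2 R \<Longrightarrow> g \<in> SL2 UNIV"
  by (simp add: SL2_def has_entries_def)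

lemma coset_mult_left:
  fixes g :: "'a::{field,finite} mat2"
  assumes "\<gamma> \<in> SL2 poly_ring"
  shows "coset (\<gamma> ** g) = coset g"
proof -
  have sub: "coset (\<gamma> ** g) \<subseteq> coset g" if "\<gamma> \<in> SL2 poly_ring" for \<gamma> g :: "'a mat2"
    unfolding coset_def using SL2_poly_mult[OF _ that] by (auto simp: matrix_mul_assoc)
  have "g = adj2 \<gamma> ** (\<gamma> ** g)"
    using adj2_inverse(2)[of \<gamma>] assms by (simp add: matrix_mul_assoc SL2_def)
  then have "coset g \<subseteq> coset (\<gamma> ** g)"
    using sub[OF SL2_poly_adj2[OF assms], of "\<gamma> ** g"] by simp
  with sub[OF assms] show ?thesis by blast
qed

lemma right_translate_coset: "right_translate s (coset g) = coset (g ** s)"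
  by (simp add: right_translate_def coset_def image_image matrix_mul_assoc)

lemma right_translate_in_quot_space:
  "s \<in> SL2 UNIV \<Longrightarrow> x \<in> quot_space \<Longrightarrow> right_translate s x \<in> quot_space"
  by (auto simp: quot_space_def right_translate_coset SL2_UNIV_mult)

lemma h_K_coset:
  assumes "g \<in> SL2 UNIV"
  shows "h_K (coset g) = height (act g (ray_vertex 0))"
proof -
  have "act g (ray_vertex 0) \<in> tree_vertices"
    using assms by (intro act_in_tree) (auto simp: SL2_UNIV_iff)
  then have "height (act (\<gamma> ** g) (ray_vertex 0)) = height (act g (ray_vertex 0))" if "\<gamma> \<in> SL2 poly_ring" for \<gamma>
    using height_act[OF SL2_poly_subset_GL2[OF that]] by (simp flip: act_mult)
  then have "(\<lambda>h. height (act h (ray_vertex 0))) ` coset g = {height (act g (ray_vertex 0))}"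
    unfolding coset_def using SL2_poly_1 by (auto simp: image_image)
  then show ?thesis by (simp add: h_K_def)
qed

lemma act_SL2_integer:
  assumes "k \<in> SL2 integer_ring"
  shows "act k (ray_vertex 0) = ray_vertex 0"
proof -
  have sub: "(*v) k ` std_lattice \<subseteq> std_lattice" if "k \<in> SL2 integer_ring" for k :: "'a mat2"
  proof -
    have "val_ge 0 (k $ i $ j)" for i j
      using that by (simp add: SL2_def has_entries_def integer_ring_iff)
    then show ?thesis
      by (auto simp: std_lattice_iff matrix_vector_2 intro!: val_ge_add val_ge_mult_le[of 0 _ 0])
  qed
  have "x \<in> (*v) k ` std_lattice" if "x \<in> std_lattice" for x
  proof -
    have "x = k *v (adj2 k *v x)"
      using adj2_inverse(1)[of k] assms by (simp add: matrix_vector_mul_assoc SL2_def)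
    then show ?thesis
      using sub[OF SL2_integer_adj2[OF assms]] that by blast
  qed
  then have "(*v) k ` std_lattice = std_lattice"
    using sub[OF assms] by blast
  then show ?thesis
    by (simp add: ray_vertex_0 act_homothety_class)
qed

lemma SL2_origin_stabilizer:
  fixes g :: "'a::{field,finite} mat2"
  assumes "g \<in> SL2 UNIV" "act g (ray_vertex 0) = ray_vertex 0"
  shows "g \<in> SL2 integer_ring"
proof -
  have det: "det g = 1" using assms by (simp add: SL2_UNIV_iff)
  have "det g \<noteq> 0" "det (mat 1 :: 'a mat2) \<noteq> 0" "act g (ray_vertex 0) = act (mat 1) (ray_vertex 0)"
    using det assms(2) by simp_all
  from act_origin_eq_imp[OF this] obtain e K where "g = mat 1 ** K" "\<And>i j. val_ge e (K $ i $ j)" 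
    "fls_subdegree (det g) = fls_subdegree (det (mat 1 :: 'a mat2)) + 2 * e" by blast
  then show ?thesis
    using det by (auto simp: SL2_def has_entries_def integer_ring_iff)
qed

lemma SL2_orbit_ray:
  assumes g: "g \<in> SL2 UNIV" and n: "height (act g (ray_vertex 0)) = n"
  obtains \<gamma> where "\<gamma> \<in> GL2 poly_ring" "act g (ray_vertex 0) = act (\<gamma> ** ray_matrix n) (ray_vertex 0)"
proof -
  have "act g (ray_vertex 0) \<in> tree_vertices"
    using g by (intro act_in_tree) (auto simp: SL2_UNIV_iff)
  from height_spec[OF this] obtain \<gamma> where "\<gamma> \<in> GL2 poly_ring" "act g (ray_vertex 0) = act \<gamma> (ray_vertex n)"
    by (auto simp: poly_equiv_def n)
  then show ?thesis using that by (metis act_mult ray_vertex_eq_act)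
qed

text \<open>
  The determinant of \<open>diag(t\<^sup>n, 1)\<close> has valuation \<open>-n\<close>, and a matrix of determinant \<open>1\<close> can only
  differ from it by an even valuation.
\<close>
lemma even_height_SL2:
  assumes g: "g \<in> SL2 UNIV"
  shows "even (height (act g (ray_vertex 0)))"
proof -
  obtain \<gamma> where \<gamma>: "\<gamma> \<in> GL2 poly_ring" 
    "act g (ray_vertex 0) = act (\<gamma> ** ray_matrix (height (act g (ray_vertex 0)))) (ray_vertex 0)"
    using SL2_orbit_ray[OF g refl] by blast
  have det: "det (\<gamma> ** ray_matrix n) \<noteq> 0" 
    "fls_subdegree (det (\<gamma> ** ray_matrix n)) = - int n" for n
    using GL2_poly_det[OF \<gamma>(1)] by (simp_all add: det_mul)
  have "det g = 1" using g by (simp add: SL2_UNIV_iff)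
  then obtain e where "fls_subdegree (det g) = 
      fls_subdegree (det (\<gamma> ** ray_matrix (height (act g (ray_vertex 0))))) + 2 * e"
    using act_origin_eq_imp[OF _ det(1) \<gamma>(2)] by (metis zero_neq_one)
  then have "int (height (act g (ray_vertex 0))) = 2 * e"
    using det(2) \<open>det g = 1\<close> by simp
  then show ?thesis by (metis dvd_triv_left even_of_nat)
qed

lemma ray_stabilizer: 
  fixes d :: "'a::{field,finite} fls"
  assumes "fls_subdegree d = 0" "d \<noteq> 0"
  shows "act (mat22 d 0 0 1) (ray_vertex n) = ray_vertex n"
proof -
  have "act (mat22 d 0 0 1) (ball_vertex (- int n) 0) = ball_vertex (- int n) 0"
  proof -
    have "(*v) (mat22 d 0 0 1) ` ball_lattice (- int n) 0 = ball_lattice (- int n) 0"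
    proof (intro set_eqI iffI)
      fix x :: "'a fls ^ 2" assume "x \<in> ball_lattice (- int n) 0"
      then have "vector [x $ 1 / d, x $ 2] \<in> ball_lattice (- int n) 0"
        using assms by (simp add: ball_lattice_iff val_ge_divide_iff)
      moreover have "x = mat22 d 0 0 1 *v vector [x $ 1 / d, x $ 2]"
        using assms by (simp add: vec2_eq_iff matrix_vector_2)
      ultimately show "x \<in> (*v) (mat22 d 0 0 1) ` ball_lattice (- int n) 0" by blast
    qed (use assms in \<open>auto simp: ball_lattice_iff matrix_vector_2 val_ge_mult_iff\<close>)
    then show ?thesis by (simp add: ball_vertex_def act_homothety_class)
  qed
  then show ?thesis by (simp add: ray_vertex_eq_ball)
qed

text \<open>
  Equal heights give a matrix of \<open>GL\<^sub>2(F\<^sub>q[t])\<close> between the two vertices. Its determinant is a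
  nonzero constant \<open>d\<close>, which is corrected by \<open>diag(d, 1)\<close> because this matrix fixes the ray; so the
  two vertices are related by \<open>SL\<^sub>2(F\<^sub>q[t])\<close>.
\<close>
lemma h_K_eq_imp_same_K_orbit:
  assumes x: "x \<in> quot_space" and y: "y \<in> quot_space" and eq: "h_K x = h_K y"
  obtains k where "k \<in> SL2 integer_ring" "y = right_translate k x"
proof -
  obtain g h where g: "g \<in> SL2 UNIV" "x = coset g" and h: "h \<in> SL2 UNIV" "y = coset h"
    using x y by (auto simp: quot_space_def)
  define n where "n = h_K x"
  obtain \<gamma> where \<gamma>: "\<gamma> \<in> GL2 poly_ring" "act g (ray_vertex 0) = act (\<gamma> ** ray_matrix n) (ray_vertex 0)"
    using SL2_orbit_ray[OF g(1)] h_K_coset[OF g(1)] g(2) n_def by metis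
  obtain \<delta> where \<delta>: "\<delta> \<in> GL2 poly_ring" "act h (ray_vertex 0) = act (\<delta> ** ray_matrix n) (ray_vertex 0)"
    using SL2_orbit_ray[OF h(1)] h_K_coset[OF h(1)] h(2) eq n_def by metis
  obtain \<gamma>' where \<gamma>': "\<gamma>' \<in> GL2 poly_ring" "\<gamma> ** \<gamma>' = mat 1" "\<gamma>' ** \<gamma> = mat 1"
    using GL2_poly_inverse[OF \<gamma>(1)] .
  define d where "d = det \<gamma> / det \<delta>"
  note det = GL2_poly_det[OF \<gamma>(1)] GL2_poly_det[OF \<delta>(1)]
  have d: "d \<noteq> 0" "fls_subdegree d = 0"
    using det by (simp_all add: d_def subdegree_divide')
  have "d \<in> poly_ring"
    using poly_ring_mult[OF det(3,8)] by (simp add: d_def)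
  \<comment> \<open>the element of \<open>SL\<^sub>2(F\<^sub>q[t])\<close> that takes \<open>g v\<^sub>0\<close> to \<open>h v\<^sub>0\<close>\<close>
  define \<eta> where "\<eta> = \<delta> ** (mat22 d 0 0 1 ** \<gamma>')"
  have \<eta>: "\<eta> \<in> SL2 poly_ring"
  proof -
    have "has_entries poly_ring \<eta>"
      unfolding \<eta>_def using \<delta>(1) \<gamma>'(1) \<open>d \<in> poly_ring\<close>
      by (intro has_entries_poly_mult) (auto simp: GL2_def has_entries_2)
    moreover have "det \<gamma> * det \<gamma>' = 1"
      using \<gamma>'(2) by (metis det_I det_mul)
    then have "det \<eta> = 1"
      using det by (simp add: \<eta>_def det_mul d_def field_simps)
    ultimately show ?thesis by (simp add: SL2_def)
  qed
  have ray: "act g (ray_vertex 0) = act \<gamma> (ray_vertex n)" "act h (ray_vertex 0) = act \<delta> (ray_vertex n)"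
    by (simp_all only: \<gamma>(2) \<delta>(2) act_mult[symmetric] ray_vertex_eq_act[of n, symmetric])
  have "act (\<eta> ** g) (ray_vertex 0) = act \<delta> (act (mat22 d 0 0 1) (act \<gamma>' (act g (ray_vertex 0))))"
    by (simp only: \<eta>_def act_mult matrix_mul_assoc)
  also have "act \<gamma>' (act g (ray_vertex 0)) = ray_vertex n"
    by (simp only: ray act_mult \<gamma>' act_1)
  finally have eq: "act (\<eta> ** g) (ray_vertex 0) = act h (ray_vertex 0)"
    by (simp only: ray ray_stabilizer[OF d(2,1)])
  define k where "k = adj2 (\<eta> ** g) ** h"
  have \<eta>g: "\<eta> ** g \<in> SL2 UNIV"
    using SL2_UNIV_mult[OF SL2_subset_UNIV[OF \<eta>] g(1)] .
  then have inv: "(\<eta> ** g) ** adj2 (\<eta> ** g) = mat 1" "adj2 (\<eta> ** g) ** (\<eta> ** g) = mat 1" "det (adj2 (\<eta> ** g)) = 1"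
    using adj2_inverse[of "\<eta> ** g"] by (auto simp: SL2_UNIV_iff)
  have "k \<in> SL2 UNIV"
    using h(1) inv(3) by (simp add: k_def SL2_UNIV_iff det_mul)
  moreover have "act k (ray_vertex 0) = ray_vertex 0"
    unfolding k_def act_mult[symmetric, of _ h] eq[symmetric] by (simp add: act_mult inv(2))
  ultimately have "k \<in> SL2 integer_ring" by (rule SL2_origin_stabilizer)
  moreover have "y = right_translate k x"
  proof -
    have "coset ((\<eta> ** g) ** k) = coset h"
      by (simp add: k_def matrix_mul_assoc inv(1))
    then show ?thesis
      unfolding g(2) h(2) right_translate_coset using coset_mult_left[OF \<eta>] by (metis matrix_mul_assoc)
  qed
  ultimately show ?thesis using that by blast
qed

section \<open>Topology and measurability\<close>

definition entries_close :: "int \<Rightarrow> 'a::{field,finite} mat2 \<Rightarrow> 'a mat2 \<Rightarrow> bool" where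
  "entries_close n h g \<longleftrightarrow> (\<forall>i j. val_ge n (h $ i $ j - g $ i $ j))"

lemma dist_fls_less_imp:
  assumes "dist f g < inverse (2 ^ n)"
  shows "val_ge (int n) (f - g :: 'a::{field,finite} fls)"
proof (cases "f = g")
  case False
  define d where "d = fls_subdegree (f - g)"
  have "d \<ge> 0"
  proof (rule ccontr)
    assume "\<not> d \<ge> 0"
    then have "dist f g = 2 ^ nat (- d)"
      using False by (simp add: dist_fls_def d_def)
    moreover have "(1::real) \<le> 2 ^ nat (- d)" "inverse (2 ^ n) \<le> (1::real)"
      by (simp_all add: inverse_le_1_iff)
    ultimately show False using assms by linarith
  qed
  then have "dist f g = inverse (2 ^ nat d)"
    using False by (simp add: dist_fls_def d_def)
  with assms have "(2::real) ^ n < 2 ^ nat d" by simp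
  then have "n < nat d" by (rule power_less_imp_less_exp[rotated]) simp
  then have "int n \<le> d" by simp
  then show ?thesis by (simp add: val_ge_def flip: d_def)
qed simp

lemma dist_fls_le:
  assumes "val_ge (int n) (f - g :: 'a::{field,finite} fls)"
  shows "dist f g \<le> inverse (2 ^ n)"
proof (cases "f = g")
  case False
  then have "int n \<le> fls_subdegree (f - g)"
    using assms by (simp add: val_ge_def)
  then have "dist f g = inverse (2 ^ nat (fls_subdegree (f - g)))" "n \<le> nat (fls_subdegree (f - g))"
    using False by (simp_all add: dist_fls_def)
  then show ?thesis by (simp add: power_increasing)
qed simp

text \<open>
  The topology of the matrix space in terms of valuations: neighbourhoods are given by congruence
  of all entries modulo a power of \<open>\<pi>\<close>.
\<close>
lemma openin_SL2_iff:
  "openin (top_of_set S) (U :: 'a::{field,finite} mat2 set) \<longleftrightarrow>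
    U \<subseteq> S \<and> (\<forall>g\<in>U. \<exists>n. \<forall>h\<in>S. entries_close n h g \<longrightarrow> h \<in> U)"
proof -
  have "(\<exists>e>0. \<forall>h\<in>S. dist h g < e \<longrightarrow> h \<in> U) \<longleftrightarrow> (\<exists>n. \<forall>h\<in>S. entries_close n h g \<longrightarrow> h \<in> U)" for g
  proof
    assume "\<exists>e>0. \<forall>h\<in>S. dist h g < e \<longrightarrow> h \<in> U"
    then obtain e where e: "e > 0" "\<And>h. h \<in> S \<Longrightarrow> dist h g < e \<Longrightarrow> h \<in> U" by blast
    obtain n where n: "inverse (2 ^ n) < e / 4"
      using real_arch_pow_inv[of "e / 4" "1 / 2"] e(1) by (auto simp: power_one_over inverse_eq_divide)
    have "dist h g < e" if "entries_close (int n) h g" for h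
    proof -
      have entry: "dist (h $ i $ j) (g $ i $ j) \<le> inverse (2 ^ n)" for i j
        using that by (intro dist_fls_le) (auto simp: entries_close_def)
      have vec: "dist x y \<le> dist (x $ 1) (y $ 1) + dist (x $ 2) (y $ 2)" for x y :: "('b::metric_space) ^ 2"
        unfolding dist_vec_def by (rule order_trans[OF L2_set_le_sum]) (auto simp: sum_2)
      have "dist h g \<le> dist (h $ 1) (g $ 1) + dist (h $ 2) (g $ 2)"
        by (rule vec)
      also have "\<dots> \<le> (inverse (2 ^ n) + inverse (2 ^ n)) + (inverse (2 ^ n) + inverse (2 ^ n))"
        by (intro add_mono order_trans[OF vec add_mono] entry)
      finally show ?thesis using n by simp
    qed
    then show "\<exists>n. \<forall>h\<in>S. entries_close n h g \<longrightarrow> h \<in> U" using e(2) by blast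
  next
    assume "\<exists>n. \<forall>h\<in>S. entries_close n h g \<longrightarrow> h \<in> U"
    then obtain n where n: "\<And>h. h \<in> S \<Longrightarrow> entries_close n h g \<Longrightarrow> h \<in> U" by blast
    have "entries_close n h g" if "dist h g < inverse (2 ^ nat n)" for h
      unfolding entries_close_def
    proof (intro allI)
      fix i j
      have "dist (h $ i $ j) (g $ i $ j) < inverse (2 ^ nat n)"
        using that dist_vec_nth_le[of "h $ i" j "g $ i"] dist_vec_nth_le[of h i g] by simp
      from dist_fls_less_imp[OF this] show "val_ge n (h $ i $ j - g $ i $ j)"
        by (rule val_ge_mono) simp
    qed
    then show "\<exists>e>0. \<forall>h\<in>S. dist h g < e \<longrightarrow> h \<in> U"
      using n by (intro exI[of _ "inverse (2 ^ nat n)"]) auto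
  qed
  then show ?thesis
    unfolding openin_euclidean_subtopology_iff by simp
qed

lemma entries_bounded_below: "\<exists>e. \<forall>i j. val_ge e (A $ i $ j)" for A :: "'a::{field,finite} mat2"
proof -
  define e where "e = Min (range (\<lambda>(i, j). fls_subdegree (A $ i $ j)))"
  have "e \<le> fls_subdegree (A $ i $ j)" for i j
    unfolding e_def by (intro Min_le) (auto intro: image_eqI[of _ _ "(i, j)"])
  then show ?thesis by (auto simp: val_ge_def)
qed

lemma entries_close_mult_right:
  obtains m where "\<And>h g. entries_close m h g \<Longrightarrow> entries_close n (h ** s) (g ** s)"
proof -
  obtain e where e: "\<And>i j. val_ge e (s $ i $ j)" using entries_bounded_below[of s] by blast
  have "entries_close n (h ** s) (g ** s)" if "entries_close (n - e) h g" for h g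
  proof -
    have *: "val_ge n ((h $ i $ k - g $ i $ k) * s $ k $ j)" for i j k
      using that e by (intro val_ge_mult_le[of "n - e" _ e]) (auto simp: entries_close_def)
    have "(h ** s) $ i $ j - (g ** s) $ i $ j = (h $ i $ 1 - g $ i $ 1) * s $ 1 $ j + (h $ i $ 2 - g $ i $ 2) * s $ 2 $ j" for i j
      by (simp add: matrix_matrix_2 algebra_simps)
    then show ?thesis
      unfolding entries_close_def by (simp only:) (intro allI val_ge_add *)
  qed
  then show ?thesis using that by blast
qed

lemma entries_close_mult_left:
  obtains m where "\<And>h g. entries_close m h g \<Longrightarrow> entries_close n (s ** h) (s ** g)"
proof -
  obtain e where e: "\<And>i j. val_ge e (s $ i $ j)" using entries_bounded_below[of s] by blast
  have "entries_close n (s ** h) (s ** g)" if "entries_close (n - e) h g" for h g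
  proof -
    have *: "val_ge n (s $ i $ k * (h $ k $ j - g $ k $ j))" for i j k
      using that e by (intro val_ge_mult_le[of e _ "n - e"]) (auto simp: entries_close_def)
    have "(s ** h) $ i $ j - (s ** g) $ i $ j = s $ i $ 1 * (h $ 1 $ j - g $ 1 $ j) + s $ i $ 2 * (h $ 2 $ j - g $ 2 $ j)" for i j
      by (simp add: matrix_matrix_2 algebra_simps)
    then show ?thesis
      unfolding entries_close_def by (simp only:) (intro allI val_ge_add *)
  qed
  then show ?thesis using that by blast
qed

lemma quot_open_iff:
  "quot_open V \<longleftrightarrow> V \<subseteq> quot_space \<and>
     (\<forall>g\<in>SL2 UNIV. coset g \<in> V \<longrightarrow> (\<exists>n. \<forall>h\<in>SL2 UNIV. entries_close n h g \<longrightarrow> coset h \<in> V))"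
  unfolding quot_open_def openin_SL2_iff by blast

lemma quot_open_subset: "{U. quot_open U} \<subseteq> Pow quot_space"
  by (auto simp: quot_open_def)

lemma space_quot_borel [simp]: "space quot_borel = quot_space"
  by (simp add: quot_borel_def space_measure_of quot_open_subset)

lemma quot_open_measurable: "quot_open U \<Longrightarrow> U \<in> sets quot_borel"
  by (simp add: quot_borel_def quot_open_subset)

lemma right_translate_measurable:
  assumes s: "s \<in> SL2 UNIV"
  shows "right_translate s \<in> measurable quot_borel quot_borel"
  unfolding quot_borel_def[of, symmetric]
proof (subst (2) quot_borel_def, rule measurable_measure_of)
  show "right_translate s \<in> space quot_borel \<rightarrow> quot_space"
    using right_translate_in_quot_space[OF s] by auto
  fix V :: "'a quot set" assume "V \<in> {U. quot_open U}"
  then have V: "quot_open V" by simp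
  have "quot_open (right_translate s -` V \<inter> space quot_borel)"
    unfolding quot_open_iff
  proof (intro conjI ballI impI)
    fix g assume g: "g \<in> SL2 UNIV" "coset g \<in> right_translate s -` V \<inter> space quot_borel"
    then have "coset (g ** s) \<in> V" by (simp add: right_translate_coset)
    then obtain n where n: "\<And>h. h \<in> SL2 UNIV \<Longrightarrow> entries_close n h (g ** s) \<Longrightarrow> coset h \<in> V"
      using V SL2_UNIV_mult[OF g(1) s] unfolding quot_open_iff by blast
    obtain m where m: "\<And>h g. entries_close m h g \<Longrightarrow> entries_close n (h ** s) (g ** s)"
      using entries_close_mult_right[where s = s] by blast
    show "\<exists>n. \<forall>h\<in>SL2 UNIV. entries_close n h g \<longrightarrow> coset h \<in> right_translate s -` V \<inter> space quot_borel"
      using n m SL2_UNIV_mult[OF _ s] by (intro exI[of _ m]) (auto simp: right_translate_coset quot_space_def)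
  qed auto
  then show "right_translate s -` V \<inter> space quot_borel \<in> sets quot_borel"
    by (rule quot_open_measurable)
qed (rule quot_open_subset)

lemma h_K_even: "x \<in> quot_space \<Longrightarrow> even (h_K x)"
  by (auto simp: quot_space_def h_K_coset even_height_SL2)

text \<open>
  The level sets of the height are open: if \<open>h\<close> is close to \<open>g\<close>, then \<open>g\<^sup>-\<^sup>1 h\<close> is congruent to the
  identity, hence lies in \<open>K\<close>, and \<open>h v\<^sub>0 = g v\<^sub>0\<close>.
\<close>
lemma h_K_measurable: "h_K \<in> measurable quot_borel (count_space {n. even n})"
proof (rule measurable_count_space_eq2_countable[THEN iffD2], intro conjI ballI)
  show "h_K \<in> space quot_borel \<rightarrow> {n. even n}"
    using h_K_even by auto
  fix m :: nat
  have "quot_open (h_K -` {m} \<inter> space quot_borel :: 'a quot set)"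
    unfolding quot_open_iff
  proof (intro conjI ballI impI)
    fix g :: "'a mat2" assume g: "g \<in> SL2 UNIV" "coset g \<in> h_K -` {m} \<inter> space quot_borel"
    have detg: "det g = 1" using g(1) by (simp add: SL2_UNIV_iff)
    obtain n where n: "\<And>h g'. entries_close n h g' \<Longrightarrow> entries_close 0 (adj2 g ** h) (adj2 g ** g')"
      using entries_close_mult_left[where s = "adj2 g"] by blast
    have "coset h \<in> h_K -` {m} \<inter> space quot_borel" if h: "h \<in> SL2 UNIV" "entries_close n h g" for h
    proof -
      define k where "k = adj2 g ** h"
      have "entries_close 0 k (mat 1)"
        using n[OF h(2)] adj2_inverse(2)[OF detg] by (simp add: k_def)
      have "val_ge 0 (k $ i $ j)" for i j
      proof -
        have "val_ge 0 ((mat 1 :: 'a mat2) $ i $ j)" by (simp add: mat_def)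
        moreover have "val_ge 0 (k $ i $ j - (mat 1 :: 'a mat2) $ i $ j)"
          using \<open>entries_close 0 k (mat 1)\<close> by (simp add: entries_close_def)
        ultimately show ?thesis using val_ge_add by fastforce
      qed
      moreover have "det k = 1"
        using h(1) adj2_inverse(3)[OF detg] by (simp add: k_def det_mul SL2_UNIV_iff)
      ultimately have "k \<in> SL2 integer_ring"
        by (simp add: SL2_def has_entries_def integer_ring_iff)
      moreover have "h = g ** k"
        by (simp add: k_def matrix_mul_assoc adj2_inverse[OF detg])
      ultimately have "act h (ray_vertex 0) = act g (ray_vertex 0)"
        by (simp add: act_SL2_integer flip: act_mult)
      then show ?thesis
        using g h(1) by (simp add: h_K_coset quot_space_def)
    qed
    then show "\<exists>n. \<forall>h\<in>SL2 UNIV. entries_close n h g \<longrightarrow> coset h \<in> h_K -` {m} \<inter> space quot_borel"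
      by blast
  qed auto
  then show "h_K -` {m} \<inter> space quot_borel \<in> sets (quot_borel :: 'a quot measure)"
    by (rule quot_open_measurable)
qed

lemma h_K_surj:
  assumes "even n"
  obtains x :: "'a::{field,finite} quot" where "x \<in> quot_space" "h_K x = n"
proof -
  obtain m where n: "n = 2 * m" using assms by blast
  let ?g = "mat22 (unif (- int m)) 0 0 (unif (int m)) :: 'a mat2"
  have g: "?g \<in> SL2 UNIV" by (simp add: SL2_UNIV_iff)
  have "(*v) ?g ` std_lattice = (*s) (unif (int m)) ` ball_lattice (- int n) 0"
  proof -
    have "(*v) ?g x = unif (int m) *s (mat22 (unif (- int n)) 0 0 1 *v x)" for x
      by (simp add: vec2_eq_iff matrix_vector_2 n flip: mult.assoc unif_add)
    then show ?thesis
      unfolding ball_lattice_eq_matrix by (simp add: image_image)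
  qed
  then have "act ?g (ray_vertex 0) = ray_vertex n"
    by (simp add: ray_vertex_0 act_homothety_class homothety_class_smult) (simp add: ray_vertex_eq_ball ball_vertex_def)
  then have "h_K (coset ?g) = n"
    by (simp add: h_K_coset[OF g] height_ray)
  then show ?thesis using that g by (auto simp: quot_space_def)
qed

section \<open>Spheres in the tree\<close>

lemma Desc_act:
  assumes g: "det g \<noteq> 0"
  shows "tree_adj y z \<Longrightarrow> Desc N (act g y, act g z) = act g ` Desc N (y, z)"
proof (induction N arbitrary: y z)
  case 0
  then show ?case using tree_adj_act[OF g 0] by (simp add: Desc_0)
next
  case (Suc N)
  have "nbrs (act g z) - {act g y} = act g ` (nbrs z - {y})"
    using inj_act[OF g] by (auto simp: nbrs_act[OF g] inj_eq)
  moreover have "Desc N (act g z, act g w) = act g ` Desc N (z, w)" if "w \<in> nbrs z" for w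
    using Suc.IH that by (simp add: nbrs_def)
  ultimately show ?case
    using tree_adj_act[OF g Suc.prems] by (simp add: Desc_Suc Suc.prems image_UN)
qed

text \<open>
  The sphere of radius \<open>N + 1\<close>, presented as a union of shadows.
\<close>
definition tree_sphere :: "nat \<Rightarrow> 'a::{field,finite} vertex \<Rightarrow> 'a vertex set" where
  "tree_sphere N v = (\<Union>w\<in>nbrs v. Desc N (v, w))"

lemma tree_sphere_act:
  assumes "det g \<noteq> 0"
  shows "tree_sphere N (act g v) = act g ` tree_sphere N v"
proof -
  have "Desc N (act g v, act g w) = act g ` Desc N (v, w)" if "w \<in> nbrs v" for w
    using Desc_act[OF assms] that by (simp add: nbrs_def)
  then show ?thesis
    by (simp add: tree_sphere_def nbrs_act[OF assms] image_UN)
qed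

lemma sum_tree_sphere:
  assumes "v \<in> tree_vertices"
  shows "(\<Sum>u\<in>tree_sphere N v. \<psi> u) = (\<Sum>w\<in>nbrs v. \<Sum>u\<in>Desc N (v, w). \<psi> u)"
  unfolding tree_sphere_def
proof (rule sum.UNION_disjoint)
  show "finite (nbrs v)" using card_nbrs(1)[OF assms] .
  show "\<forall>w\<in>nbrs v. finite (Desc N (v, w))"
    by (auto simp: nbrs_def finite_Desc)
  show "\<forall>w\<in>nbrs v. \<forall>w'\<in>nbrs v. w \<noteq> w' \<longrightarrow> Desc N (v, w) \<inter> Desc N (v, w') = {}"
    using Desc_disjoint by blast
qed

lemma edge_state_of_nbr:
  assumes w: "w \<in> nbrs v"
  obtains \<epsilon> where "edge_state \<epsilon> (height w) (v, w)" "\<epsilon> = Fwd \<Longrightarrow> 1 \<le> height w"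
    "odd (height v + height w)"
proof -
  have adj: "tree_adj v w" using w by (simp add: nbrs_def)
  obtain u where u: "height u = height v + 1"
    "\<And>w. w \<in> nbrs v \<Longrightarrow> w \<noteq> u \<Longrightarrow> height w = (if height v = 0 then 1 else height v - 1)"
    using height_nbrs[OF nbrs_in_tree(2)[OF w]] by metis
  from u(1) u(2)[OF w] have "height w = height v + 1 \<or> height v = height w + 1"
    by (cases "w = u"; cases "height v = 0") (simp_all split: if_splits)
  then consider "height w = height v + 1" | "height v = height w + 1" by blast
  then show ?thesis
  proof cases
    case 1
    then show ?thesis using adj that[of Fwd] by simp
  next
    case 2
    then show ?thesis using adj that[of Bwd] by simp
  qed
qed

lemma card_Desc:
  fixes v :: "'a::{field,finite} vertex"
  assumes "w \<in> nbrs v"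
  shows "card (Desc N (v, w)) = CARD('a) ^ N"
proof -
  obtain \<epsilon> where "edge_state \<epsilon> (height w) (v, w)"
    using edge_state_of_nbr[OF assms] by metis
  from sum_Desc_height[OF this, of "\<lambda>_. 1" N]
  have "complex_of_nat (card (Desc N (v, w))) = of_nat (CARD('a) ^ N)"
    by (simp add: walk_avg_const)
  then show ?thesis by (simp only: of_nat_eq_iff)
qed

lemma card_tree_sphere:
  fixes v :: "'a::{field,finite} vertex"
  assumes "v \<in> tree_vertices"
  shows "card (tree_sphere N v) = (CARD('a) + 1) * CARD('a) ^ N"
proof -
  have "card (tree_sphere N v) = (\<Sum>w\<in>nbrs v. card (Desc N (v, w)))"
    using sum_tree_sphere[OF assms, of "\<lambda>_. 1 :: nat" N] by simp
  also have "\<dots> = (\<Sum>w\<in>nbrs v. CARD('a) ^ N)"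
    by (intro sum.cong card_Desc) auto
  finally show ?thesis using card_nbrs[OF assms] by simp
qed

lemma Desc_level_parity:
  assumes "tree_adj z w" "u \<in> Desc N (z, w)"
  shows "even (level u - level w - int N)"
  using assms
proof (induction N arbitrary: z w)
  case 0
  then show ?case by (simp add: Desc_0)
next
  case (Suc N)
  then obtain w' where w': "w' \<in> nbrs w" "u \<in> Desc N (w, w')"
    by (auto simp: Desc_Suc)
  then have "even (level u - level w' - int N)"
    using Suc.IH by (simp add: nbrs_def)
  moreover have "level w' = level w + 1 \<or> level w' = level w - 1"
    using nbrs_parent_or_child[OF w'(1)] by auto
  ultimately show ?case by auto
qed

text \<open>
  The normal form of a ball of even exponent \<open>2m\<close> has determinant \<open>\<pi>^(2m)\<close>, so a homothety by \<open>\<pi>^(-m)\<close>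
  moves it into \<open>SL\<^sub>2(F)\<close>.
\<close>
lemma even_level_SL2_orbit:
  fixes v :: "'a::{field,finite} vertex"
  assumes "v \<in> tree_vertices" "even (level v)"
  shows "\<exists>s\<in>SL2 UNIV. v = act s (ray_vertex 0)"
proof -
  obtain n f where v: "v = ball_vertex n (f :: 'a fls)"
    using assms by (auto simp: tree_vertices_eq)
  then obtain m where n: "n = 2 * m" using assms by auto
  let ?s = "mat22 (unif m) (f * unif (- m)) 0 (unif (- m))"
  have "mat22 (unif n) f 0 1 *v x = unif m *s (?s *v x)" for x
  proof -
    have "unif n = unif m * (unif m :: 'a fls)" by (simp add: n flip: unif_add)
    moreover have "unif m * (unif (- m) * y) = y" for y :: "'a fls"
      by (simp flip: mult.assoc)
    ultimately show ?thesis
      by (simp add: vec2_eq_iff matrix_vector_2 algebra_simps)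
  qed
  then have "ball_lattice n f = (*s) (unif m) ` (*v) ?s ` std_lattice"
    unfolding ball_lattice_eq_matrix by (simp add: image_image)
  then have "v = act ?s (ray_vertex 0)"
    by (simp add: v ball_vertex_def homothety_class_smult ray_vertex_0 act_homothety_class)
  moreover have "?s \<in> SL2 UNIV" by (simp add: SL2_UNIV_iff)
  ultimately show ?thesis by blast
qed

lemma odd_tree_sphere_origin_SL2:
  assumes "u \<in> tree_sphere (2 * i + 1) (ray_vertex 0)"
  shows "\<exists>s\<in>SL2 UNIV. u = act s (ray_vertex 0)"
proof -
  obtain w where w: "w \<in> nbrs (ray_vertex 0)" "u \<in> Desc (2 * i + 1) (ray_vertex 0, w)"
    using assms by (auto simp: tree_sphere_def)
  have adj: "tree_adj (ray_vertex 0) w" using w by (simp add: nbrs_def)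
  have "odd (level w)"
    using nbrs_parent_or_child[OF w(1)] by (auto simp: ray_vertex_eq_ball)
  with Desc_level_parity[OF adj w(2)] have "even (level u)" by auto
  moreover have "u \<in> tree_vertices"
    using w(2) by (fastforce simp: Desc_def tree_adj_def)
  ultimately show ?thesis using even_level_SL2_orbit by blast
qed

text \<open>
  For a fixed edge the margin tends to infinity with the number of steps; an odd number of steps is
  the parity at which even heights are reached from \<open>w\<close>.
\<close>
lemma edge_avg_tendsto:
  fixes v :: "'a::{field,finite} vertex"
  assumes w: "w \<in> nbrs v" and v: "even (height v)" and B: "B \<ge> 0"
    and lim: "walk_limit (real CARD('a)) \<Phi> B \<Lambda>"
  shows "(\<lambda>i. (\<Sum>u\<in>Desc (2 * i + 1) (v, w). \<Phi> (height u)) / of_nat (CARD('a) ^ (2 * i + 1))) \<longlonglongrightarrow> \<Lambda>"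
proof -
  define q where "q = real CARD('a)"
  have "card {0, 1 :: 'a} \<le> CARD('a)" by (intro card_mono) auto
  then have q: "q \<ge> 2" by (simp add: q_def)
  define k where "k = height w"
  obtain \<epsilon> where e: "edge_state \<epsilon> k (v, w)" "\<epsilon> = Fwd \<Longrightarrow> 1 \<le> k" "odd (height v + k)"
    unfolding k_def using edge_state_of_nbr[OF w] by metis
  then obtain j where k: "k = 2 * j + 1" using v by (metis even_add oddE)
  have avg: "(\<Sum>u\<in>Desc (2 * i + 1) (v, w). \<Phi> (height u)) / of_nat (CARD('a) ^ (2 * i + 1)) 
      = walk_avg q \<Phi> \<epsilon> k (2 * i + 1)" for i
    unfolding sum_Desc_height[OF e(1)] by (simp add: q_def)
  \<comment> \<open>the offset \<open>j\<close> makes the number of steps at least the height \<open>k\<close>\<close>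
  have bound: "cmod (walk_avg q \<Phi> \<epsilon> k (2 * (i + j) + 1) - \<Lambda>) \<le> 4 * B * (1 / q) ^ i" for i
  proof (cases \<epsilon>)
    case Fwd
    have "2 * (i + j) + 1 = k + 2 * i" by (simp add: k)
    moreover have "4 * B * (1 / q) ^ i = 4 * B / q ^ i" by (simp add: power_one_over)
    ultimately show ?thesis
      using lim[folded q_def] e(2)[OF Fwd] Fwd by (simp only: walk_limit_def)
  next
    case Bwd
    have "cmod (walk_avg q \<Phi> \<epsilon> k (2 * (i + j) + 1) - \<Lambda>) \<le> 2 * B / q ^ (2 * i)"
      using lim[folded q_def, unfolded walk_limit_def, THEN conjunct1, rule_format, of k "2 * (i + j) + 1"] Bwd
      by (simp add: k)
    also have "\<dots> \<le> 4 * B / q ^ i"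
      using q B by (intro frac_le power_increasing) auto
    finally show ?thesis by (simp add: power_one_over)
  qed
  have "(\<lambda>i. 4 * B * (1 / q) ^ i) \<longlonglongrightarrow> 4 * B * 0"
    using q by (intro tendsto_mult tendsto_const LIMSEQ_power_zero) auto
  then have "(\<lambda>i. 4 * B * (1 / q) ^ i) \<longlonglongrightarrow> 0" by simp
  with always_eventually[OF allI[OF bound]]
  have "(\<lambda>i. walk_avg q \<Phi> \<epsilon> k (2 * (i + j) + 1) - \<Lambda>) \<longlonglongrightarrow> 0"
    by (rule Lim_null_comparison)
  then have "(\<lambda>i. walk_avg q \<Phi> \<epsilon> k (2 * (i + j) + 1)) \<longlonglongrightarrow> \<Lambda>"
    by (rule LIM_zero_cancel)
  then have "(\<lambda>i. walk_avg q \<Phi> \<epsilon> k (2 * i + 1)) \<longlonglongrightarrow> \<Lambda>"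
    by (rule LIMSEQ_offset[where k = j and f = "\<lambda>i. walk_avg q \<Phi> \<epsilon> k (2 * i + 1)"])
  then show ?thesis unfolding avg .
qed

lemma sphere_avg_tendsto:
  fixes v :: "'a::{field,finite} vertex"
  assumes v: "v \<in> tree_vertices" "even (height v)" and B: "B \<ge> 0"
    and lim: "walk_limit (real CARD('a)) \<Phi> B \<Lambda>"
  shows "(\<lambda>i. (\<Sum>u\<in>tree_sphere (2 * i + 1) v. \<Phi> (height u)) / of_nat (card (tree_sphere (2 * i + 1) v))) \<longlonglongrightarrow> \<Lambda>"
proof -
  define q1 where "q1 = complex_of_nat (CARD('a) + 1)"
  have q1: "q1 \<noteq> 0" unfolding q1_def by (metis of_nat_0_eq_iff add_is_0 one_neq_zero)
  have "(\<lambda>i. (\<Sum>w\<in>nbrs v. (\<Sum>u\<in>Desc (2 * i + 1) (v, w). \<Phi> (height u)) / of_nat (CARD('a) ^ (2 * i + 1))) / q1) 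
      \<longlonglongrightarrow> (\<Sum>w\<in>nbrs v. \<Lambda>) / q1"
    by (intro tendsto_divide tendsto_sum tendsto_const edge_avg_tendsto[OF _ _ B lim] v q1)
  also have "(\<Sum>w\<in>nbrs v. \<Lambda>) / q1 = \<Lambda>"
    using card_nbrs[OF v(1)] q1 by (simp add: q1_def)
  also have "(\<lambda>i. (\<Sum>w\<in>nbrs v. (\<Sum>u\<in>Desc (2 * i + 1) (v, w). \<Phi> (height u)) / of_nat (CARD('a) ^ (2 * i + 1))) / q1)
      = (\<lambda>i. (\<Sum>u\<in>tree_sphere (2 * i + 1) v. \<Phi> (height u)) / of_nat (card (tree_sphere (2 * i + 1) v)))"
    unfolding sum_tree_sphere[OF v(1)] card_tree_sphere[OF v(1)] sum_divide_distrib[symmetric] of_nat_mult q1_def 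
    by (intro ext) (simp only: divide_divide_eq_left mult.commute[of "of_nat (CARD('a) + 1)"])
  finally show ?thesis .
qed

section \<open>The integral against the invariant measure\<close>

lemma borel_measurable_h_K:
  fixes f :: "'a::{field,finite} quot \<Rightarrow> complex"
  assumes "sets \<mu> = sets quot_borel" and f: "\<And>x. x \<in> quot_space \<Longrightarrow> f x = \<Phi> (h_K x)"
  shows "f \<in> borel_measurable \<mu>"
proof -
  have "(\<lambda>x. \<Phi> (h_K x)) \<in> borel_measurable (quot_borel :: 'a quot measure)"
    using measurable_compose[OF h_K_measurable, of \<Phi> borel] by simp
  then have "f \<in> borel_measurable quot_borel"
    using f by (subst measurable_cong) auto
  then show ?thesis
    using assms(1) measurable_cong_sets by blast
qed

text \<open>
  The means \<open>F i\<close> of \<open>f\<close> over translates by matrices \<open>s u\<close> taking \<open>v\<^sub>0\<close> to the points \<open>u\<close> of a sphere are,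
  at the coset of \<open>g\<close>, the sphere means of the profile around \<open>g v\<^sub>0\<close>. They have the same integral
  as \<open>f\<close> by invariance and converge pointwise to the constant \<open>\<Lambda>\<close>.
\<close>
lemma invariant_integral:
  fixes f :: "'a::{field,finite} quot \<Rightarrow> complex"
  assumes \<mu>: "invariant_prob \<mu>" and f: "\<And>x. x \<in> quot_space \<Longrightarrow> f x = \<Phi> (h_K x)"
    and \<Phi>: "\<And>n. even n \<Longrightarrow> cmod (\<Phi> n) \<le> B"
    and lim: "walk_limit (real CARD('a)) \<Phi> B \<Lambda>"
  shows "(\<integral>x. f x \<partial>\<mu>) = \<Lambda>"
proof -
  interpret prob_space \<mu> using \<mu> by (simp add: invariant_prob_def prob_on_quot_def)
  have sets: "sets \<mu> = sets quot_borel" using \<mu> by (simp add: invariant_prob_def prob_on_quot_def)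
  have space: "space \<mu> = quot_space" using sets_eq_imp_space_eq[OF sets] by simp
  have B: "B \<ge> 0" using order_trans[OF norm_ge_zero \<Phi>[of 0]] by simp
  have f_meas: "f \<in> borel_measurable \<mu>"
    by (rule borel_measurable_h_K[where \<Phi> = \<Phi>, OF sets f])
  have f_bound: "cmod (f x) \<le> B" if "x \<in> quot_space" for x
    using f[OF that] \<Phi> h_K_even[OF that] by simp
  have trans_meas: "right_translate s \<in> measurable \<mu> \<mu>" if "s \<in> SL2 UNIV" for s
    using right_translate_measurable[OF that] measurable_cong_sets[OF sets sets] by blast
  have trans_int: "(\<integral>x. f (right_translate s x) \<partial>\<mu>) = (\<integral>x. f x \<partial>\<mu>)" if "s \<in> SL2 UNIV" for s
    using integral_distr[OF trans_meas[OF that] f_meas] \<mu> that by (simp add: invariant_prob_def)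
  define S where "S i = tree_sphere (2 * i + 1) (ray_vertex 0 :: 'a vertex)" for i
  have card_S: "card (S i) > 0" for i
    by (simp add: S_def card_tree_sphere)
  obtain s :: "'a vertex \<Rightarrow> 'a mat2" where s: "\<And>i u. u \<in> S i \<Longrightarrow> s u \<in> SL2 UNIV \<and> u = act (s u) (ray_vertex 0)"
    using odd_tree_sphere_origin_SL2 unfolding S_def by metis
  define F where "F i x = (\<Sum>u\<in>S i. f (right_translate (s u) x)) / of_nat (card (S i))" for i x
  have F_eq: "F i (coset g) = (\<Sum>u\<in>tree_sphere (2 * i + 1) (act g (ray_vertex 0)). \<Phi> (height u)) 
      / of_nat (card (tree_sphere (2 * i + 1) (act g (ray_vertex 0))))" if g: "g \<in> SL2 UNIV" for i g
  proof -
    have detg: "det g \<noteq> 0" using g by (simp add: SL2_UNIV_iff)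
    have "f (right_translate (s u) (coset g)) = \<Phi> (height (act g u))" if "u \<in> S i" for u
    proof -
      have *: "g ** s u \<in> SL2 UNIV" using s[OF that] g SL2_UNIV_mult by blast
      then have "f (right_translate (s u) (coset g)) = \<Phi> (h_K (coset (g ** s u)))"
        unfolding right_translate_coset by (intro f) (simp add: quot_space_def)
      also have "h_K (coset (g ** s u)) = height (act g u)"
        using s[OF that] by (simp add: h_K_coset[OF *] flip: act_mult)
      finally show ?thesis .
    qed
    then have "(\<Sum>u\<in>S i. f (right_translate (s u) (coset g))) = (\<Sum>u\<in>S i. \<Phi> (height (act g u)))"
      by (intro sum.cong) auto
    also have "\<dots> = (\<Sum>u\<in>act g ` S i. \<Phi> (height u))"
      using inj_act[OF detg] by (subst sum.reindex) (auto intro: inj_on_subset)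
    finally have "(\<Sum>u\<in>S i. f (right_translate (s u) (coset g))) = (\<Sum>u\<in>act g ` S i. \<Phi> (height u))" .
    moreover have "card (act g ` S i) = card (S i)"
      by (intro card_image inj_on_subset[OF inj_act[OF detg]]) simp
    ultimately show ?thesis
      unfolding F_def tree_sphere_act[OF detg] S_def[symmetric] by simp
  qed
  have F_lim: "(\<lambda>i. F i x) \<longlonglongrightarrow> \<Lambda>" if x: "x \<in> quot_space" for x
  proof -
    obtain g where g: "g \<in> SL2 UNIV" "x = coset g" using x by (auto simp: quot_space_def)
    show ?thesis
      unfolding g(2) F_eq[OF g(1)]
    proof (rule sphere_avg_tendsto[OF _ _ B lim])
      show "act g (ray_vertex 0) \<in> tree_vertices"
        using g(1) by (intro act_in_tree) (auto simp: SL2_UNIV_iff)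
    qed (use even_height_SL2[OF g(1)] in auto)
  qed
  have F_meas: "F i \<in> borel_measurable \<mu>" for i
    unfolding F_def using measurable_compose[OF trans_meas f_meas] s 
    by (intro borel_measurable_divide borel_measurable_sum borel_measurable_const) blast
  have F_bound: "cmod (F i x) \<le> B" if "x \<in> quot_space" for i x
  proof -
    have "cmod (\<Sum>u\<in>S i. f (right_translate (s u) x)) \<le> (\<Sum>u\<in>S i. B)"
      using s right_translate_in_quot_space[OF _ that] by (intro sum_norm_le f_bound) blast
    then show ?thesis
      using card_S[of i] by (simp add: F_def norm_divide field_simps)
  qed
  have integrable_trans: "integrable \<mu> (\<lambda>x. f (right_translate u x))" if "u \<in> SL2 UNIV" for u
    by (rule integrable_const_bound[of _ B])
       (use f_bound right_translate_in_quot_space[OF that] space measurable_compose[OF trans_meas[OF that] f_meas] in auto)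
  have F_int: "(\<integral>x. F i x \<partial>\<mu>) = (\<integral>x. f x \<partial>\<mu>)" for i
  proof -
    have "(\<integral>x. F i x \<partial>\<mu>) = (\<Sum>u\<in>S i. \<integral>x. f (right_translate (s u) x) \<partial>\<mu>) / of_nat (card (S i))"
      unfolding F_def using s integrable_trans by (simp add: Bochner_Integration.integral_sum)
    also have "(\<Sum>u\<in>S i. \<integral>x. f (right_translate (s u) x) \<partial>\<mu>) = (\<Sum>u\<in>S i. \<integral>x. f x \<partial>\<mu>)"
      using s trans_int by (intro sum.cong) auto
    finally show ?thesis using card_S[of i] by simp
  qed
  have "(\<lambda>i. \<integral>x. F i x \<partial>\<mu>) \<longlonglongrightarrow> (\<integral>x. \<Lambda> \<partial>\<mu>)"
  proof (rule integral_dominated_convergence[where w = "\<lambda>_. B"])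
    show "AE x in \<mu>. (\<lambda>i. F i x) \<longlonglongrightarrow> \<Lambda>" "\<And>i. AE x in \<mu>. cmod (F i x) \<le> B"
      using F_lim F_bound by (auto intro!: AE_I2 simp: space)
  qed (use F_meas in auto)
  then have "(\<lambda>i. \<integral>x. f x \<partial>\<mu>) \<longlonglongrightarrow> \<Lambda>"
    by (simp add: F_int prob_space)
  then show ?thesis using LIMSEQ_unique[OF tendsto_const] by blast
qed

section \<open>Shadow decompositions and equidistribution\<close>

lemma shadow_nonneg: "shadow TYPE('a::{field,finite}) \<epsilon> k N j \<ge> 0"
  by (simp add: shadow_def Let_def)

text \<open>
  The profile is assumed to vanish at odd heights because the pushforward lives on the even numbers,
  whereas the sum of a shadow over all heights is what the walk computes.
\<close>
lemma shadow_decomposition_integral: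
  fixes f :: "'a::{field,finite} quot \<Rightarrow> complex"
  assumes lam: "prob_on_quot lam" and dec: "shadow_decomposition lam L c \<epsilon> k D"
    and f: "\<And>x. x \<in> quot_space \<Longrightarrow> f x = \<Phi> (h_K x)" and odd: "\<And>n. odd n \<Longrightarrow> \<Phi> n = 0"
  shows "(\<integral>x. f x \<partial>lam) = (\<Sum>l=1..L. c l * walk_avg (real CARD('a)) \<Phi> (\<epsilon> l) (k l) (D l))"
proof -
  have sets: "sets lam = sets quot_borel" using lam by (simp add: prob_on_quot_def)
  have space: "space lam = quot_space" using sets_eq_imp_space_eq[OF sets] by simp
  define E where "E = {n :: nat. even n}"
  define w where "w j = (\<Sum>l=1..L. c l * shadow TYPE('a) (\<epsilon> l) (k l) (D l) j)" for j
  have c: "c l \<ge> 0" "\<epsilon> l = Fwd \<Longrightarrow> k l \<ge> 1" if "l \<in> {1..L}" for l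
    using dec that by (auto simp: shadow_decomposition_def)
  have w: "w j \<ge> 0" for j
    unfolding w_def using c by (intro sum_nonneg mult_nonneg_nonneg shadow_nonneg) auto
  have "\<forall>l\<in>{1..L}. \<exists>J. finite J \<and> (\<forall>j. j \<notin> J \<longrightarrow> shadow TYPE('a) (\<epsilon> l) (k l) (D l) j = 0) \<and>
    (\<forall>(\<Phi> :: nat \<Rightarrow> complex) J'. finite J' \<longrightarrow> J \<subseteq> J' \<longrightarrow> 
       (\<Sum>j\<in>J'. \<Phi> j * shadow TYPE('a) (\<epsilon> l) (k l) (D l) j) = walk_avg (real CARD('a)) \<Phi> (\<epsilon> l) (k l) (D l))"
    using c(2) by (intro ballI shadow_sums) auto
  then obtain J where J: "\<And>l. l \<in> {1..L} \<Longrightarrow> finite (J l)" 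
    "\<And>l j. l \<in> {1..L} \<Longrightarrow> j \<notin> J l \<Longrightarrow> shadow TYPE('a) (\<epsilon> l) (k l) (D l) j = 0"
    "\<And>l J'. l \<in> {1..L} \<Longrightarrow> finite J' \<Longrightarrow> J l \<subseteq> J' \<Longrightarrow> 
       (\<Sum>j\<in>J'. \<Phi> j * shadow TYPE('a) (\<epsilon> l) (k l) (D l) j) = walk_avg (real CARD('a)) \<Phi> (\<epsilon> l) (k l) (D l)"
    by (metis (no_types))
  define J' where "J' = (\<Union>l\<in>{1..L}. J l)"
  have J': "finite J'" using J(1) by (auto simp: J'_def)
  have w_0: "w j = 0" if "j \<notin> J'" for j
    unfolding w_def using that J(2) by (intro sum.neutral) (auto simp: J'_def)
  have "(\<integral>x. f x \<partial>lam) = (\<integral>x. \<Phi> (h_K x) \<partial>lam)"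
    using f space by (intro Bochner_Integration.integral_cong) auto
  also have "\<dots> = (\<integral>n. \<Phi> n \<partial>distr lam (count_space E) h_K)"
    using h_K_measurable measurable_cong_sets[OF sets refl] unfolding E_def
    by (intro integral_distr[symmetric]) auto
  also have "distr lam (count_space E) h_K = density (count_space E) (\<lambda>j. ennreal (w j))"
    using dec by (simp add: shadow_decomposition_def E_def w_def point_measure_def)
  also have "(\<integral>n. \<Phi> n \<partial>density (count_space E) (\<lambda>j. ennreal (w j))) = (\<integral>n. w n *\<^sub>R \<Phi> n \<partial>count_space E)"
    using w by (intro integral_density) auto
  also have "\<dots> = (\<Sum>n | n \<in> E \<and> w n *\<^sub>R \<Phi> n \<noteq> 0. w n *\<^sub>R \<Phi> n)"
    using w_0 by (intro lebesgue_integral_count_space_finite_support finite_subset[OF _ J']) auto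
  also have "\<dots> = (\<Sum>n\<in>J'. w n *\<^sub>R \<Phi> n)"
    using J' w_0 odd by (intro sum.mono_neutral_left) (auto simp: E_def)
  also have "\<dots> = (\<Sum>n\<in>J'. \<Sum>l=1..L. c l * (\<Phi> n * shadow TYPE('a) (\<epsilon> l) (k l) (D l) n))"
    by (simp add: w_def scaleR_conv_of_real sum_distrib_left mult_ac)
  also have "\<dots> = (\<Sum>l=1..L. c l * (\<Sum>n\<in>J'. \<Phi> n * shadow TYPE('a) (\<epsilon> l) (k l) (D l) n))"
    by (subst sum.swap) (simp add: sum_distrib_left)
  also have "\<dots> = (\<Sum>l=1..L. c l * walk_avg (real CARD('a)) \<Phi> (\<epsilon> l) (k l) (D l))"
  proof (intro sum.cong refl arg_cong2[where f = "(*)"])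
    fix l assume l: "l \<in> {1..L}"
    show "(\<Sum>n\<in>J'. \<Phi> n * shadow TYPE('a) (\<epsilon> l) (k l) (D l) n) = walk_avg (real CARD('a)) \<Phi> (\<epsilon> l) (k l) (D l)"
      by (rule J(3)[OF l J']) (use l in \<open>auto simp: J'_def\<close>)
  qed
  finally show ?thesis .
qed

lemma convex_combination_bound:
  fixes z :: "nat \<Rightarrow> complex" and c :: "nat \<Rightarrow> real"
  assumes "\<And>l. l \<in> I \<Longrightarrow> c l \<ge> 0" "sum c I = 1" "\<And>l. l \<in> I \<Longrightarrow> cmod (z l - \<Lambda>) \<le> b"
  shows "cmod ((\<Sum>l\<in>I. c l * z l) - \<Lambda>) \<le> b"
proof -
  have "(\<Sum>l\<in>I. complex_of_real (c l)) = 1"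
    using assms(2) by (metis of_real_1 of_real_sum)
  then have "(\<Sum>l\<in>I. c l * z l) - \<Lambda> = (\<Sum>l\<in>I. c l * (z l - \<Lambda>))"
    by (simp add: algebra_simps sum_subtractf flip: sum_distrib_left)
  also have "cmod \<dots> \<le> (\<Sum>l\<in>I. c l * b)"
    using assms by (intro sum_norm_le) (auto simp: norm_mult mult_left_mono)
  also have "\<dots> = b" using assms(2) by (simp flip: sum_distrib_right)
  finally show ?thesis .
qed

text \<open>
  Every component is within its own error of the same number \<open>\<Lambda>\<close>, and a convex combination
  does not increase the error. Passing from \<open>\<Phi>\<close> to the profile \<open>\<Psi>\<close> changes nothing on the values of
  \<open>h_K\<close>.
\<close>
lemma equidistribution_bounds:
  fixes f :: "'a::{field,finite} quot \<Rightarrow> complex"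
  assumes \<mu>: "invariant_prob \<mu>" and lam: "prob_on_quot lam" 
    and dec: "shadow_decomposition lam L c \<epsilon> k D" and M: "M = margin L k D" "M \<ge> 0"
    and f: "\<And>x. x \<in> quot_space \<Longrightarrow> f x = \<Phi> (h_K x)"
    and \<Phi>: "\<And>n. even n \<Longrightarrow> cmod (\<Phi> n) \<le> B"
  shows "cmod ((\<integral>x. f x \<partial>lam) - (\<integral>x. f x \<partial>\<mu>)) \<le> 4 * B * real CARD('a) powr (- (real_of_int M / 2))"
    and "(\<forall>l\<in>{1..L}. \<epsilon> l = Bwd) \<Longrightarrow>
      cmod ((\<integral>x. f x \<partial>lam) - (\<integral>x. f x \<partial>\<mu>)) \<le> 2 * B * real CARD('a) powr (- real_of_int M)"
proof -
  define q where "q = real CARD('a)"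
  have "card {0, 1 :: 'a} \<le> CARD('a)" by (intro card_mono) auto
  then have q: "q \<ge> 2" by (simp add: q_def)
  have B: "B \<ge> 0" using order_trans[OF norm_ge_zero \<Phi>[of 0]] by simp
  define \<Psi> where "\<Psi> n = (if even n then \<Phi> n else 0)" for n
  have \<Psi>: "\<And>n. even n \<Longrightarrow> cmod (\<Psi> n) \<le> B" "\<And>n. odd n \<Longrightarrow> \<Psi> n = 0"
    using \<Phi> by (auto simp: \<Psi>_def)
  have f': "f x = \<Psi> (h_K x)" if "x \<in> quot_space" for x
    using f[OF that] h_K_even[OF that] by (simp add: \<Psi>_def)
  from walk_limit_exists[where \<Phi> = \<Psi> and B = B, OF q \<Psi>(1)]
  obtain \<Lambda> where lim: "walk_limit q \<Psi> B \<Lambda>" ..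
  have bwd: "cmod (walk_avg q \<Psi> Bwd k N - \<Lambda>) \<le> 2 * B / q ^ (N - k)" if "even (k + N)" "k \<le> N" for k N
    by (rule lim[unfolded walk_limit_def, THEN conjunct1, rule_format, OF conjI[OF that]])
  have fwd: "cmod (walk_avg q \<Psi> Fwd k (k + 2 * s) - \<Lambda>) \<le> 4 * B / q ^ s" if "1 \<le> k" for k s
    by (rule lim[unfolded walk_limit_def, THEN conjunct2, rule_format, OF that])
  have int_\<mu>: "(\<integral>x. f x \<partial>\<mu>) = \<Lambda>"
    by (rule invariant_integral[where \<Phi> = \<Psi>, OF \<mu> f' \<Psi>(1) lim[unfolded q_def]])
  have int_lam: "(\<integral>x. f x \<partial>lam) = (\<Sum>l=1..L. c l * walk_avg q \<Psi> (\<epsilon> l) (k l) (D l))"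
    unfolding q_def by (rule shadow_decomposition_integral[where \<Phi> = \<Psi>, OF lam dec f' \<Psi>(2)])
  have c: "\<And>l. l \<in> {1..L} \<Longrightarrow> c l \<ge> 0" "sum c {1..L} = 1" "\<And>l. l \<in> {1..L} \<Longrightarrow> even (k l + D l)"
    "\<And>l. l \<in> {1..L} \<Longrightarrow> \<epsilon> l = Fwd \<Longrightarrow> 1 \<le> k l"
    using dec by (auto simp: shadow_decomposition_def)
  have M_le: "M \<le> int (D l) - int (k l)" if "l \<in> {1..L}" for l
    unfolding M(1) margin_def using that by (intro Min_le) auto
  have k_le: "k l \<le> D l" if "l \<in> {1..L}" for l
    using M_le[OF that] M(2) by simp
  have Bwd_bound: "cmod (walk_avg q \<Psi> (\<epsilon> l) (k l) (D l) - \<Lambda>) \<le> 2 * B * q powr (- real_of_int M)"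
    if l: "l \<in> {1..L}" and "\<epsilon> l = Bwd" for l
  proof -
    have "cmod (walk_avg q \<Psi> (\<epsilon> l) (k l) (D l) - \<Lambda>) \<le> 2 * B / q ^ (D l - k l)"
      using bwd[OF c(3)[OF l] k_le[OF l]] that by simp
    also have "\<dots> = 2 * B * q powr (- real (D l - k l))"
      using q by (simp add: powr_minus powr_realpow divide_inverse)
    also have "\<dots> \<le> 2 * B * q powr (- real_of_int M)"
      using M_le[OF l] k_le[OF l] q B by (intro mult_left_mono powr_mono) auto
    finally show ?thesis .
  qed
  have any_bound: "cmod (walk_avg q \<Psi> (\<epsilon> l) (k l) (D l) - \<Lambda>) \<le> 4 * B * q powr (- (real_of_int M / 2))"
    if l: "l \<in> {1..L}" for l
  proof (cases "\<epsilon> l")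
    case Fwd
    have "even (D l - k l)" using c(3)[OF l] k_le[OF l] by presburger
    then obtain s where "D l - k l = 2 * s" by (rule evenE)
    then have s: "D l = k l + 2 * s" using k_le[OF l] by simp
    then have "cmod (walk_avg q \<Psi> (\<epsilon> l) (k l) (D l) - \<Lambda>) \<le> 4 * B / q ^ s"
      using fwd[of "k l" s] c(4)[OF l Fwd] Fwd by simp
    also have "\<dots> = 4 * B * q powr (- real s)"
      using q by (simp add: powr_minus powr_realpow divide_inverse)
    also have "\<dots> \<le> 4 * B * q powr (- (real_of_int M / 2))"
      using M_le[OF l] q B by (intro mult_left_mono powr_mono) (auto simp: s)
    finally show ?thesis .
  next
    case Bwd
    note Bwd_bound[OF l Bwd]
    also have "2 * B * q powr (- real_of_int M) \<le> 4 * B * q powr (- (real_of_int M / 2))"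
      using M(2) q B by (intro mult_mono powr_mono) auto
    finally show ?thesis .
  qed
  show "cmod ((\<integral>x. f x \<partial>lam) - (\<integral>x. f x \<partial>\<mu>)) \<le> 4 * B * real CARD('a) powr (- (real_of_int M / 2))"
    unfolding int_\<mu> int_lam q_def[symmetric]
    by (rule convex_combination_bound[OF c(1,2) any_bound])
  show "cmod ((\<integral>x. f x \<partial>lam) - (\<integral>x. f x \<partial>\<mu>)) \<le> 2 * B * real CARD('a) powr (- real_of_int M)"
    if "\<forall>l\<in>{1..L}. \<epsilon> l = Bwd"
    unfolding int_\<mu> int_lam q_def[symmetric]
    by (rule convex_combination_bound[OF c(1,2) Bwd_bound]) (use that in auto)
qed

text \<open>
  Boundedness of \<open>f\<close> bounds \<open>\<Phi>\<close> on the even numbers because each of them is a value of \<open>h_K\<close>; without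
  this the supremum would carry no information.
\<close>
lemma sup_norm_bound:
  fixes f :: "'a::{field,finite} quot \<Rightarrow> complex"
  assumes bd: "bounded (f ` quot_space)" and f: "\<And>x. x \<in> quot_space \<Longrightarrow> f x = \<Phi> (h_K x)"
    and n: "even n"
  shows "cmod (\<Phi> n) \<le> sup_norm \<Phi>"
  unfolding sup_norm_def
proof (rule cSUP_upper)
  obtain b where b: "\<And>x. x \<in> quot_space \<Longrightarrow> cmod (f x) \<le> b"
    using bd by (auto simp: bounded_iff)
  have "cmod (\<Phi> m) \<le> b" if "even m" for m
    using h_K_surj[OF that] b f by metis
  then show "bdd_above ((\<lambda>n. cmod (\<Phi> n)) ` {n. even n})"
    by (intro bdd_aboveI2[of _ _ b]) auto
qed (use n in simp)

lemma right_K_invariant_profile: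
  fixes f :: "'a::{field,finite} quot \<Rightarrow> complex"
  assumes "right_K_invariant f"
  obtains \<Phi> where "\<And>x. x \<in> quot_space \<Longrightarrow> f x = \<Phi> (h_K x)"
proof
  fix x :: "'a quot" assume x: "x \<in> quot_space"
  define y :: "'a quot" where "y = (SOME y. y \<in> quot_space \<and> h_K y = h_K x)"
  have y: "y \<in> quot_space \<and> h_K y = h_K x"
    unfolding y_def by (rule someI_ex) (use x in blast)
  then obtain k where "k \<in> SL2 integer_ring" "y = right_translate k x"
    using h_K_eq_imp_same_K_orbit[OF x] by metis
  then have "f x = f y"
    using assms x by (auto simp: right_K_invariant_def)
  then show "f x = (\<lambda>n. f (SOME y. y \<in> quot_space \<and> h_K y = n)) (h_K x)"
    by (simp add: y_def)
qed

lemma powr_minus_margin_tendsto: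
  fixes M :: "nat \<Rightarrow> int"
  assumes "q > 1" "filterlim M at_top sequentially"
  shows "(\<lambda>T. q powr (- (real_of_int (M T) / 2))) \<longlonglongrightarrow> 0"
proof -
  have "filterlim (\<lambda>T. real_of_int (M T)) at_top sequentially"
    using filterlim_compose[OF filterlim_real_of_int_at_top assms(2)] .
  then have "filterlim (\<lambda>T. ln q / 2 * real_of_int (M T)) at_top sequentially"
    using assms(1) by (intro filterlim_tendsto_pos_mult_at_top[OF tendsto_const]) auto
  then have "filterlim (\<lambda>T. - (ln q / 2 * real_of_int (M T))) at_bot sequentially"
    by (simp add: filterlim_uminus_at_bot)
  from filterlim_compose[OF exp_at_bot this]
  show ?thesis
    using assms(1) by (simp add: powr_def mult_ac)
qed

lemma equidistribution_bounds_sup_norm: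
  fixes f :: "'a::{field,finite} quot \<Rightarrow> complex"
  assumes hyps: "invariant_prob \<mu>" "prob_on_quot lam" "shadow_decomposition lam L c \<epsilon> k D"
      "M = margin L k D" "M \<ge> 0"
    and f: "bounded (f ` quot_space)" "\<forall>x\<in>quot_space. f x = \<Phi> (h_K x)"
  shows "cmod ((\<integral>x. f x \<partial>lam) - (\<integral>x. f x \<partial>\<mu>))
        \<le> 4 * sup_norm \<Phi> * real CARD('a) powr (- (real_of_int M / 2))"
    and "\<forall>l\<in>{1..L}. \<epsilon> l = Bwd \<Longrightarrow>
        cmod ((\<integral>x. f x \<partial>lam) - (\<integral>x. f x \<partial>\<mu>)) \<le> 2 * sup_norm \<Phi> * real CARD('a) powr (- real_of_int M)"
proof -
  have f': "\<And>x. x \<in> quot_space \<Longrightarrow> f x = \<Phi> (h_K x)" using f(2) by blast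
  have \<Phi>: "cmod (\<Phi> n) \<le> sup_norm \<Phi>" if "even n" for n
    by (rule sup_norm_bound[where \<Phi> = \<Phi>, OF f(1) f' that])
  note bounds = equidistribution_bounds[where \<Phi> = \<Phi> and B = "sup_norm \<Phi>", OF hyps f' \<Phi>]
  show "cmod ((\<integral>x. f x \<partial>lam) - (\<integral>x. f x \<partial>\<mu>))
        \<le> 4 * sup_norm \<Phi> * real CARD('a) powr (- (real_of_int M / 2))"
    by (rule bounds(1))
  show "cmod ((\<integral>x. f x \<partial>lam) - (\<integral>x. f x \<partial>\<mu>)) \<le> 2 * sup_norm \<Phi> * real CARD('a) powr (- real_of_int M)"
    if "\<forall>l\<in>{1..L}. \<epsilon> l = Bwd"
    by (rule bounds(2)[OF _ _ that])
qed

lemma equidistribution_limit: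
  fixes f :: "'a::{field,finite} quot \<Rightarrow> complex" and M :: "nat \<Rightarrow> int"
  assumes hyps: "invariant_prob \<mu>" "\<forall>T. prob_on_quot (lam T)"
      "\<forall>T. shadow_decomposition (lam T) (L T) (c T) (eps T) (k T) (D T)"
      "\<forall>T. M T = margin (L T) (k T) (D T)" "\<forall>T. M T \<ge> 0" "filterlim M at_top sequentially"
    and f: "right_K_invariant f" "bounded (f ` quot_space)"
  shows "(\<lambda>T. \<integral>x. f x \<partial>lam T) \<longlonglongrightarrow> (\<integral>x. f x \<partial>\<mu>)"
proof -
  obtain \<Phi> where \<Phi>: "\<And>x. x \<in> quot_space \<Longrightarrow> f x = \<Phi> (h_K x)"
    using right_K_invariant_profile[OF f(1)] by blast
  have "card {0, 1 :: 'a} \<le> CARD('a)" by (intro card_mono) auto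
  then have "real CARD('a) > 1" by simp
  from tendsto_mult[OF tendsto_const powr_minus_margin_tendsto[OF this hyps(6)], of "4 * sup_norm \<Phi>"]
  have lim: "(\<lambda>T. 4 * sup_norm \<Phi> * real CARD('a) powr (- (real_of_int (M T) / 2))) \<longlonglongrightarrow> 0"
    by simp
  have bound: "cmod ((\<integral>x. f x \<partial>lam T) - (\<integral>x. f x \<partial>\<mu>)) 
      \<le> 4 * sup_norm \<Phi> * real CARD('a) powr (- (real_of_int (M T) / 2))" for T
    by (rule equidistribution_bounds_sup_norm(1)[OF hyps(1) hyps(2-5)[rule_format, of T] f(2)]) (use \<Phi> in blast)
  have "(\<lambda>T. (\<integral>x. f x \<partial>lam T) - (\<integral>x. f x \<partial>\<mu>)) \<longlonglongrightarrow> 0"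
    by (rule Lim_null_comparison[OF always_eventually[OF allI[OF bound]] lim])
  then show ?thesis by (rule LIM_zero_cancel)
qed

theorem theorem1p2:
  shows "\<exists>C C' :: real.
    \<forall>(\<mu> :: 'a::{field,finite} quot measure) (lam :: nat \<Rightarrow> 'a quot measure)
      (L :: nat \<Rightarrow> nat) (c :: nat \<Rightarrow> nat \<Rightarrow> real) (eps :: nat \<Rightarrow> nat \<Rightarrow> direction)
      (k :: nat \<Rightarrow> nat \<Rightarrow> nat) (D :: nat \<Rightarrow> nat \<Rightarrow> nat) (M :: nat \<Rightarrow> int).
      invariant_prob \<mu> \<and>
      (\<forall>T. prob_on_quot (lam T)) \<and>
      (\<forall>T. shadow_decomposition (lam T) (L T) (c T) (eps T) (k T) (D T)) \<and>
      (\<forall>T. M T = margin (L T) (k T) (D T)) \<and>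
      (\<forall>T. M T \<ge> 0)
      \<longrightarrow>
      (\<forall>f \<Phi> T.
         right_K_invariant f \<and> bounded (f ` quot_space) \<and> (\<forall>x\<in>quot_space. f x = \<Phi> (h_K x)) \<longrightarrow>
         cmod ((\<integral>x. f x \<partial>lam T) - (\<integral>x. f x \<partial>\<mu>))
           \<le> C * sup_norm \<Phi> * real CARD('a) powr (- (real_of_int (M T) / 2)) \<and>
         ((\<forall>l\<in>{1..L T}. eps T l = Bwd) \<longrightarrow>
            cmod ((\<integral>x. f x \<partial>lam T) - (\<integral>x. f x \<partial>\<mu>))
              \<le> C' * sup_norm \<Phi> * real CARD('a) powr (- real_of_int (M T)))) \<and>
      (filterlim M at_top sequentially \<longrightarrow>
         (\<forall>f. right_K_invariant f \<and> bounded (f ` quot_space) \<longrightarrow>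
            (\<lambda>T. \<integral>x. f x \<partial>lam T) \<longlonglongrightarrow> (\<integral>x. f x \<partial>\<mu>)))"
proof (rule exI[of _ 4], rule exI[of _ 2], intro allI impI)
  \<comment> \<open>the constants come from the two rates in \<open>walk_limit\<close>\<close>
  fix \<mu> :: "'a quot measure" and lam :: "nat \<Rightarrow> 'a quot measure" and L :: "nat \<Rightarrow> nat"
    and c :: "nat \<Rightarrow> nat \<Rightarrow> real" and eps :: "nat \<Rightarrow> nat \<Rightarrow> direction"
    and k D :: "nat \<Rightarrow> nat \<Rightarrow> nat" and M :: "nat \<Rightarrow> int"
  assume "invariant_prob \<mu> \<and> (\<forall>T. prob_on_quot (lam T)) \<and>
    (\<forall>T. shadow_decomposition (lam T) (L T) (c T) (eps T) (k T) (D T)) \<and>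
    (\<forall>T. M T = margin (L T) (k T) (D T)) \<and> (\<forall>T. M T \<ge> 0)"
  then have hyps: "invariant_prob \<mu>" "\<forall>T. prob_on_quot (lam T)"
      "\<forall>T. shadow_decomposition (lam T) (L T) (c T) (eps T) (k T) (D T)"
      "\<forall>T. M T = margin (L T) (k T) (D T)" "\<forall>T. M T \<ge> 0"
    by blast+
  have bounds: "cmod ((\<integral>x. f x \<partial>lam T) - (\<integral>x. f x \<partial>\<mu>))
           \<le> 4 * sup_norm \<Phi> * real CARD('a) powr (- (real_of_int (M T) / 2)) \<and>
         ((\<forall>l\<in>{1..L T}. eps T l = Bwd) \<longrightarrow>
            cmod ((\<integral>x. f x \<partial>lam T) - (\<integral>x. f x \<partial>\<mu>))
              \<le> 2 * sup_norm \<Phi> * real CARD('a) powr (- real_of_int (M T)))"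
    if "bounded (f ` quot_space)" "\<forall>x\<in>quot_space. f x = \<Phi> (h_K x)" for f \<Phi> T
    using equidistribution_bounds_sup_norm[OF hyps(1) hyps(2-5)[rule_format, of T] that] by blast
  show "(\<forall>f \<Phi> T.
         right_K_invariant f \<and> bounded (f ` quot_space) \<and> (\<forall>x\<in>quot_space. f x = \<Phi> (h_K x)) \<longrightarrow>
         cmod ((\<integral>x. f x \<partial>lam T) - (\<integral>x. f x \<partial>\<mu>))
           \<le> 4 * sup_norm \<Phi> * real CARD('a) powr (- (real_of_int (M T) / 2)) \<and>
         ((\<forall>l\<in>{1..L T}. eps T l = Bwd) \<longrightarrow>
            cmod ((\<integral>x. f x \<partial>lam T) - (\<integral>x. f x \<partial>\<mu>))
              \<le> 2 * sup_norm \<Phi> * real CARD('a) powr (- real_of_int (M T)))) \<and>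
      (filterlim M at_top sequentially \<longrightarrow>
         (\<forall>f. right_K_invariant f \<and> bounded (f ` quot_space) \<longrightarrow>
            (\<lambda>T. \<integral>x. f x \<partial>lam T) \<longlonglongrightarrow> (\<integral>x. f x \<partial>\<mu>)))"
      (is "?bounds \<and> ?limit")
  proof
    show ?bounds
      by (intro allI impI, elim conjE, rule bounds; assumption)
    show ?limit
      by (intro allI impI, elim conjE, rule equidistribution_limit[OF hyps]; assumption)
  qed
qed

end
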